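(* Let $q\in\mathbb C^\times$ be not a root of unity and $t\in\mathbb C^\times$. For any $\alpha,\beta\in\mathbb C$, the quantum Hamiltonian (difference operator in $n$ variables) $$\widetilde{H_{2,1}}=\sum_{i=1}^n\widetilde a_iT_i^2+\sum_{i<j}\widetilde b_{ij}T_iT_j+\alpha\sum_{i=1}^n\prod_{k\ne i}\frac{1-tx_ix_k^{-1}}{1-x_ix_k^{-1}}\,x_i^{-1}T_i+\beta\sum_{i=1}^nx_i^{-1},$$ where $$\widetilde a_i=(qx_i)^{-1}\prod_{j\ne i}\frac{(1-tx_ix_j^{-1})(1-qtx_ix_j^{-1})}{(1-x_ix_j^{-1})(1-qx_ix_j^{-1})},$$ $$\widetilde b_{ij}=\frac{(t-1)(t-q)(x_i^{-1}+x_j^{-1})}{(1-qx_ix_j^{-1})(1-qx_jx_i^{-1})}\prod_{l\ne i,j}\frac{(1-tx_ix_l^{-1})(1-tx_jx_l^{-1})}{(1-x_ix_l^{-1})(1-x_jx_l^{-1})},$$ is completely integrable.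
   Context: $x_1,\dots,x_n$ are independent variables and $T_i$ is the $q$-shift operator in the $i$th variable, $T_ix_j=q^{\delta_{ij}}x_jT_i$. The operators considered lie in the algebra of $q$-difference operators generated over the field of rational functions $\mathbb C(x_1,\dots,x_n)$ by $T_1^{\pm1},\dots,T_n^{\pm1}$. Completely integrable means that the operator belongs to a commutative algebra of such $q$-difference operators containing $n$ algebraically independent elements. *)

theory Defs
  imports Complex_Main "HOL-Library.Poly_Mapping" "HOL-Computational_Algebra.Fraction_Field"
begin

text \<open>
  The variables \<open>x\<^sub>1, \<dots>, x\<^sub>n\<close> are indexed by a finite linearly ordered type \<open>'n\<close> with
  \<open>n = CARD('n)\<close>.
\<close>

type_synonym 'n mpol = "('n \<Rightarrow>\<^sub>0 nat) \<Rightarrow>\<^sub>0 complex"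

type_synonym 'n ratfun = "'n mpol fract"

type_synonym 'n ratop = "'n ratfun \<Rightarrow> 'n ratfun"

definition cst :: "complex \<Rightarrow> 'n::linorder ratfun"
  where "cst c = Fract (Poly_Mapping.single 0 c) 1"

definition var :: "'n::linorder \<Rightarrow> 'n ratfun"
  where "var i = Fract (Poly_Mapping.single (Poly_Mapping.single i 1) 1) 1"

text \<open>The substitution \<open>x\<^sub>i \<mapsto> q x\<^sub>i\<close> in a polynomial, and then in a rational function.\<close>

definition mpol_q_shift :: "complex \<Rightarrow> 'n \<Rightarrow> 'n mpol \<Rightarrow> 'n mpol"
  where "mpol_q_shift q i = Poly_Mapping.mapp (\<lambda>m c. q ^ Poly_Mapping.lookup m i * c)"

definition q_shift :: "complex \<Rightarrow> 'n::linorder \<Rightarrow> 'n ratop"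
  where "q_shift q i f =
    (THE g. \<exists>a b. b \<noteq> 0 \<and> f = Fract a b \<and> g = Fract (mpol_q_shift q i a) (mpol_q_shift q i b))"

text \<open>
  Since \<open>T\<^sub>i\<close> acts on rational functions by an automorphism, the relation
  \<open>T\<^sub>i x\<^sub>j = q\<^bsup>\<delta>\<^sub>i\<^sub>j\<^esup> x\<^sub>j T\<^sub>i\<close> holds as an identity of operators (lemma \<open>q_shift_var_mult\<close> below).
  For \<open>q\<close> not a root of unity the automorphisms given by distinct monomials in the \<open>T\<^sub>i\<close> are
  distinct, hence linearly independent over the rational functions; so the concrete
  algebra of operators below is the algebra of \<open>q\<close>-difference operators.
\<close>

inductive_set qdiff_ops :: "complex \<Rightarrow> 'n::linorder ratop set" for q :: complex
  where
    mult: "(\<lambda>f. r * f) \<in> qdiff_ops q"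
  | shift: "q_shift q i \<in> qdiff_ops q"
  | shift_inv: "inv (q_shift q i) \<in> qdiff_ops q"
  | add: "D \<in> qdiff_ops q \<Longrightarrow> E \<in> qdiff_ops q \<Longrightarrow> (\<lambda>f. D f + E f) \<in> qdiff_ops q"
  | comp: "D \<in> qdiff_ops q \<Longrightarrow> E \<in> qdiff_ops q \<Longrightarrow> D \<circ> E \<in> qdiff_ops q"

definition commutative_qdiff_algebra :: "complex \<Rightarrow> 'n::linorder ratop set \<Rightarrow> bool"
  where "commutative_qdiff_algebra q A \<longleftrightarrow>
    A \<subseteq> qdiff_ops q \<and>
    (\<forall>c. (\<lambda>f. cst c * f) \<in> A) \<and>
    (\<forall>D\<in>A. \<forall>E\<in>A. (\<lambda>f. D f + E f) \<in> A) \<and>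
    (\<forall>D\<in>A. \<forall>E\<in>A. D \<circ> E \<in> A) \<and>
    (\<forall>D\<in>A. \<forall>E\<in>A. D \<circ> E = E \<circ> D)"

text \<open>
  Evaluation of a polynomial in \<open>n\<close> variables at a family of operators. The factors of each
  monomial are composed in increasing order of the index, which is immaterial for the commuting
  families to which this is applied.
\<close>

definition op_monomial :: "('n::{finite,linorder} \<Rightarrow> 'n ratop) \<Rightarrow> ('n \<Rightarrow>\<^sub>0 nat) \<Rightarrow> 'n ratop"
  where "op_monomial P m =
    foldr (\<lambda>i D. (P i ^^ Poly_Mapping.lookup m i) \<circ> D) (sorted_list_of_set UNIV) id"

definition op_eval :: "('n::{finite,linorder} \<Rightarrow> 'n ratop) \<Rightarrow> 'n mpol \<Rightarrow> 'n ratop"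
  where "op_eval P p =
    (\<lambda>f. \<Sum>m\<in>Poly_Mapping.keys p. cst (Poly_Mapping.lookup p m) * op_monomial P m f)"

definition algebraically_independent :: "('n::{finite,linorder} \<Rightarrow> 'n ratop) \<Rightarrow> bool"
  where "algebraically_independent P \<longleftrightarrow> (\<forall>p. op_eval P p = (\<lambda>f. 0) \<longrightarrow> p = 0)"

definition completely_integrable :: "complex \<Rightarrow> 'n::{finite,linorder} ratop \<Rightarrow> bool"
  where "completely_integrable q H \<longleftrightarrow>
    (\<exists>A. commutative_qdiff_algebra q A \<and> H \<in> A \<and>
      (\<exists>P :: 'n \<Rightarrow> 'n ratop. range P \<subseteq> A \<and> algebraically_independent P))"

definition a_coeff :: "complex \<Rightarrow> complex \<Rightarrow> 'n::{finite,linorder} \<Rightarrow> 'n ratfun"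
  where "a_coeff q t i =
    inverse (cst q * var i) *
    (\<Prod>j\<in>UNIV - {i}.
      ((1 - cst t * (var i / var j)) * (1 - cst q * cst t * (var i / var j))) /
      ((1 - var i / var j) * (1 - cst q * (var i / var j))))"

definition b_coeff ::
  "complex \<Rightarrow> complex \<Rightarrow> 'n::{finite,linorder} \<Rightarrow> 'n \<Rightarrow> 'n ratfun"
  where "b_coeff q t i j =
    ((cst t - 1) * (cst t - cst q) * (inverse (var i) + inverse (var j))) /
    ((1 - cst q * (var i / var j)) * (1 - cst q * (var j / var i))) *
    (\<Prod>l\<in>UNIV - {i, j}.
      ((1 - cst t * (var i / var l)) * (1 - cst t * (var j / var l))) /
      ((1 - var i / var l) * (1 - var j / var l)))"

definition H21 ::
  "complex \<Rightarrow> complex \<Rightarrow> complex \<Rightarrow> complex \<Rightarrow> 'n::{finite,linorder} ratop"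
  where "H21 q t \<alpha> \<beta> f =
    (\<Sum>i\<in>UNIV. a_coeff q t i * q_shift q i (q_shift q i f)) +
    (\<Sum>(i, j)\<in>{(i, j). i < j}. b_coeff q t i j * q_shift q i (q_shift q j f)) +
    cst \<alpha> * (\<Sum>i\<in>UNIV.
      (\<Prod>k\<in>UNIV - {i}. (1 - cst t * (var i / var k)) / (1 - var i / var k)) *
      inverse (var i) * q_shift q i f) +
    cst \<beta> * (\<Sum>i\<in>UNIV. inverse (var i)) * f"


section \<open>The shift operators are well defined\<close>

lemma lookup_mpol_q_shift:
  "Poly_Mapping.lookup (mpol_q_shift q i p) m = q ^ Poly_Mapping.lookup m i * Poly_Mapping.lookup p m"
  by (auto simp: mpol_q_shift_def lookup_mapp when_def in_keys_iff)

lemma mpol_q_shift_zero [simp]: "mpol_q_shift q i 0 = 0"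
  by (rule poly_mapping_eqI) (simp add: lookup_mpol_q_shift)

lemma mpol_q_shift_single:
  "mpol_q_shift q i (Poly_Mapping.single m c) = Poly_Mapping.single m (q ^ Poly_Mapping.lookup m i * c)"
  by (rule poly_mapping_eqI) (auto simp: lookup_mpol_q_shift lookup_single when_def)

lemma mpol_q_shift_one [simp]: "mpol_q_shift q i 1 = 1"
  by (simp flip: single_one add: mpol_q_shift_single)

lemma mpol_q_shift_add: "mpol_q_shift q i (p + r) = mpol_q_shift q i p + mpol_q_shift q i r"
  by (rule poly_mapping_eqI) (simp add: lookup_mpol_q_shift lookup_add algebra_simps)

lemma mpol_q_shift_sum: "mpol_q_shift q i (sum g S) = (\<Sum>s\<in>S. mpol_q_shift q i (g s))"
  by (induction S rule: infinite_finite_induct) (simp_all add: mpol_q_shift_add)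

lemma mpol_sum_single:
  fixes p :: "'n mpol"
  shows "p = (\<Sum>m\<in>Poly_Mapping.keys p. Poly_Mapping.single m (Poly_Mapping.lookup p m))"
  by (rule poly_mapping_eqI)
    (auto simp: lookup_sum lookup_single when_def in_keys_iff sum.delta)

lemma mpol_q_shift_mult: "mpol_q_shift q i (p * r) = mpol_q_shift q i p * mpol_q_shift q i r"
proof -
  have s: "mpol_q_shift q i (Poly_Mapping.single m c * Poly_Mapping.single m' c') =
      mpol_q_shift q i (Poly_Mapping.single m c) * mpol_q_shift q i (Poly_Mapping.single m' c')"
    for m m' c c'
    by (simp add: mult_single mpol_q_shift_single lookup_add power_add mult_ac)
  show ?thesis
    by (subst (1 2) mpol_sum_single[of p], subst (1 2) mpol_sum_single[of r])
      (simp add: sum_product mpol_q_shift_sum s)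
qed

lemma mpol_q_shift_eq_0_iff [simp]: "q \<noteq> 0 \<Longrightarrow> mpol_q_shift q i p = 0 \<longleftrightarrow> p = 0"
  by (auto simp: poly_mapping_eq_iff fun_eq_iff lookup_mpol_q_shift)

lemma mpol_q_shift_inverse [simp]:
  "q \<noteq> 0 \<Longrightarrow> mpol_q_shift q i (mpol_q_shift (inverse q) i p) = p"
  by (rule poly_mapping_eqI) (simp add: lookup_mpol_q_shift power_inverse)

lemma q_shift_Fract:
  assumes "q \<noteq> 0" "b \<noteq> 0"
  shows "q_shift q i (Fract a b) = Fract (mpol_q_shift q i a) (mpol_q_shift q i b)"
  unfolding q_shift_def
proof (rule the_equality)
  fix g
  assume "\<exists>a' b'. b' \<noteq> 0 \<and> Fract a b = Fract a' b' \<and>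
    g = Fract (mpol_q_shift q i a') (mpol_q_shift q i b')"
  then obtain a' b' where *: "b' \<noteq> 0" "Fract a b = Fract a' b'"
    "g = Fract (mpol_q_shift q i a') (mpol_q_shift q i b')" by blast
  then have "a * b' = a' * b" using assms by (simp add: eq_fract)
  then have "mpol_q_shift q i a * mpol_q_shift q i b' = mpol_q_shift q i a' * mpol_q_shift q i b"
    by (simp flip: mpol_q_shift_mult)
  then show "g = Fract (mpol_q_shift q i a) (mpol_q_shift q i b)"
    using * assms by (simp add: eq_fract)
qed (use assms in blast)

lemma q_shift_mult: "q \<noteq> 0 \<Longrightarrow> q_shift q i (f * g) = q_shift q i f * q_shift q i g"
  by (cases f; cases g) (simp add: q_shift_Fract mpol_q_shift_mult)

lemma q_shift_add: "q \<noteq> 0 \<Longrightarrow> q_shift q i (f + g) = q_shift q i f + q_shift q i g"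
  by (cases f; cases g) (simp add: q_shift_Fract mpol_q_shift_mult mpol_q_shift_add)

lemma q_shift_cst: "q \<noteq> 0 \<Longrightarrow> q_shift q i (cst c) = cst c"
  by (simp add: cst_def q_shift_Fract mpol_q_shift_single)

lemma q_shift_var: "q \<noteq> 0 \<Longrightarrow> q_shift q i (var j) = (if i = j then cst q * var j else var j)"
  by (simp add: var_def cst_def q_shift_Fract mpol_q_shift_single lookup_single mult_single when_def)

lemma q_shift_var_mult:
  "q \<noteq> 0 \<Longrightarrow> q_shift q i (var j * f) = (if i = j then cst q else 1) * var j * q_shift q i f"
  by (simp add: q_shift_mult q_shift_var)

lemma bij_q_shift:
  assumes "q \<noteq> 0"
  shows "bij (q_shift q i)"
proof -
  have *: "q_shift p i (q_shift (inverse p) i f) = f" if "p \<noteq> 0" for p f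
    using that by (cases f) (simp add: q_shift_Fract)
  have "q_shift (inverse q) i (q_shift q i f) = f" for f
    using *[of "inverse q" f] assms by simp
  then show ?thesis
    using *[OF assms] by (intro bijI') metis+
qed

end

theory Submission
  imports Defs "HOL-Combinatorics.Permutations" "HOL-Library.Cardinality"
begin

text \<open>
  On rational functions act the Hecke generators \<open>T\<^sub>i = t + \<kappa>\<^sub>i (s\<^sub>i - 1)\<close>, the first Cherednik operator
  \<open>Y\<close> and \<open>z\<^sub>0 = 1 / x\<^sub>0\<close>, where indices run through \<open>0, \<dots>, n - 1\<close>. Put
  \<open>D\<^sub>0 = z\<^sub>0 f(Y)\<close> with \<open>f(y) = q\<^sup>-\<^sup>1 y\<^sup>2 + \<alpha> y + \<beta>\<close>. Like \<open>z\<^sub>0\<close> it commutes with \<open>T\<^sub>i\<close> for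
  \<open>i > 0\<close>, and the relations of the double affine Hecke algebra imply
  \<open>D\<^sub>0 T\<^sub>0 D\<^sub>0 T\<^sub>0 = T\<^sub>0 D\<^sub>0 T\<^sub>0 D\<^sub>0\<close>. Hence the operators \<open>D\<^sub>i\<^sub>+\<^sub>1 = t\<^sup>-\<^sup>1 T\<^sub>i D\<^sub>i T\<^sub>i\<close> commute with each other, and
  their elementary symmetric polynomials commute with all \<open>T\<^sub>i\<close> and preserve the symmetric functions. There
  they act as \<open>q\<close>-difference operators, which are determined by their restriction to symmetric
  functions; \<open>D\<^sub>0 + \<dots> + D\<^sub>n\<^sub>-\<^sub>1\<close> acts as the Hamiltonian.

  For the algebraic independence, apply the monomials in the \<open>D\<^sub>i\<close> to a power \<open>g\<close> of
  \<open>z\<^sub>0 \<cdots> z\<^sub>n\<^sub>-\<^sub>1\<close> chosen such that \<open>f(Y)\<close> is injective on the space \<open>W\<close> spanned by \<open>z\<^sup>m g\<close> for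
  \<open>|m| \<le> d\<close>. The functions \<open>D\<^sup>m g\<close> with \<open>|m| \<le> d\<close> then span a space containing \<open>W\<close>, so by counting
  they are linearly independent.
\<close>

section \<open>Hecke algebra relations\<close>

text \<open>The factor q^-1 in f is dictated by (q x_i)^-1 in the coefficient of T_i^2: on a
  symmetric g, Y is the shift in x_0, Y^2 brings in the double shifts, and the Hecke generators
  spread the index 0 over all indices. The commuting operators thus exist only as
  difference-reflection operators; on the difference operators themselves commutation is known only
  through symmetric functions, hence the uniqueness of a difference operator with a given
  restriction. For special \<alpha>, \<beta> the operator f(Y) has a kernel (it contains the
  constants as soon as f(1) = 0), so D_0 cannot be inverted, and the D_i may all vanish on a given
  function. This is why the test function g has to depend on f. As g is symmetric, a nonzero
  polynomial in the D_i cannot vanish on all symmetric functions, although a single D_i need not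
  preserve them. Applied to p(e_1(D), ..., e_n(D)), this reduces the independence of the
  Hamiltonians to that of the elementary symmetric polynomials in ordinary variables, where leading
  monomials decide.\<close>

lemma commutes_inverse: "ti * x = x * ti" if "t * ti = 1" "ti * t = 1" "t * x = x * t"
  for t ti x :: "'a::monoid_mult"
proof -
  have "ti * x = ti * (x * t) * ti" by (simp add: mult.assoc that(1))
  also have "\<dots> = ti * (t * x) * ti" by (simp add: that(3))
  also have "\<dots> = x * ti" by (simp add: that(2) flip: mult.assoc)
  finally show ?thesis .
qed

lemma commutes_left: "y * (x * z) = x * (y * z)" if "x * y = y * x"
  for x y z :: "'a::semigroup_mult"
  by (simp add: that flip: mult.assoc)

lemma commutes_mult: "x * (y * z) = y * z * x" if "x * y = y * x" "x * z = z * x"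
  for x y z :: "'a::semigroup_mult"
proof -
  have "x * (y * z) = y * (x * z)" by (simp add: that(1) flip: mult.assoc)
  then show ?thesis by (simp add: that(2) mult.assoc)
qed

lemma commutes_power: "x * y ^ k = y ^ k * x" if "x * y = y * x" for x y :: "'a::monoid_mult"
  by (rule power_commuting_commutes[symmetric]) (rule that[symmetric])

lemma commutes_sum: "x * sum g A = sum g A * x" if "\<And>a. x * g a = g a * x"
  for x :: "'a::ring_1"
  by (simp add: sum_distrib_left sum_distrib_right that)

text \<open>The relations of the double affine Hecke algebra on the first two strands. A mere ring
  has no scalars, so \<open>t\<close> is an element that commutes with the others. With Z1 =
  \<open>ti * T * Z * T\<close> the relation \<open>cross\<close> reads Y T Z = Z1 Y T.\<close>

locale rank_two =
  fixes T Ti Y Z t ti :: "'a::ring_1"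
  assumes t_ti: "t * ti = 1" "ti * t = 1"
    and t_comm: "t * T = T * t" "t * Y = Y * t" "t * Z = Z * t"
    and T_Ti: "T * Ti = 1" "Ti * T = 1"
    and quad: "T * T = (t - 1) * T + t"
    and braid_Y: "Y * T * Y * T = T * Y * T * Y"
    and braid_Z: "Z * T * Z * T = T * Z * T * Z"
    and cross: "Y * T * Z = ti * (T * Z * T) * (Y * T)"
begin

lemmas ti_comms = t_comm[THEN commutes_inverse[OF t_ti]]

lemma t_ti_left: "t * (ti * x) = x" "ti * (t * x) = x"
  by (simp_all add: t_ti flip: mult.assoc)

lemmas scalars = t_comm[symmetric] ti_comms[symmetric] t_comm[THEN commutes_left] ti_comms[THEN commutes_left]
  t_ti t_ti_left

text \<open>The elements with \<open>Y\<^sup>a T Z = T Z T X\<^sub>a\<close>. They reduce the braid relation for \<open>Z f(Y)\<close> to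
  identities in the algebra generated by \<open>T\<close> and \<open>Y\<close> alone.\<close>

definition X :: "nat \<Rightarrow> 'a" where
  "X a = (if a = 0 then Ti else if a = 1 then ti * Y * T else ti * ti * Y * T * T * Y * T)"

lemma X_simps: "X 0 = Ti" "X 1 = ti * Y * T" "X 2 = ti * ti * Y * T * T * Y * T"
  by (simp_all add: X_def)

text \<open>The case a = 1 is \<open>cross\<close>, and a = 2 applies it twice, whence
  \<open>X 2 = X 1 * T * X 1\<close>; for a = 0 the factor \<open>X 0 = Ti\<close> removes the
  surplus \<open>T\<close>.\<close>

lemma Y_pow_TZ:
  assumes "a \<le> 2" shows "Y ^ a * T * Z = T * Z * T * X a"
proof -
  have 0: "T * Z = T * Z * T * Ti" by (simp add: mult.assoc T_Ti)
  have 1: "Y * T * Z = T * Z * T * (ti * Y * T)"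
    unfolding cross by (simp add: mult.assoc scalars)
  have "Y * (Y * T * Z) = Y * (T * Z * T * (ti * Y * T))"
    by (simp only: 1)
  also have "\<dots> = (Y * T * Z) * (T * (ti * Y * T))"
    by (simp only: mult.assoc)
  also have "\<dots> = T * Z * T * (ti * Y * T * (T * (ti * Y * T)))"
    by (simp only: 1) (simp only: mult.assoc)
  also have "ti * Y * T * (T * (ti * Y * T)) = ti * ti * Y * T * T * Y * T"
    by (simp add: mult.assoc scalars)
  finally have 2: "Y * Y * T * Z = T * Z * T * (ti * ti * Y * T * T * Y * T)"
    by (simp add: mult.assoc)
  from assms consider "a = 0" | "a = 1" | "a = 2" by linarith
  then show ?thesis
    using 0 1 2 by cases (simp_all only: X_simps power_0 power_one_right power2_eq_square mult_1_left)
qed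

text \<open>The product of \<open>Y\<close> and \<open>T * Y * T\<close>, which commute by
  \<open>braid_Y\<close>. It is central in the algebra generated by \<open>T\<close> and
  \<open>Y\<close>, so the identities for \<open>X\<close> can be checked by collecting it.\<close>

definition B where "B = Y * T * Y * T"

lemma B_comm: "B * T = T * B" "B * Y = Y * B"
proof -
  have "B * T = (T * Y * T * Y) * T" unfolding B_def by (subst braid_Y) (rule refl)
  then show "B * T = T * B" by (simp only: B_def mult.assoc)
  have "Y * B = Y * (T * Y * T * Y)" unfolding B_def by (subst braid_Y) (rule refl)
  then show "B * Y = Y * B" by (simp only: B_def mult.assoc)
qed

lemma B_fold: "Y * (T * (Y * T)) = B" "T * (Y * (T * Y)) = B"
    "Y * (T * (Y * (T * x))) = B * x" "T * (Y * (T * (Y * x))) = B * x"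
proof -
  show 1: "Y * (T * (Y * T)) = B" by (simp add: B_def mult.assoc)
  show 2: "T * (Y * (T * Y)) = B" using braid_Y by (simp add: B_def mult.assoc)
  show "Y * (T * (Y * (T * x))) = B * x" using 1 by (simp flip: mult.assoc)
  show "T * (Y * (T * (Y * x))) = B * x" using 2 by (simp flip: mult.assoc)
qed

lemma ti_B: "ti * B = B * ti" by (simp add: B_def mult.assoc scalars)

lemmas B_left = B_comm[symmetric] B_comm[THEN commutes_left] ti_B[symmetric] ti_B[THEN commutes_left]

lemma Ti_eq: "Ti = ti * T - ti * (t - 1)"
proof -
  have "(ti * T - ti * (t - 1)) * T = ti * (T * T - (t - 1) * T)"
    by (simp add: algebra_simps)
  also have "\<dots> = 1" by (simp add: quad t_ti)
  finally have "(ti * T - ti * (t - 1)) * T * Ti = Ti" by simp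
  then show ?thesis by (simp add: mult.assoc T_Ti)
qed

lemma YTTYT: "Y * T * T * Y * T = (t - 1) * B + t * Y * Y * T"
proof -
  have "Y * T * T * Y * T = Y * (T * T) * Y * T" by (simp add: mult.assoc)
  also have "\<dots> = (t - 1) * B + t * Y * Y * T"
    unfolding quad B_def by (simp add: algebra_simps scalars)
  finally show ?thesis .
qed

text \<open>Put Y1 = \<open>ti * T * Y * T\<close>, which commutes with \<open>Y\<close>. Then
  \<open>X a\<close> is \<open>Ti\<close> times the a-th power of Y1 for a \<le> 2, so
  \<open>X a * Y ^ b + X b * Y ^ a\<close> is \<open>Ti\<close> times a symmetric polynomial in Y
  and Y1. Symmetric polynomials in this pair commute with \<open>T\<close> (Bernstein); the cases
  needed are checked by hand here and in the next lemmas.\<close>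

lemma X_sym_01: "X 0 * Y * T + X 1 * T = T * X 0 * Y + T * X 1"
proof -
  have *: "ti * (Y * (T * T)) = ti * (t - 1) * (Y * T) + Y"
  proof -
    have "ti * (Y * (T * T)) = ti * (t * (Y * T)) - ti * (Y * T) + ti * (t * Y)"
      unfolding quad by (simp add: algebra_simps scalars)
    also have "\<dots> = ti * (t - 1) * (Y * T) + Y"
      by (simp add: algebra_simps t_ti) (simp add: t_ti flip: mult.assoc)
    finally show ?thesis .
  qed
  have "X 0 * Y * T + X 1 * T = ti * (T * (Y * T)) - ti * (t - 1) * (Y * T) + ti * (Y * (T * T))"
    unfolding X_simps unfolding Ti_eq by (simp add: algebra_simps)
  also have "\<dots> = ti * (T * (Y * T)) + Y" unfolding * by simp
  also have "\<dots> = T * X 0 * Y + T * X 1"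
    by (simp only: X_simps T_Ti) (simp add: algebra_simps scalars)
  finally show ?thesis .
qed

lemma X_sym_02: "X 0 * Y\<^sup>2 * T + X 2 * T = T * X 0 * Y\<^sup>2 + T * X 2"
proof -
  have X2: "X 2 = ti * ti * ((t - 1) * B) + ti * (Y\<^sup>2 * T)"
  proof -
    have "X 2 = ti * ti * (Y * T * T * Y * T)" by (simp only: X_simps mult.assoc)
    also have "\<dots> = ti * ti * ((t - 1) * B) + ti * (ti * t) * (Y\<^sup>2 * T)"
      unfolding YTTYT by (simp add: algebra_simps power2_eq_square)
    finally show ?thesis by (simp add: t_ti)
  qed
  have *: "ti * (Y\<^sup>2 * (T * T)) = ti * (t - 1) * (Y\<^sup>2 * T) + Y\<^sup>2"
  proof -
    have "ti * (Y\<^sup>2 * (T * T)) = ti * (t * (Y\<^sup>2 * T)) - ti * (Y\<^sup>2 * T) + ti * (t * Y\<^sup>2)"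
      unfolding quad power2_eq_square by (simp add: algebra_simps scalars)
    also have "\<dots> = ti * (t - 1) * (Y\<^sup>2 * T) + Y\<^sup>2"
      by (simp add: algebra_simps scalars)
    finally show ?thesis .
  qed
  have "X 0 * Y\<^sup>2 * T + X 2 * T = ti * (T * (Y\<^sup>2 * T)) - ti * (t - 1) * (Y\<^sup>2 * T)
      + ti * ti * ((t - 1) * (B * T)) + ti * (Y\<^sup>2 * (T * T))"
    unfolding X2 X_simps unfolding Ti_eq by (simp add: algebra_simps)
  also have "\<dots> = ti * (T * (Y\<^sup>2 * T)) + ti * ti * ((t - 1) * (T * B)) + Y\<^sup>2"
    unfolding * B_comm by simp
  also have "ti * ti * ((t - 1) * (T * B)) = T * (ti * ti * ((t - 1) * B))"
    by (simp add: algebra_simps scalars)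
  also have "ti * (T * (Y\<^sup>2 * T)) = T * (ti * (Y\<^sup>2 * T))"
    by (simp add: algebra_simps scalars)
  also have "T * (ti * (Y\<^sup>2 * T)) + T * (ti * ti * ((t - 1) * B)) + Y\<^sup>2 = T * X 0 * Y\<^sup>2 + T * X 2"
    unfolding X2 by (simp only: X_simps T_Ti) (simp add: algebra_simps)
  finally show ?thesis .
qed

text \<open>As x y^2 + x^2 y = x y (x + y), both sides are \<open>ti * B\<close> times those of
  \<open>X_sym_01\<close>.\<close>

lemma X_sym_12: "X 1 * Y\<^sup>2 * T + X 2 * Y * T = T * X 1 * Y\<^sup>2 + T * X 2 * Y"
proof -
  have 1: "X 1 * Y\<^sup>2 * T = ti * B * (X 0 * Y * T)"
  proof -
    have "X 1 * Y\<^sup>2 * T = ti * ((Y * T * Y * (T * Ti)) * (Y * T))"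
      unfolding X_simps power2_eq_square T_Ti by (simp add: mult.assoc)
    also have "\<dots> = ti * B * (X 0 * Y * T)"
      unfolding X_simps B_def by (simp only: mult.assoc)
    finally show ?thesis .
  qed
  have 2: "X 2 * Y * T = ti * B * (X 1 * T)"
    unfolding X_simps by (simp add: mult.assoc scalars B_fold B_left)
  have 3: "T * X 1 * Y\<^sup>2 = ti * B * (T * X 0 * Y)"
    unfolding X_simps T_Ti power2_eq_square by (simp add: mult.assoc scalars B_fold B_left)
  have 4: "T * X 2 * Y = ti * B * (T * X 1)"
    unfolding X_simps by (simp add: mult.assoc scalars B_fold B_left)
  show ?thesis
    unfolding 1 2 3 4 distrib_left[symmetric] X_sym_01 ..
qed

text \<open>The diagonal case is wanted undoubled: the symmetrised identity with a = b gives only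
  twice this one, and 2 cannot be cancelled in a general ring.\<close>

lemma X_sym_same: "a \<le> 2 \<Longrightarrow> X a * Y ^ a * T = T * X a * Y ^ a"
proof -
  assume "a \<le> 2"
  then consider "a = 0" | "a = 1" | "a = 2" by linarith
  then show ?thesis
  proof cases
    case 1
    then show ?thesis by (simp add: X_simps T_Ti)
  next
    case 2
    show ?thesis
      unfolding 2 X_simps by (simp add: mult.assoc scalars B_fold B_left)
  next
    case 3
    show ?thesis
      unfolding 3 X_simps power2_eq_square by (simp add: mult.assoc scalars B_fold B_left)
  qed
qed

lemma X_sym:
  assumes "a \<le> 2" "b \<le> 2"
  shows "X a * Y ^ b * T + X b * Y ^ a * T = T * X a * Y ^ b + T * X b * Y ^ a"
proof -
  have 1: "X 0 * Y ^ 1 * T + X 1 * Y ^ 0 * T = T * X 0 * Y ^ 1 + T * X 1 * Y ^ 0"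
    using X_sym_01 by (simp only: power_0 power_one_right mult_1_right)
  have 2: "X 0 * Y ^ 2 * T + X 2 * Y ^ 0 * T = T * X 0 * Y ^ 2 + T * X 2 * Y ^ 0"
    using X_sym_02 by (simp only: power_0 mult_1_right)
  have 3: "X 1 * Y ^ 2 * T + X 2 * Y ^ 1 * T = T * X 1 * Y ^ 2 + T * X 2 * Y ^ 1"
    using X_sym_12 by (simp only: power_one_right)
  have sym: "X b * Y ^ a * T + X a * Y ^ b * T = T * X b * Y ^ a + T * X a * Y ^ b"
    if "X a * Y ^ b * T + X b * Y ^ a * T = T * X a * Y ^ b + T * X b * Y ^ a" for a b
    using that by (simp only: add.commute)
  have "a = b \<or> a = 0 \<and> b = 1 \<or> a = 1 \<and> b = 0 \<or> a = 0 \<and> b = 2 \<or> a = 2 \<and> b = 0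
      \<or> a = 1 \<and> b = 2 \<or> a = 2 \<and> b = 1"
    using assms by arith
  then show ?thesis
    using 1 2 3 sym[OF 1] sym[OF 2] sym[OF 3] X_sym_same[OF assms(1)] by (elim disjE conjE) (simp_all only:)
qed

lemma W_comm: "Z * (T * Z * T) * T = T * (Z * (T * Z * T))"
  using braid_Z by (simp add: mult.assoc)

text \<open>\<open>Y_pow_TZ\<close> gathers both factors \<open>Z\<close> on the left in
  \<open>?W\<close>, which commutes with \<open>T\<close> by \<open>braid_Z\<close>; what remains to
  be compared is \<open>X_sym\<close>.\<close>

lemma ZY_sym:
  assumes "a \<le> 2" "b \<le> 2"
  shows "Z * Y ^ a * T * Z * Y ^ b * T + Z * Y ^ b * T * Z * Y ^ a * T =
    T * Z * Y ^ a * T * Z * Y ^ b + T * Z * Y ^ b * T * Z * Y ^ a"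
proof -
  let ?W = "Z * (T * Z * T)"
  have R: "Z * Y ^ a * T * Z * Y ^ b * T = ?W * (X a * Y ^ b * T)" if "a \<le> 2" for a b
  proof -
    have "Z * Y ^ a * T * Z * Y ^ b * T = Z * (Y ^ a * T * Z) * Y ^ b * T" by (simp only: mult.assoc)
    then show ?thesis unfolding Y_pow_TZ[OF that] by (simp only: mult.assoc)
  qed
  have L: "T * Z * Y ^ a * T * Z * Y ^ b = ?W * (T * X a * Y ^ b)" if "a \<le> 2" for a b
  proof -
    have "T * Z * Y ^ a * T * Z * Y ^ b = T * Z * (Y ^ a * T * Z) * Y ^ b" by (simp only: mult.assoc)
    also have "\<dots> = T * ?W * (X a * Y ^ b)" unfolding Y_pow_TZ[OF that] by (simp only: mult.assoc)
    also have "\<dots> = ?W * T * (X a * Y ^ b)" by (simp only: W_comm)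
    finally show ?thesis by (simp only: mult.assoc)
  qed
  show ?thesis
    unfolding R[OF assms(1)] R[OF assms(2)] L[OF assms(1)] L[OF assms(2)]
    using X_sym[OF assms] by (simp flip: distrib_left)
qed

text \<open>Expanding the relation gives a double sum over a and b with coefficients
  \<open>f a * f b\<close>, which are symmetric in a and b. So the terms (a, b) and (b, a) need to
  match only together, and this is \<open>ZY_sym\<close>.\<close>

lemma braid_quadratic:
  fixes f :: "nat \<Rightarrow> 'a"
  assumes "\<And>a. f a * T = T * f a" "\<And>a. f a * Y = Y * f a" "\<And>a. f a * Z = Z * f a"
    and "\<And>a b. f a * f b = f b * f a"
  defines "D \<equiv> Z * (\<Sum>a\<le>2. f a * Y ^ a)"
  shows "D * T * D * T = T * D * T * D"
proof -
  have fY: "f a * Y ^ b = Y ^ b * f a" for a b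
    by (rule power_commuting_commutes[symmetric]) (simp add: assms)
  note mv = assms(1-3)[symmetric] fY[symmetric] assms(1-3)[THEN commutes_left] fY[THEN commutes_left]
  have dbl: "U * (\<Sum>a\<le>2. u a) * V * (\<Sum>b\<le>2. u b) * T' = (\<Sum>a\<le>2. \<Sum>b\<le>2. U * u a * V * u b * T')"
    for U V T' and u :: "nat \<Rightarrow> 'a"
  proof -
    have 1: "U * (\<Sum>a\<le>2. u a) * V = (\<Sum>a\<le>2. U * u a * V)"
      by (simp only: sum_distrib_left sum_distrib_right)
    have 2: "(\<Sum>b\<le>2. u b) * T' = (\<Sum>b\<le>2. u b * T')"
      by (simp only: sum_distrib_left sum_distrib_right)
    have "U * (\<Sum>a\<le>2. u a) * V * (\<Sum>b\<le>2. u b) * T' =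
        (\<Sum>a\<le>2. U * u a * V) * (\<Sum>b\<le>2. u b * T')"
      unfolding 1[symmetric] 2[symmetric] by (simp only: mult.assoc)
    also have "\<dots> = (\<Sum>a\<le>2. \<Sum>b\<le>2. U * u a * V * u b * T')"
      unfolding sum_product by (simp only: mult.assoc)
    finally show ?thesis .
  qed
  have e: "D * T * D * T = (\<Sum>a\<le>2. \<Sum>b\<le>2. f a * f b * (Z * Y ^ a * T * Z * Y ^ b * T))"
  proof -
    have "D * T * D * T = Z * (\<Sum>a\<le>2. f a * Y ^ a) * (T * Z) * (\<Sum>b\<le>2. f b * Y ^ b) * T"
      by (simp only: D_def mult.assoc)
    then show ?thesis
      unfolding dbl by (simp add: mult.assoc mv)
  qed
  have e': "T * D * T * D = (\<Sum>a\<le>2. \<Sum>b\<le>2. f a * f b * (T * Z * Y ^ a * T * Z * Y ^ b))"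
  proof -
    have "T * D * T * D = T * Z * (\<Sum>a\<le>2. f a * Y ^ a) * (T * Z) * (\<Sum>b\<le>2. f b * Y ^ b) * 1"
      by (simp add: D_def mult.assoc)
    then show ?thesis
      unfolding dbl by (simp add: mult.assoc mv)
  qed
  have s: "R 0 1 + R 1 0 = L 0 1 + L 1 0 \<Longrightarrow> R 0 2 + R 2 0 = L 0 2 + L 2 0 \<Longrightarrow>
      R 1 2 + R 2 1 = L 1 2 + L 2 1 \<Longrightarrow> R 0 0 = L 0 0 \<Longrightarrow> R 1 1 = L 1 1 \<Longrightarrow> R 2 2 = L 2 2 \<Longrightarrow>
      (\<Sum>a\<le>2. \<Sum>b\<le>2. R a b) = (\<Sum>a\<le>2. \<Sum>b\<le>2. L a b)"
    for R L :: "nat \<Rightarrow> nat \<Rightarrow> 'a"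
  proof -
    assume h: "R 0 1 + R 1 0 = L 0 1 + L 1 0" "R 0 2 + R 2 0 = L 0 2 + L 2 0"
      "R 1 2 + R 2 1 = L 1 2 + L 2 1" "R 0 0 = L 0 0" "R 1 1 = L 1 1" "R 2 2 = L 2 2"
    have ex: "(\<Sum>a\<le>2. \<Sum>b\<le>(2::nat). M a b) = M 0 0 + M 1 1 + M 2 2 + (M 0 1 + M 1 0) + (M 0 2 + M 2 0) + (M 1 2 + M 2 1)"
      for M :: "nat \<Rightarrow> nat \<Rightarrow> 'a"
      by (simp add: numeral_2_eq_2 algebra_simps)
    show ?thesis unfolding ex h ..
  qed
  have p: "f a * f b * (Z * Y ^ a * T * Z * Y ^ b * T) + f b * f a * (Z * Y ^ b * T * Z * Y ^ a * T)
     = f a * f b * (T * Z * Y ^ a * T * Z * Y ^ b) + f b * f a * (T * Z * Y ^ b * T * Z * Y ^ a)"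
    if "a \<le> 2" "b \<le> 2" for a b
    unfolding assms(4)[of b a] using ZY_sym[OF that] by (simp flip: distrib_left)
  have d: "Z * Y ^ a * T * Z * Y ^ a * T = T * Z * Y ^ a * T * Z * Y ^ a" if "a \<le> 2" for a
  proof -
    have "Z * Y ^ a * T * Z * Y ^ a * T = Z * (Y ^ a * T * Z) * (Y ^ a * T)" by (simp only: mult.assoc)
    also have "\<dots> = Z * (T * Z * T) * (X a * Y ^ a * T)" unfolding Y_pow_TZ[OF that] by (simp only: mult.assoc)
    also have "\<dots> = Z * (T * Z * T) * (T * X a * Y ^ a)" unfolding X_sym_same[OF that] ..
    also have "\<dots> = Z * (T * Z * T) * T * (X a * Y ^ a)" by (simp only: mult.assoc)
    also have "\<dots> = T * Z * (T * Z * T * X a) * Y ^ a" unfolding W_comm by (simp only: mult.assoc)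
    also have "\<dots> = T * Z * Y ^ a * T * Z * Y ^ a" unfolding Y_pow_TZ[OF that, symmetric] by (simp only: mult.assoc)
    finally show ?thesis .
  qed
  show ?thesis
    unfolding e e'
    by (rule s; (rule p)?) (simp_all only: d zero_le one_le_numeral order_refl)
qed

end

section \<open>Finite and affine Hecke algebras\<close>

fun esym :: "(nat \<Rightarrow> 'a::ring_1) \<Rightarrow> nat \<Rightarrow> nat \<Rightarrow> 'a" where
  "esym X k 0 = 1"
| "esym X 0 (Suc r) = 0"
| "esym X (Suc k) (Suc r) = esym X k (Suc r) + X k * esym X k r"

text \<open>Here \<open>n\<close> counts the generators, one less than the variables they act
  on.\<close>

locale hecke =
  fixes T :: "nat \<Rightarrow> 'a::ring_1" and t ti :: 'a and n :: nat
  assumes t_ti: "t * ti = 1" "ti * t = 1"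
    and t_T: "i < n \<Longrightarrow> t * T i = T i * t"
    and quad: "i < n \<Longrightarrow> T i * T i = (t - 1) * T i + t"
    and braid: "Suc i < n \<Longrightarrow> T i * T (Suc i) * T i = T (Suc i) * T i * T (Suc i)"
    and far: "Suc i < j \<Longrightarrow> j < n \<Longrightarrow> T i * T j = T j * T i"
begin

lemma t_ti_left: "t * (ti * x) = x" "ti * (t * x) = x"
  by (simp_all add: t_ti flip: mult.assoc)

lemma scalars_T:
  assumes "i < n"
  shows "T i * t = t * T i" "T i * (t * x) = t * (T i * x)"
    "T i * ti = ti * T i" "T i * (ti * x) = ti * (T i * x)"
proof -
  note c = t_T[OF assms] and c' = commutes_inverse[OF t_ti t_T[OF assms]]
  show "T i * t = t * T i" "T i * ti = ti * T i" using c c' by simp_all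
  show "T i * (t * x) = t * (T i * x)" "T i * (ti * x) = ti * (T i * x)"
    by (rule commutes_left, rule c) (rule commutes_left, rule c')
qed

lemma far': "T i * T j = T j * T i" if "i < n" "j < n" "Suc i \<noteq> j" "i \<noteq> Suc j"
  using far[of i j] far[of j i] that by (cases i j rule: linorder_cases) auto

definition S :: "nat \<Rightarrow> 'a" where "S i = T i - (t - 1)"

lemma S_T: "i < n \<Longrightarrow> S i * T i = t" "i < n \<Longrightarrow> T i * S i = t"
  by (simp_all add: S_def quad scalars_T algebra_simps)

lemma S_commute: "S i * x = x * S i" if "T i * x = x * T i" "t * x = x * t"
  using that by (simp add: S_def algebra_simps)

lemma t_S: "i < n \<Longrightarrow> t * S i = S i * t"
  by (simp add: S_def algebra_simps scalars_T)

lemma scalars_S: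
  assumes "i < n"
  shows "S i * t = t * S i" "S i * (t * x) = t * (S i * x)"
    "S i * ti = ti * S i" "S i * (ti * x) = ti * (S i * x)"
proof -
  note c = t_S[OF assms] and c' = commutes_inverse[OF t_ti t_S[OF assms]]
  show "S i * t = t * S i" "S i * ti = ti * S i" using c c' by simp_all
  show "S i * (t * x) = t * (S i * x)" "S i * (ti * x) = ti * (S i * x)"
    by (rule commutes_left, rule c) (rule commutes_left, rule c')
qed

lemma S_braid:
  assumes "Suc i < n"
  shows "S i * S (Suc i) * S i = S (Suc i) * S i * S (Suc i)"
proof -
  have i: "i < n" using assms by simp
  have q: "T j * (T j * x) = (t - 1) * (T j * x) + t * x" if "j < n" for j x
  proof -
    have "T j * (T j * x) = T j * T j * x" by (simp only: mult.assoc)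
    then show ?thesis by (simp add: quad[OF that] algebra_simps)
  qed
  show ?thesis
    using braid[OF assms]
    by (simp add: S_def algebra_simps scalars_T i assms q quad[OF i] quad[OF assms])
qed

text \<open>\<open>T\<close> and \<open>S\<close> differ by the scalar \<open>t - 1\<close>, so the
  braid relation for \<open>S\<close> yields this mixed form, which later moves a generator through
  \<open>P\<close>.\<close>

lemma SST: "Suc i < n \<Longrightarrow> S (Suc i) * S i * T (Suc i) = T i * S (Suc i) * S i"
proof -
  assume a: "Suc i < n"
  then have c: "S (Suc i) * S i * (t - 1) = (t - 1) * (S (Suc i) * S i)"
    by (simp add: algebra_simps scalars_S)
  have T: "T j = S j + (t - 1)" for j by (simp add: S_def)
  have "S (Suc i) * S i * T (Suc i) = S (Suc i) * S i * S (Suc i) + S (Suc i) * S i * (t - 1)"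
    by (simp only: T distrib_left)
  also have "\<dots> = S i * S (Suc i) * S i + (t - 1) * (S (Suc i) * S i)"
    by (simp only: S_braid[OF a] c)
  also have "\<dots> = T i * S (Suc i) * S i"
    by (simp only: T distrib_right mult.assoc)
  finally show ?thesis .
qed

primrec tower :: "'a \<Rightarrow> nat \<Rightarrow> 'a" where
  "tower X 0 = X"
| "tower X (Suc k) = ti * T k * tower X k * T k"

end

text \<open>The relations between the first polynomial generator of an affine Hecke algebra and the
  finite generators, without its inverse: \<open>D0\<close> need not be invertible.\<close>

locale affine_hecke = hecke +
  fixes X0 :: 'a
  assumes t_X0: "t * X0 = X0 * t"
    and X0_T: "0 < i \<Longrightarrow> i < n \<Longrightarrow> X0 * T i = T i * X0"
    and X0_braid: "0 < n \<Longrightarrow> X0 * T 0 * X0 * T 0 = T 0 * X0 * T 0 * X0"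
begin

abbreviation "X \<equiv> tower X0"

lemma t_X: "i \<le> n \<Longrightarrow> t * X i = X i * t"
proof (induction i)
  case (Suc i)
  then have "i < n" and IH: "t * X i = X i * t" by auto
  then have IH': "X i * (t * x) = t * (X i * x)" for x using commutes_left by blast
  show ?case
    using scalars_T[OF \<open>i < n\<close>] IH by (simp add: mult.assoc IH' t_ti t_ti_left)
qed (simp add: t_X0)

lemma scalars_X:
  assumes "i \<le> n"
  shows "X i * t = t * X i" "X i * (t * x) = t * (X i * x)"
    "X i * ti = ti * X i" "X i * (ti * x) = ti * (X i * x)"
proof -
  note c = t_X[OF assms] and c' = commutes_inverse[OF t_ti t_X[OF assms]]
  show "X i * t = t * X i" "X i * ti = ti * X i" using c c' by simp_all
  show "X i * (t * x) = t * (X i * x)" "X i * (ti * x) = ti * (X i * x)"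
    by (rule commutes_left, rule c) (rule commutes_left, rule c')
qed

lemma T_X_greater: "i < j \<Longrightarrow> j < n \<Longrightarrow> T j * X i = X i * T j"
proof (induction i)
  case (Suc i)
  then have c: "T i * T j = T j * T i" and IH: "T j * X i = X i * T j"
    by (auto intro: far)
  have i: "i < n" using Suc by simp
  have "T j * X (Suc i) = ti * (T j * T i) * X i * T i"
    using Suc by (simp add: mult.assoc scalars_T)
  also have "\<dots> = ti * T i * (T j * X i) * T i" by (simp only: c[symmetric] mult.assoc)
  also have "\<dots> = ti * T i * X i * (T j * T i)" by (simp only: IH mult.assoc)
  finally show ?case by (simp only: c[symmetric] mult.assoc tower.simps)
qed (simp add: X0_T)

text \<open>The critical element is X_(j+2), a multiple of T_(j+1) T_j X_j T_j T_(j+1). The braid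
  relation lets T_j enter as T_(j+1), which commutes with X_j, and a second use of it lets T_j leave
  on the right.\<close>

lemma T_X_less: "Suc j < i \<Longrightarrow> i \<le> n \<Longrightarrow> T j * X i = X i * T j"
proof (induction i)
  case (Suc i)
  then have i: "i < n" "j < n" by auto
  show ?case
  proof (cases "Suc j = i")
    case False
    then have c: "T i * T j = T j * T i" and IH: "T j * X i = X i * T j"
      using Suc far[of j i] by auto
    have "T j * X (Suc i) = ti * (T j * T i) * X i * T i"
      using i by (simp add: mult.assoc scalars_T)
    also have "\<dots> = ti * T i * (T j * X i) * T i" by (simp only: c[symmetric] mult.assoc)
    also have "\<dots> = ti * T i * X i * (T j * T i)" by (simp only: IH mult.assoc)
    finally show ?thesis by (simp only: c[symmetric] mult.assoc tower.simps)
  next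
    case True
    have b: "T j * T i * T j = T i * T j * T i" using braid[of j] True i by simp
    have g: "T i * X j = X j * T i" using T_X_greater[of j i] True i by simp
    have X: "X (Suc i) = ti * ti * (T i * T j * X j * T j * T i)"
      using i True[symmetric] by (simp add: mult.assoc scalars_T)
    have "T j * X (Suc i) = ti * ti * (T j * T i * T j * X j * T j * T i)"
      unfolding X using i by (simp add: mult.assoc scalars_T)
    also have "\<dots> = ti * ti * (T i * T j * (T i * X j) * T j * T i)"
      unfolding b by (simp only: mult.assoc)
    also have "\<dots> = ti * ti * (T i * T j * X j * (T i * T j * T i))"
      unfolding g by (simp only: mult.assoc)
    also have "\<dots> = X (Suc i) * T j"
      unfolding b[symmetric] X by (simp only: mult.assoc)
    finally show ?thesis .
  qed
qed simp

lemma T_X: "j < n \<Longrightarrow> i \<le> n \<Longrightarrow> i \<noteq> j \<Longrightarrow> i \<noteq> Suc j \<Longrightarrow> T j * X i = X i * T j"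
  using T_X_greater[of i j] T_X_less[of j i] by (cases i j rule: linorder_cases) auto

lemma X0_X: "i \<le> n \<Longrightarrow> X0 * X i = X i * X0"
proof (induction i)
  case (Suc i)
  show ?case
  proof (cases "i = 0")
    case True
    have "X0 * X 1 = ti * (X0 * T 0 * X0 * T 0)"
      using scalars_X[of 0] by (simp add: mult.assoc)
    also have "\<dots> = X 1 * X0" using X0_braid Suc by (simp add: mult.assoc)
    finally show ?thesis using True by simp
  next
    case False
    then have c: "X0 * T i = T i * X0" and IH: "X0 * X i = X i * X0"
      using Suc X0_T by auto
    have "X0 * X (Suc i) = ti * (X0 * T i) * X i * T i"
      using scalars_X[of 0] by (simp add: mult.assoc)
    also have "\<dots> = ti * T i * (X0 * X i) * T i" by (simp only: c mult.assoc)
    also have "\<dots> = ti * T i * X i * (X0 * T i)" by (simp only: IH mult.assoc)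
    finally show ?thesis by (simp only: c mult.assoc tower.simps)
  qed
qed simp

lemma X_X_less: "i < j \<Longrightarrow> j \<le> n \<Longrightarrow> X i * X j = X j * X i"
proof (induction i)
  case (Suc i)
  then have c: "T i * X j = X j * T i" and IH: "X i * X j = X j * X i"
    using T_X_less by auto
  have "X (Suc i) * X j = ti * T i * X i * (T i * X j)" by (simp only: mult.assoc tower.simps)
  also have "\<dots> = ti * T i * (X i * X j) * T i" by (simp only: c mult.assoc)
  also have "\<dots> = ti * (T i * X j) * X i * T i" by (simp only: IH mult.assoc)
  also have "\<dots> = X j * X (Suc i)" using scalars_X[of j] Suc.prems by (simp add: c mult.assoc)
  finally show ?case .
qed (simp add: X0_X)

lemma X_X: "i \<le> n \<Longrightarrow> j \<le> n \<Longrightarrow> X i * X j = X j * X i"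
  using X_X_less[of i j] X_X_less[of j i] by (cases i j rule: linorder_cases) auto

text \<open>This and the next lemma are the Bernstein relations. Their consequence is that the sum
  and the product of \<open>X i\<close> and \<open>X (Suc i)\<close> commute with
  \<open>T i\<close>.\<close>

lemma T_X_same: "i < n \<Longrightarrow> T i * X i = X (Suc i) * S i"
  by (simp add: mult.assoc S_T scalars_X) (simp add: t_ti_left scalars_T)

lemma T_X_Suc: "i < n \<Longrightarrow> T i * X (Suc i) = (t - 1) * X (Suc i) + X i * T i"
proof -
  assume i: "i < n"
  have "T i * X (Suc i) = ti * (T i * T i) * (X i * T i)" using i by (simp add: mult.assoc scalars_T)
  also have "\<dots> = (t - 1) * X (Suc i) + X i * T i"
    unfolding quad[OF i] by (simp add: algebra_simps t_ti_left)
  finally show ?thesis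
    by simp
qed

lemma T_X_add: "i < n \<Longrightarrow> T i * (X i + X (Suc i)) = (X i + X (Suc i)) * T i"
  by (simp add: algebra_simps T_X_same T_X_Suc S_def scalars_X del: tower.simps)

lemma T_X_mult: "i < n \<Longrightarrow> T i * (X i * X (Suc i)) = X i * X (Suc i) * T i"
proof -
  assume i: "i < n"
  have "S i * X (Suc i) = X i * T i"
    using T_X_Suc[OF i] by (simp add: S_def algebra_simps del: tower.simps)
  moreover have "T i * (X i * X (Suc i)) = X (Suc i) * (S i * X (Suc i))"
    using T_X_same[OF i] by (simp flip: mult.assoc del: tower.simps)
  ultimately show ?thesis using X_X[of i "Suc i"] i by (simp flip: mult.assoc del: tower.simps)
qed

text \<open>The bound k must not separate \<open>X j\<close> from \<open>X (Suc j)\<close>. For k =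
  j + 2 the recursion is unfolded twice, so that these two enter only through their sum and their
  product.\<close>

lemma T_esym: "j < n \<Longrightarrow> k \<le> Suc n \<Longrightarrow> k \<noteq> Suc j \<Longrightarrow> T j * esym X k r = esym X k r * T j"
proof (induction k arbitrary: r rule: less_induct)
  case (less k)
  consider "k = 0" | "k = Suc (Suc j)" | k' where "k = Suc k'" "k' \<noteq> j" "k' \<noteq> Suc j"
    using less.prems by (metis not0_implies_Suc)
  then show ?case
  proof cases
    case 1
    then show ?thesis by (cases r) simp_all
  next
    case 2
    have e: "T j * esym X j s = esym X j s * T j" for s
      using less by (simp add: 2)
    have rec: "esym X k (Suc (Suc s)) = esym X j (Suc (Suc s)) + (X j + X (Suc j)) * esym X j (Suc s)
        + X j * X (Suc j) * esym X j s" for s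
      using X_X[of j "Suc j"] less.prems
      by (simp add: 2 algebra_simps del: tower.simps)
    have rec1: "esym X k (Suc 0) = esym X j (Suc 0) + (X j + X (Suc j)) * esym X j 0"
      by (simp add: 2 algebra_simps del: tower.simps)
    have c: "T j * (A * esym X j s) = A * esym X j s * T j" if "T j * A = A * T j" for A s
      using that e by (rule commutes_mult)
    consider "r = 0" | "r = Suc 0" | s where "r = Suc (Suc s)"
      by (metis not0_implies_Suc)
    then show ?thesis
    proof cases
      case 3
      show ?thesis
        unfolding 3 rec distrib_left[of "T j"] distrib_right[of _ _ "T j"] e
          c[OF T_X_add[OF less.prems(1)]] c[OF T_X_mult[OF less.prems(1)]] ..
    next
      case 2
      show ?thesis
        unfolding 2 rec1 distrib_left[of "T j"] distrib_right[of _ _ "T j"] e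
          c[OF T_X_add[OF less.prems(1)]] ..
    qed simp
  next
    case (3 k')
    then have e: "T j * esym X k' s = esym X k' s * T j" for s
      using less by simp
    have x: "T j * X k' = X k' * T j" using T_X 3 less.prems by simp
    have "T j * (X k' * esym X k' s) = X k' * esym X k' s * T j" for s
      using x e by (rule commutes_mult)
    with e show ?thesis unfolding 3
      by (cases r) (simp_all add: distrib_left distrib_right)
  qed
qed

end

text \<open>A presentation by the finite Hecke generators, one polynomial generator and the rotation
  \<open>p\<close>. Conjugation by \<open>p\<close> would turn \<open>T (n - 1)\<close> into the
  affine generator, which is absent here; \<open>p_p_T\<close> steps over it and arrives at
  \<open>T 0\<close>. The relation \<open>p_Z\<close> says that \<open>p\<close> carries the first
  polynomial generator to the second.\<close>

locale daha = hecke +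
  fixes Z p :: 'a
  assumes t_Z: "t * Z = Z * t" and t_p: "t * p = p * t"
    and Z_T: "0 < i \<Longrightarrow> i < n \<Longrightarrow> Z * T i = T i * Z"
    and Z_braid: "0 < n \<Longrightarrow> Z * T 0 * Z * T 0 = T 0 * Z * T 0 * Z"
    and p_T: "Suc i < n \<Longrightarrow> p * T i = T (Suc i) * p"
    and p_p_T: "0 < n \<Longrightarrow> p * p * T (n - 1) = T 0 * p * p"
    and p_Z: "0 < n \<Longrightarrow> p * Z = ti * (T 0 * Z * T 0) * p"
begin

primrec P :: "nat \<Rightarrow> 'a" where
  "P 0 = 1"
| "P (Suc k) = S k * P k"

text \<open>\<open>Q k\<close> is \<open>P (Suc k)\<close> without its last factor
  \<open>S 0\<close>. It is what \<open>Y * T 0\<close> leaves of \<open>P n\<close>, because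
  \<open>S 0 * T 0 = t\<close>.\<close>

primrec Q :: "nat \<Rightarrow> 'a" where
  "Q 0 = 1"
| "Q (Suc k) = S (Suc k) * Q k"

text \<open>The first Cherednik operator: \<open>S\<^sub>k = t T\<^sub>k\<^sup>-\<^sup>1\<close>, and \<open>p\<close> is the \<open>q\<close>-shift of \<open>x\<^sub>0\<close> composed with a
  cyclic permutation of the variables.\<close>

definition Y :: 'a where "Y = p * P n"

lemma P_Q: "P (Suc k) = Q k * S 0"
  by (induction k) (simp_all add: mult.assoc)

lemma P_T_greater: "k < j \<Longrightarrow> j < n \<Longrightarrow> P k * T j = T j * P k"
proof (induction k)
  case (Suc k)
  then have "S k * T j = T j * S k" by (intro S_commute) (simp_all add: far' t_T)
  with Suc show ?case by (simp add: mult.assoc) (simp flip: mult.assoc)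
qed simp

lemma P_T: "Suc i < k \<Longrightarrow> k \<le> n \<Longrightarrow> P k * T (Suc i) = T i * P k"
proof (induction k)
  case (Suc k)
  show ?case
  proof (cases "Suc i = k")
    case True
    have "P (Suc k) * T (Suc i) = S (Suc i) * S i * (P i * T (Suc i))"
      using True by (auto simp: mult.assoc)
    also have "\<dots> = S (Suc i) * S i * T (Suc i) * P i"
      using P_T_greater[of i "Suc i"] Suc.prems by (simp add: mult.assoc)
    also have "\<dots> = T i * S (Suc i) * S i * P i"
      using Suc.prems by (subst SST) simp_all
    finally show ?thesis using True by (auto simp: mult.assoc)
  next
    case False
    with Suc.prems have "S k * T i = T i * S k" by (intro S_commute) (simp_all add: far' t_T)
    then show ?thesis using Suc False by (simp add: mult.assoc) (simp flip: mult.assoc)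
  qed
qed simp

lemma t_P: "k \<le> n \<Longrightarrow> t * P k = P k * t"
proof (induction k)
  case (Suc k)
  have "t * P (Suc k) = S k * (t * P k)"
    using scalars_S[of k] Suc.prems by (simp add: mult.assoc)
  with Suc show ?case by (simp add: mult.assoc)
qed simp

lemma P_S: "Suc i < k \<Longrightarrow> k \<le> n \<Longrightarrow> P k * S (Suc i) = S i * P k"
  by (simp add: S_def algebra_simps P_T t_P)

lemma t_Y: "t * Y = Y * t"
proof -
  have "t * Y = p * (t * P n)" using t_p by (simp add: Y_def flip: mult.assoc)
  then show ?thesis using t_P[of n] by (simp add: Y_def mult.assoc)
qed

text \<open>\<open>P n\<close> lowers the index of the generator by one and \<open>p\<close> raises
  it again.\<close>

lemma Y_T: "0 < i \<Longrightarrow> i < n \<Longrightarrow> Y * T i = T i * Y"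
proof -
  assume i: "0 < i" "i < n"
  then obtain j where j: "i = Suc j" by (cases i) auto
  have "Y * T i = p * T j * P n" using P_T[of j n] i j by (simp add: Y_def mult.assoc)
  then show ?thesis using p_T[of j] i j by (simp add: Y_def mult.assoc)
qed

lemma Q_p: "k < n \<Longrightarrow> Q k * p = p * P k"
proof (induction k)
  case (Suc k)
  have "S (Suc k) * p = p * S k"
    using p_T[of k] Suc.prems t_p by (simp add: S_def algebra_simps)
  with Suc show ?case by (simp add: mult.assoc) (simp flip: mult.assoc)
qed simp

lemma P_Q_shift: "k < n \<Longrightarrow> P n * Q k = P k * P n"
proof (induction k)
  case (Suc k)
  have "P n * Q (Suc k) = (P n * S (Suc k)) * Q k" by (simp add: mult.assoc)
  also have "\<dots> = S k * (P n * Q k)" using P_S[of k n] Suc.prems by (simp add: mult.assoc)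
  finally show ?case using Suc by (simp add: mult.assoc)
qed simp

lemma Q_Z: "k < n \<Longrightarrow> Q k * Z = Z * Q k"
proof (induction k)
  case (Suc k)
  have "S (Suc k) * Z = Z * S (Suc k)"
    using Z_T[of "Suc k"] Suc.prems t_Z by (intro S_commute) auto
  with Suc show ?case by (simp add: mult.assoc) (simp flip: mult.assoc)
qed simp

lemma Y_T0: "n = Suc m \<Longrightarrow> Y * T 0 = p * Q m * t"
proof -
  assume n: "n = Suc m"
  then have "P n = Q m * S 0" by (simp only: P_Q)
  moreover from n have "S 0 * T 0 = t" by (simp add: S_T)
  ultimately show ?thesis by (simp add: Y_def mult.assoc)
qed

text \<open>With n = m + 1 the product Y T_0 Y equals t p^2 P_m P_n, and \<open>T 0\<close> commutes
  with it: p^2 intertwines T_m with T_0, and P_m P_n intertwines T_0 with T_m. The latter holds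
  because S_m P_m = P_n, so that both S_m (P_m P_n) and (P_m P_n) S_0 equal P_n P_n.\<close>

lemma Y_braid: "0 < n \<Longrightarrow> Y * T 0 * Y * T 0 = T 0 * Y * T 0 * Y"
proof -
  assume "0 < n"
  then obtain m where m: "n = Suc m" by (cases n) auto
  have "t * Q k = Q k * t" if "k < n" for k
    using that
  proof (induction k)
    case (Suc k)
    have "t * Q (Suc k) = S (Suc k) * (t * Q k)"
      using scalars_S[of "Suc k"] Suc.prems by (simp add: mult.assoc)
    with Suc show ?case by (simp add: mult.assoc)
  qed simp
  then have "Q m * t = t * Q m" using m by simp
  moreover have "p * (t * x) = t * (p * x)" for x using commutes_left[OF t_p] .
  ultimately have YT: "Y * T 0 = t * (p * Q m)" using Y_T0[OF m] by (simp add: mult.assoc)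
  have YTY: "Y * T 0 * Y = t * (p * p * (P m * P n))"
  proof -
    have "Y * T 0 * Y = t * (p * Q m) * Y" by (simp only: YT)
    also have "\<dots> = t * p * (Q m * p) * P n" by (simp only: Y_def mult.assoc)
    finally show ?thesis using Q_p[of m] m by (simp only: mult.assoc lessI)
  qed
  have "S m * (P m * P n) = P m * P n * S 0"
  proof -
    have "S m * (P m * P n) = P n * P (Suc m)" by (simp add: m mult.assoc)
    also have "\<dots> = P n * Q m * S 0" by (simp only: P_Q mult.assoc)
    finally show ?thesis using P_Q_shift[of m] m by simp
  qed
  then have *: "T m * (P m * P n) = P m * P n * T 0"
  proof -
    have "P m * P n * t = t * (P m * P n)"
    proof -
      have "P m * P n * t = P m * (t * P n)" using t_P[of n] by (simp only: mult.assoc order_refl)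
      also have "\<dots> = (t * P m) * P n" using t_P[of m] m by (simp add: mult.assoc del: P.simps)
      finally show ?thesis by (simp only: mult.assoc)
    qed
    then have c: "P m * P n * (t - 1) = (t - 1) * (P m * P n)"
      by (simp add: left_diff_distrib right_diff_distrib del: P.simps)
    have "T m * (P m * P n) = S m * (P m * P n) + (t - 1) * (P m * P n)"
      by (simp only: S_def diff_add_cancel flip: distrib_right)
    also have "\<dots> = P m * P n * S 0 + P m * P n * (t - 1)"
      by (simp only: \<open>S m * (P m * P n) = P m * P n * S 0\<close> c)
    also have "\<dots> = P m * P n * T 0"
      by (simp only: S_def diff_add_cancel flip: distrib_left)
    finally show ?thesis .
  qed
  have "T 0 * (Y * T 0 * Y) = t * ((T 0 * p * p) * (P m * P n))"
    unfolding YTY using m by (simp add: mult.assoc scalars_T)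
  also have "\<dots> = t * (p * p * (T m * (P m * P n)))"
  proof -
    have "T 0 * p * p = p * p * T m" using p_p_T m by simp
    then show ?thesis by (simp only: mult.assoc)
  qed
  also have "\<dots> = Y * T 0 * Y * T 0" unfolding * YTY by (simp only: mult.assoc)
  finally show ?thesis by (simp only: mult.assoc)
qed

text \<open>The factor \<open>T 0\<close> cancels \<open>S 0\<close>, the only factor of
  \<open>P n\<close> that does not commute with \<open>Z\<close>; so in effect only \<open>p\<close>
  has to cross \<open>Z\<close>.\<close>

lemma Y_cross: "0 < n \<Longrightarrow> Y * T 0 * Z = ti * (T 0 * Z * T 0) * (Y * T 0)"
proof -
  assume n: "0 < n"
  then obtain m where m: "n = Suc m" by (cases n) auto
  have "Y * T 0 * Z = p * (Q m * Z) * t" using t_Z by (simp add: Y_T0[OF m] mult.assoc)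
  also have "\<dots> = (p * Z) * Q m * t" using Q_Z[of m] m by (simp add: mult.assoc)
  finally show ?thesis unfolding p_Z[OF n] Y_T0[OF m] by (simp only: mult.assoc)
qed

lemma rank_two: "0 < n \<Longrightarrow> rank_two (T 0) (ti * S 0) Y Z t ti"
  using t_T t_Y t_Z t_ti S_T Y_braid Z_braid Y_cross quad
  by unfold_locales (simp_all add: mult.assoc scalars_T)

lemma affine_hecke_quadratic:
  fixes f :: "nat \<Rightarrow> 'a"
  assumes f: "\<And>a i. i < n \<Longrightarrow> f a * T i = T i * f a" "\<And>a. f a * p = p * f a"
      "\<And>a. f a * Z = Z * f a" "\<And>a b. f a * f b = f b * f a" "\<And>a. f a * t = t * f a"
  shows "affine_hecke T t ti n (Z * (\<Sum>a\<le>2. f a * Y ^ a))"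
proof
  have fS: "f a * S i = S i * f a" if "i < n" for a i
    using f(1)[OF that] f(5) by (simp add: S_def algebra_simps)
  have fP: "f a * P k = P k * f a" if "k \<le> n" for a k
    using that by (induction k) (simp_all add: commutes_mult fS)
  have fY: "f a * Y = Y * f a" for a
    unfolding Y_def using f(2) fP[of n] by (simp add: commutes_mult)
  have comm: "x * (\<Sum>a\<le>2. f a * Y ^ a) = (\<Sum>a\<le>2. f a * Y ^ a) * x"
    if "x * Y = Y * x" "\<And>a. x * f a = f a * x" for x
    by (intro commutes_sum commutes_mult commutes_power that)
  show "t * (Z * (\<Sum>a\<le>2. f a * Y ^ a)) = Z * (\<Sum>a\<le>2. f a * Y ^ a) * t"
    using t_Z t_Y f(5) by (intro commutes_mult comm) simp_all
  show "Z * (\<Sum>a\<le>2. f a * Y ^ a) * T i = T i * (Z * (\<Sum>a\<le>2. f a * Y ^ a))" if "0 < i" "i < n" for i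
    using that Z_T Y_T f(1) by (intro commutes_mult[symmetric] comm) simp_all
  show "Z * (\<Sum>a\<le>2. f a * Y ^ a) * T 0 * (Z * (\<Sum>a\<le>2. f a * Y ^ a)) * T 0 =
      T 0 * (Z * (\<Sum>a\<le>2. f a * Y ^ a)) * T 0 * (Z * (\<Sum>a\<le>2. f a * Y ^ a))" if "0 < n"
    using rank_two.braid_quadratic[OF rank_two[OF that], of f] f(1)[OF that] fY f(3,4) by simp
qed

end

section \<open>Additive operators and automorphisms of the field of rational functions\<close>

text \<open>Additive maps form a ring under composition; as a type of class \<open>ring_1\<close>
  they can instantiate the locales above. Complex linearity is expressed inside this ring, as
  commuting with the multiplications by constants.\<close>

typedef (overloaded) 'a endo = "{f :: 'a::ab_group_add \<Rightarrow> 'a. \<forall>x y. f (x + y) = f x + f y}"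
  morphisms app Endo
  by (rule exI[of _ id]) simp

setup_lifting type_definition_endo

instantiation endo :: (field) ring_1
begin

lift_definition zero_endo :: "'a endo" is "\<lambda>_. 0" by simp
lift_definition one_endo :: "'a endo" is "\<lambda>x. x" by simp
lift_definition plus_endo :: "'a endo \<Rightarrow> 'a endo \<Rightarrow> 'a endo" is "\<lambda>f g x. f x + g x" by simp
lift_definition minus_endo :: "'a endo \<Rightarrow> 'a endo \<Rightarrow> 'a endo" is "\<lambda>f g x. f x - g x" by simp
lift_definition uminus_endo :: "'a endo \<Rightarrow> 'a endo" is "\<lambda>f x. - f x" by simp
lift_definition times_endo :: "'a endo \<Rightarrow> 'a endo \<Rightarrow> 'a endo" is "\<lambda>f g x. f (g x)" by simp

instance
proof
  show "(0::'a endo) \<noteq> 1"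
    by transfer (metis zero_neq_one)
qed (transfer; auto simp: fun_eq_iff)+

end

lift_definition Mul :: "'a::field \<Rightarrow> 'a endo" is "\<lambda>r x. r * x"
  by (simp add: distrib_left)

lemma app_simps [simp]:
  "app 0 x = 0" "app 1 x = x" "app (A + B) x = app A x + app B x" "app (A - B) x = app A x - app B x"
  "app (- A) x = - app A x" "app (A * B) x = app A (app B x)" "app (Mul r) x = r * x"
  by (transfer; simp)+

lemma app_add: "app A (x + y) = app A x + app A y"
  by transfer simp

lemma app_zero [simp]: "app A 0 = 0"
  using app_add[of A 0 0] by simp

lemma app_uminus: "app A (- x) = - app A x"
  using app_add[of A x "- x"] by (simp add: eq_neg_iff_add_eq_0 add.commute)

lemma app_diff: "app A (x - y) = app A x - app A y"
  using app_add[of A x "- y"] by (simp add: app_uminus)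

lemma app_sum: "app A (sum g I) = (\<Sum>i\<in>I. app A (g i))"
  by (induction I rule: infinite_finite_induct) (simp_all add: app_add)

lemma sum_app: "app (sum G I) x = (\<Sum>i\<in>I. app (G i) x)" for G :: "'i \<Rightarrow> 'a::field endo"
  by (induction I rule: infinite_finite_induct) simp_all

lemma endo_eqI: "(\<And>x. app A x = app B x) \<Longrightarrow> A = B"
  by (metis app_inject ext)

lemma Mul_simps: "Mul (r + s) = Mul r + Mul s" "Mul (r * s) = Mul r * Mul s" "Mul 1 = 1"
    "Mul 0 = 0" "Mul (r - s) = Mul r - Mul s" "Mul (- r) = - Mul r"
  by (rule endo_eqI; simp add: algebra_simps)+

lemma Mul_commute: "Mul r * Mul s = Mul s * Mul r"
  by (rule endo_eqI) simp


section \<open>Field homomorphisms and extension to the field of fractions\<close>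

locale field_hom =
  fixes h :: "'a::field \<Rightarrow> 'a"
  assumes add: "h (x + y) = h x + h y" and mult: "h (x * y) = h x * h y" and one: "h 1 = 1"
begin

lemma zero: "h 0 = 0"
  using add[of 0 0] by (metis add.right_neutral add_left_cancel)

lemma uminus: "h (- x) = - h x"
  using add[of x "- x"] by (simp add: zero eq_neg_iff_add_eq_0 add.commute)

lemma diff: "h (x - y) = h x - h y"
  using add[of x "- y"] by (simp add: uminus)

lemma inverse: "h (inverse x) = inverse (h x)"
proof (cases "x = 0")
  case False
  then have "h x * h (inverse x) = 1" by (simp add: one flip: mult)
  then show ?thesis by (simp add: inverse_unique)
qed (simp add: zero)

lemma divide: "h (x / y) = h x / h y"
  by (simp add: divide_inverse mult inverse)

lemma eq_0_iff: "h x = 0 \<longleftrightarrow> x = 0"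
  using inverse[of x] mult[of x "inverse x"] by (cases "x = 0") (auto simp: zero one)

lemma sum: "h (sum g I) = (\<Sum>i\<in>I. h (g i))"
  by (induction I rule: infinite_finite_induct) (simp_all add: zero add)

lemma prod: "h (prod g I) = (\<Prod>i\<in>I. h (g i))"
  by (induction I rule: infinite_finite_induct) (simp_all add: one mult)

lemma power: "h (x ^ k) = h x ^ k"
  by (induction k) (simp_all add: one mult)

lemmas simps = add mult one zero uminus diff inverse divide sum prod power

lemma app_Endo: "app (Endo h) x = h x"
  using Endo_inverse[of h] by (simp add: add)

end

locale injective_hom =
  fixes h :: "'a::idom \<Rightarrow> 'b::idom"
  assumes add: "h (x + y) = h x + h y" and mult: "h (x * y) = h x * h y" and one: "h 1 = 1"
    and inj: "h x = 0 \<Longrightarrow> x = 0"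

text \<open>The body has the shape of \<open>q_shift\<close>, so that \<open>q_shift\<close> becomes
  an instance by unfolding.\<close>

definition fract_map :: "('a::idom \<Rightarrow> 'a) \<Rightarrow> 'a fract \<Rightarrow> 'a fract" where
  "fract_map h f = (THE g. \<exists>a b. b \<noteq> 0 \<and> f = Fract a b \<and> g = Fract (h a) (h b))"

lemma fract_map_Fract:
  assumes "injective_hom h" "b \<noteq> 0"
  shows "fract_map h (Fract a b) = Fract (h a) (h b)"
proof -
  interpret injective_hom h by fact
  show ?thesis
    unfolding fract_map_def
  proof (rule the_equality)
    fix g
    assume "\<exists>a' b'. b' \<noteq> 0 \<and> Fract a b = Fract a' b' \<and> g = Fract (h a') (h b')"
    then obtain a' b' where *: "b' \<noteq> 0" "Fract a b = Fract a' b'" "g = Fract (h a') (h b')" by blast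
    then have "a * b' = a' * b" using assms by (simp add: eq_fract)
    then have "h a * h b' = h a' * h b" by (simp flip: mult)
    then show "g = Fract (h a) (h b)" using * assms inj by (metis eq_fract(1))
  qed (use assms in blast)
qed

lemma field_hom_fract_map:
  assumes "injective_hom h"
  shows "field_hom (fract_map h)"
proof -
  interpret injective_hom h by fact
  have nz: "b \<noteq> 0 \<Longrightarrow> h b \<noteq> 0" for b using inj by blast
  show ?thesis
  proof
    fix x y :: "'a fract"
    obtain a b where x: "x = Fract a b" "b \<noteq> 0" by (cases x)
    obtain c d where y: "y = Fract c d" "d \<noteq> 0" by (cases y)
    show "fract_map h (x + y) = fract_map h x + fract_map h y"
      "fract_map h (x * y) = fract_map h x * fract_map h y"
      using x y nz by (simp_all add: fract_map_Fract[OF assms] add mult)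
    show "fract_map h 1 = 1"
      using fract_map_Fract[OF assms, of 1 1] by (simp add: one flip: One_fract_def)
  qed
qed

lemma fract_map_fract_map:
  assumes "injective_hom h" "injective_hom g"
  shows "fract_map h (fract_map g x) = fract_map (h \<circ> g) x"
proof -
  interpret h: injective_hom h by fact
  interpret g: injective_hom g by fact
  interpret hg: injective_hom "h \<circ> g"
    by unfold_locales (auto simp: h.add h.mult h.one g.add g.mult g.one dest: h.inj g.inj)
  obtain a b where x: "x = Fract a b" "b \<noteq> 0" by (cases x)
  then have "g b \<noteq> 0" using g.inj by blast
  with x show ?thesis
    by (simp add: fract_map_Fract assms hg.injective_hom_axioms)
qed

section \<open>Rescalings and permutations of the variables\<close>

abbreviation "lookup \<equiv> Poly_Mapping.lookup"
abbreviation "single \<equiv> Poly_Mapping.single"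
abbreviation "keys \<equiv> Poly_Mapping.keys"

definition mpol_scale :: "('n::finite \<Rightarrow> complex) \<Rightarrow> 'n mpol \<Rightarrow> 'n mpol" where
  "mpol_scale a = Poly_Mapping.mapp (\<lambda>m c. (\<Prod>i\<in>UNIV. a i ^ lookup m i) * c)"

lemma lookup_mpol_scale:
  "lookup (mpol_scale a p) m =
    (\<Prod>i\<in>UNIV. a i ^ lookup m i) * lookup p m"
  by (auto simp: mpol_scale_def lookup_mapp when_def in_keys_iff)

lemma mpol_scale_single:
  "mpol_scale a (single m c) =
    single m ((\<Prod>i\<in>UNIV. a i ^ lookup m i) * c)"
  by (rule poly_mapping_eqI) (auto simp: lookup_mpol_scale lookup_single when_def)

lemma mpol_scale_add: "mpol_scale a (p + r) = mpol_scale a p + mpol_scale a r"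
  by (rule poly_mapping_eqI) (simp add: lookup_mpol_scale lookup_add algebra_simps)

text \<open>The target may be noncommutative because the lemma is also applied to the evaluation of
  polynomials at operators.\<close>

lemma mult_hom_if_single:
  fixes h :: "'n mpol \<Rightarrow> 'b::ring"
  assumes add: "\<And>p r. h (p + r) = h p + h r"
    and s: "\<And>m c m' c'. h (single m c * single m' c') =
      h (single m c) * h (single m' c')"
  shows "h (p * r) = h p * h r"
proof -
  have "h 0 = 0" using add[of 0 0] by simp
  then have sum: "h (sum g S) = (\<Sum>s\<in>S. h (g s))" for g and S :: "'s set"
    by (induction S rule: infinite_finite_induct) (simp_all add: add)
  show ?thesis
    by (subst (1 2) mpol_sum_single[of p], subst (1 2) mpol_sum_single[of r])
      (simp add: sum_product sum s)
qed

lemma injective_hom_mpol_scale: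
  assumes "\<And>i. a i \<noteq> 0"
  shows "injective_hom (mpol_scale a :: 'n::{finite,linorder} mpol \<Rightarrow> _)"
proof
  fix p r :: "'n mpol"
  show "mpol_scale a (p + r) = mpol_scale a p + mpol_scale a r" by (rule mpol_scale_add)
  show "mpol_scale a (p * r) = mpol_scale a p * mpol_scale a r"
    by (rule mult_hom_if_single)
      (simp_all add: mpol_scale_add mult_single mpol_scale_single lookup_add power_add prod.distrib mult_ac)
  show "mpol_scale a (1 :: 'n mpol) = 1"
    using mpol_scale_single[of a 0 1] by (simp add: single_one)
  show "p = 0" if "mpol_scale a p = 0"
    using that assms by (auto simp: poly_mapping_eq_iff fun_eq_iff lookup_mpol_scale)
qed

text \<open>\<open>map_key\<close> is contravariant. Applied twice it gives the covariant action
  that replaces x_i by x_(w i).\<close>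

definition mpol_perm :: "('n \<Rightarrow> 'n) \<Rightarrow> 'n mpol \<Rightarrow> 'n mpol" where
  "mpol_perm w = Poly_Mapping.map_key (Poly_Mapping.map_key w)"

lemma inj_map_key:
  assumes "bij w" shows "inj (Poly_Mapping.map_key w :: ('n \<Rightarrow>\<^sub>0 nat) \<Rightarrow> _)"
proof (rule injI)
  fix m m' :: "'n \<Rightarrow>\<^sub>0 nat"
  assume "Poly_Mapping.map_key w m = Poly_Mapping.map_key w m'"
  then have "lookup m (w i) = lookup m' (w i)" for i
    using assms by (metis bij_is_inj map_key.rep_eq comp_apply)
  then show "m = m'" using assms by (metis bij_pointE poly_mapping_eqI)
qed

lemma lookup_mpol_perm:
  "bij w \<Longrightarrow> lookup (mpol_perm w p) m = lookup p (Poly_Mapping.map_key w m)"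
  by (simp add: mpol_perm_def map_key.rep_eq inj_map_key)

lemma map_key_inv:
  assumes "bij w" shows "Poly_Mapping.map_key w (Poly_Mapping.map_key (inv w) m) = m"
    "Poly_Mapping.map_key (inv w) (Poly_Mapping.map_key w m) = m"
  using assms by (auto intro!: poly_mapping_eqI simp: map_key.rep_eq bij_is_inj bij_imp_bij_inv
      inv_f_f surj_f_inv_f bij_is_surj)

lemma mpol_perm_single:
  assumes "bij w"
  shows "mpol_perm w (single m c) = single (Poly_Mapping.map_key (inv w) m) c"
proof (rule poly_mapping_eqI)
  fix k
  have "m = Poly_Mapping.map_key w k \<longleftrightarrow> Poly_Mapping.map_key (inv w) m = k"
    using map_key_inv[OF assms] by metis
  then show "lookup (mpol_perm w (single m c)) k =
      lookup (single (Poly_Mapping.map_key (inv w) m) c) k"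
    using assms by (simp add: lookup_mpol_perm lookup_single)
qed

lemma mpol_perm_add: "bij w \<Longrightarrow> mpol_perm w (p + r) = mpol_perm w p + mpol_perm w r"
  by (rule poly_mapping_eqI) (simp add: lookup_mpol_perm lookup_add)

lemma injective_hom_mpol_perm:
  assumes "bij w"
  shows "injective_hom (mpol_perm w :: 'n::{finite,linorder} mpol \<Rightarrow> _)"
proof
  fix p r :: "'n mpol"
  show "mpol_perm w (p + r) = mpol_perm w p + mpol_perm w r" by (rule mpol_perm_add[OF assms])
  show "mpol_perm w (p * r) = mpol_perm w p * mpol_perm w r"
    by (rule mult_hom_if_single)
      (simp_all add: mpol_perm_add assms mult_single mpol_perm_single map_key_plus
        bij_is_inj bij_imp_bij_inv)
  show "mpol_perm w (1 :: 'n mpol) = 1"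
    using mpol_perm_single[OF assms, of 0 1] assms
    by (simp add: single_one bij_is_inj bij_imp_bij_inv)
  show "p = 0" if "mpol_perm w p = 0"
  proof (rule poly_mapping_eqI)
    fix m
    have "lookup (mpol_perm w p) (Poly_Mapping.map_key (inv w) m) = 0" by (simp add: that)
    then show "lookup p m = lookup 0 m"
      by (simp add: lookup_mpol_perm assms map_key_inv)
  qed
qed

definition scale :: "('n::{finite,linorder} \<Rightarrow> complex) \<Rightarrow> 'n ratop" where
  "scale a = fract_map (mpol_scale a)"

definition perm :: "('n::{finite,linorder} \<Rightarrow> 'n) \<Rightarrow> 'n ratop" where
  "perm w = fract_map (mpol_perm w)"

definition nonzero :: "('n \<Rightarrow> complex) \<Rightarrow> bool" where
  "nonzero a \<longleftrightarrow> (\<forall>i. a i \<noteq> 0)"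

lemma nonzeroD: "nonzero a \<Longrightarrow> a i \<noteq> 0"
  by (simp add: nonzero_def)

lemma field_hom_scale: "nonzero a \<Longrightarrow> field_hom (scale a)"
  unfolding scale_def nonzero_def by (intro field_hom_fract_map injective_hom_mpol_scale) auto

lemma field_hom_perm: "bij w \<Longrightarrow> field_hom (perm w)"
  unfolding perm_def by (intro field_hom_fract_map injective_hom_mpol_perm)

lemmas scale_hom = field_hom.simps[OF field_hom_scale]
lemmas perm_hom = field_hom.simps[OF field_hom_perm]

lemma scale_cst: "nonzero a \<Longrightarrow> scale a (cst c) = cst c"
  unfolding scale_def cst_def nonzero_def
  using fract_map_Fract[OF injective_hom_mpol_scale, of a 1 "single 0 c"]
    injective_hom.one[OF injective_hom_mpol_scale, of a]
  by (simp add: mpol_scale_single)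

lemma scale_var: "nonzero a \<Longrightarrow> scale a (var i) = cst (a i) * var i"
proof -
  assume a: "nonzero a"
  have "(\<Prod>j\<in>UNIV. a j ^ lookup (single i 1) j) = (\<Prod>j\<in>UNIV. if j = i then a i else 1)"
    by (intro prod.cong) (auto simp: lookup_single when_def)
  then show ?thesis
    unfolding scale_def cst_def var_def
    using a fract_map_Fract[OF injective_hom_mpol_scale, of a 1 "single (single i 1) 1"]
      injective_hom.one[OF injective_hom_mpol_scale, of a]
    by (simp add: mpol_scale_single mult_single nonzero_def)
qed

lemma perm_cst: "bij w \<Longrightarrow> perm w (cst c) = cst c"
  unfolding perm_def cst_def
  using fract_map_Fract[OF injective_hom_mpol_perm, of w 1 "single 0 c"]
    injective_hom.one[OF injective_hom_mpol_perm, of w]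
  by (simp add: mpol_perm_single bij_is_inj bij_imp_bij_inv)

lemma perm_var: "bij w \<Longrightarrow> perm w (var i) = var (w i)"
proof -
  assume w: "bij w"
  have "Poly_Mapping.map_key (inv w) (single i (1::nat)) = single (w i) 1"
    using w by (intro poly_mapping_eqI)
      (auto simp: map_key.rep_eq bij_is_inj bij_imp_bij_inv lookup_single when_def bij_inv_eq_iff
        surj_f_inv_f bij_is_surj)
  then show ?thesis
    unfolding perm_def var_def
    using w fract_map_Fract[OF injective_hom_mpol_perm, of w 1 "single (single i 1) 1"]
      injective_hom.one[OF injective_hom_mpol_perm, of w]
    by (simp add: mpol_perm_single)
qed

lemma scale_scale:
  assumes "nonzero a" "nonzero b"
  shows "scale a (scale b f) = scale (\<lambda>i. a i * b i) f"
proof -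
  have "mpol_scale a \<circ> mpol_scale b = (mpol_scale (\<lambda>i. a i * b i) :: 'a mpol \<Rightarrow> _)"
    by (rule ext, rule poly_mapping_eqI) (simp add: lookup_mpol_scale power_mult_distrib prod.distrib)
  then show ?thesis
    using assms by (simp add: scale_def fract_map_fract_map injective_hom_mpol_scale nonzero_def)
qed

lemma perm_perm:
  assumes "bij w" "bij u"
  shows "perm w (perm u f) = perm (w \<circ> u) f"
proof -
  have "mpol_perm w \<circ> mpol_perm u = (mpol_perm (w \<circ> u) :: 'a mpol \<Rightarrow> _)"
  proof (rule ext, rule poly_mapping_eqI)
    fix p :: "'a mpol" and m :: "'a \<Rightarrow>\<^sub>0 nat"
    have "Poly_Mapping.map_key u (Poly_Mapping.map_key w m) = Poly_Mapping.map_key (w \<circ> u) m"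
      using assms by (intro poly_mapping_eqI) (simp add: map_key.rep_eq bij_is_inj inj_compose)
    then show "lookup ((mpol_perm w \<circ> mpol_perm u) p) m = lookup (mpol_perm (w \<circ> u) p) m"
      using assms by (simp add: lookup_mpol_perm bij_comp)
  qed
  then show ?thesis
    using assms by (simp add: perm_def fract_map_fract_map injective_hom_mpol_perm)
qed

lemma perm_scale:
  assumes "bij w" "nonzero a"
  shows "perm w (scale (\<lambda>i. a (w i)) f) = scale a (perm w f)"
proof -
  have "mpol_perm w \<circ> mpol_scale (\<lambda>i. a (w i)) = (mpol_scale a \<circ> mpol_perm w :: 'a mpol \<Rightarrow> _)"
  proof (rule ext, rule poly_mapping_eqI)
    fix p :: "'a mpol" and m
    have "(\<Prod>i\<in>UNIV. a (w i) ^ lookup m (w i)) = (\<Prod>i\<in>UNIV. a i ^ lookup m i)"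
      using prod.reindex_bij_betw[of w UNIV UNIV "\<lambda>i. a i ^ lookup m i"] assms(1) by simp
    then show "lookup ((mpol_perm w \<circ> mpol_scale (\<lambda>i. a (w i))) p) m =
        lookup ((mpol_scale a \<circ> mpol_perm w) p) m"
      using assms(1) by (simp add: lookup_mpol_perm lookup_mpol_scale map_key.rep_eq bij_is_inj)
  qed
  then show ?thesis
    using assms by (simp add: scale_def perm_def fract_map_fract_map injective_hom_mpol_perm
        injective_hom_mpol_scale nonzero_def)
qed

lemma q_shift_eq_scale: "q_shift q i = scale (\<lambda>j. if j = i then q else 1)"
proof -
  have "mpol_q_shift q i = mpol_scale (\<lambda>j. if j = i then q else 1)"
  proof (rule ext, rule poly_mapping_eqI)
    fix p m
    have "(\<Prod>j\<in>UNIV. (if j = i then q else 1) ^ lookup m j) =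
        (\<Prod>j\<in>UNIV. if j = i then q ^ lookup m i else 1)"
      by (intro prod.cong) auto
    then show "lookup (mpol_q_shift q i p) m =
        lookup (mpol_scale (\<lambda>j. if j = i then q else 1) p) m"
      by (simp add: lookup_mpol_q_shift lookup_mpol_scale)
  qed
  then show ?thesis by (simp add: fun_eq_iff q_shift_def scale_def fract_map_def)
qed

lemma cst_simps: "cst (c + d) = cst c + cst d" "cst (c * d) = cst c * cst d" "cst 0 = 0" "cst 1 = 1"
    "cst (- c) = - cst c" "cst (c - d) = cst c - cst d"
  by (simp_all add: cst_def single_add single_diff single_uminus mult_single Zero_fract_def One_fract_def)

lemma cst_eq_iff: "cst c = cst d \<longleftrightarrow> c = d"
  by (simp add: cst_def eq_fract) (metis lookup_single_eq)

lemma cst_eq_0_iff: "cst c = 0 \<longleftrightarrow> c = 0"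
  using cst_eq_iff[of c 0] by (simp add: cst_simps)

lemma cst_inverse: "cst (inverse c) = inverse (cst c)"
proof (cases "c = 0")
  case False
  then have "cst c * cst (inverse c) = 1" by (simp flip: cst_simps)
  then show ?thesis by (rule inverse_unique[symmetric])
qed (simp add: cst_simps)

lemma cst_power: "cst (c ^ k) = cst c ^ k"
  by (induction k) (simp_all add: cst_simps)

lemma var_nonzero: "var i \<noteq> 0"
  by (simp add: var_def Zero_fract_def eq_fract) (metis single_zero inj_single injD one_neq_zero lookup_single_eq lookup_zero)

lemma cst_mult_var_neq: "i \<noteq> j \<Longrightarrow> c \<noteq> 0 \<Longrightarrow> cst c * var i \<noteq> cst d * var j"
proof
  assume "i \<noteq> j" "c \<noteq> 0" and e: "cst c * var i = cst d * var j"
  then have "single (single i (1::nat)) c = single (single j 1) d"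
    by (simp add: cst_def var_def eq_fract mult_single)
  then have "lookup (single (single j (1::nat)) d) (single i 1) = c"
    by (metis lookup_single_eq)
  moreover have "single j (1::nat) \<noteq> single i 1"
    using \<open>i \<noteq> j\<close> by (metis lookup_single_eq lookup_single_not_eq one_neq_zero)
  ultimately show False using \<open>c \<noteq> 0\<close> by (simp add: lookup_single)
qed

section \<open>The polynomial representation\<close>

text \<open>The abstract relations use consecutive indices, whereas the variables are indexed by an
  arbitrary finite linear order. Only \<open>k < CARD('n)\<close> is meaningful.\<close>

definition enum :: "nat \<Rightarrow> 'n::{finite,linorder}" where
  "enum k = sorted_list_of_set UNIV ! k"

lemma bij_enum: "bij_betw (enum :: nat \<Rightarrow> 'n::{finite,linorder}) {..<CARD('n)} UNIV"
proof -
  have "bij_betw ((!) (sorted_list_of_set (UNIV :: 'n set))) {..<CARD('n)} UNIV"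
    by (rule bij_betw_nth) simp_all
  then show ?thesis by (simp add: enum_def[abs_def])
qed

lemma enum_eq_iff: "i < CARD('n) \<Longrightarrow> j < CARD('n) \<Longrightarrow> (enum i :: 'n::{finite,linorder}) = enum j \<longleftrightarrow> i = j"
  using bij_enum by (auto simp: bij_betw_def dest: inj_onD)

lemma enum_cases: obtains k where "k < CARD('n)" "i = (enum k :: 'n::{finite,linorder})"
  using bij_enum by (metis UNIV_I bij_betw_iff_bijections lessThan_iff)

lemma enum_less_iff:
  "i < CARD('n) \<Longrightarrow> j < CARD('n) \<Longrightarrow> (enum i :: 'n::{finite,linorder}) < enum j \<longleftrightarrow> i < j"
  unfolding enum_def
  using sorted_wrt_nth_less[OF strict_sorted_list_of_set[of "UNIV :: 'n set"], of i j]
    sorted_wrt_nth_less[OF strict_sorted_list_of_set[of "UNIV :: 'n set"], of j i]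
  by (cases i j rule: linorder_cases) auto

lemma enum_ext:
  fixes f g :: "'n::{finite,linorder} \<Rightarrow> 'b"
  assumes "\<And>k. k < CARD('n) \<Longrightarrow> f (enum k) = g (enum k)"
  shows "f = g"
  using assms by (metis enum_cases ext)

abbreviation xv :: "nat \<Rightarrow> 'n::{finite,linorder} ratfun" where "xv k \<equiv> var (enum k)"

lemma x_eq_iff: "i < CARD('n) \<Longrightarrow> j < CARD('n) \<Longrightarrow>
    (xv i :: 'n::{finite,linorder} ratfun) = xv j \<longleftrightarrow> i = j"
  using cst_mult_var_neq[of "enum i :: 'n" "enum j" 1 1] by (auto simp: cst_simps enum_eq_iff)

definition adj :: "nat \<Rightarrow> 'n::{finite,linorder} \<Rightarrow> 'n" where
  "adj k = transpose (enum k) (enum (Suc k))"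

lemma bij_adj [simp]: "bij (adj k)"
  by (simp add: adj_def bij_transpose)

lemma adj_comp_adj [simp]: "adj k \<circ> adj k = id"
  by (simp add: adj_def)

lemma adj_enum: "Suc k < CARD('n) \<Longrightarrow> i < CARD('n) \<Longrightarrow>
    adj k (enum i) = (enum (if i = k then Suc k else if i = Suc k then k else i) :: 'n::{finite,linorder})"
  by (auto simp: adj_def transpose_def enum_eq_iff)

definition cyc :: "'n::{finite,linorder} \<Rightarrow> 'n" where
  "cyc i = enum (Suc (inv_into {..<CARD('n)} enum i) mod CARD('n))"

lemma cyc_enum: "k < CARD('n) \<Longrightarrow> cyc (enum k) = (enum (Suc k mod CARD('n)) :: 'n::{finite,linorder})"
  using bij_enum[where 'n = 'n] by (simp add: cyc_def bij_betw_def inv_into_f_f)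

lemma bij_cyc [simp]: "bij (cyc :: 'n::{finite,linorder} \<Rightarrow> 'n)"
proof -
  have "surj (cyc :: 'n \<Rightarrow> 'n)"
    unfolding surj_def
  proof
    fix i :: 'n
    obtain k where k: "k < CARD('n)" "i = enum k" by (rule enum_cases)
    have "cyc (enum (if k = 0 then CARD('n) - 1 else k - 1)) = i"
      using k by (subst cyc_enum) auto
    then show "\<exists>j. i = cyc j" by metis
  qed
  then show ?thesis by (simp add: finite_UNIV_surj_inj bij_def)
qed

definition Perm :: "('n::{finite,linorder} \<Rightarrow> 'n) \<Rightarrow> 'n ratfun endo" where
  "Perm w = Endo (perm w)"

definition Scale :: "('n::{finite,linorder} \<Rightarrow> complex) \<Rightarrow> 'n ratfun endo" where
  "Scale a = Endo (scale a)"

lemma app_Perm [simp]: "bij w \<Longrightarrow> app (Perm w) f = perm w f"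
  by (simp add: Perm_def field_hom.app_Endo field_hom_perm)

lemma app_Scale [simp]: "nonzero a \<Longrightarrow> app (Scale a) f = scale a f"
  by (simp add: Scale_def field_hom.app_Endo field_hom_scale)

abbreviation qpow :: "complex \<Rightarrow> 'n \<Rightarrow> 'n \<Rightarrow> complex" where
  "qpow q i \<equiv> (\<lambda>j. if j = i then q else 1)"

lemma nonzero_qpow [simp]: "q \<noteq> 0 \<Longrightarrow> nonzero (qpow q i)"
  by (simp add: nonzero_def)

definition kappa :: "complex \<Rightarrow> nat \<Rightarrow> nat \<Rightarrow> 'n::{finite,linorder} ratfun" where
  "kappa t i j = (cst t * xv j - xv i) / (xv j - xv i)"

text \<open>A Demazure-Lusztig operator: it acts by t on functions symmetric in x_k and x_(k+1), and
  its only other possible eigenvalue is -1.\<close>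

definition T_op :: "complex \<Rightarrow> nat \<Rightarrow> 'n::{finite,linorder} ratfun endo" where
  "T_op t k = Mul (cst t) + Mul (kappa t k (Suc k)) * (Perm (adj k) - 1)"

lemma app_T: "app (T_op t k) f = cst t * f + kappa t k (Suc k) * (perm (adj k) f - f)"
  by (simp add: T_op_def)

lemma perm_kappa:
  fixes w :: "'n::{finite,linorder} \<Rightarrow> 'n"
  assumes "bij w" "w (enum i) = enum i'" "w (enum j) = enum j'"
  shows "perm w (kappa t i j) = kappa t i' j'"
  using assms by (simp add: kappa_def perm_hom perm_cst perm_var)

lemma perm_kappa_adj:
  assumes "Suc k < CARD('n)" "i < CARD('n)" "j < CARD('n)"
  shows "perm (adj k) (kappa t i j :: 'n::{finite,linorder} ratfun) =
    kappa t (if i = k then Suc k else if i = Suc k then k else i)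
      (if j = k then Suc k else if j = Suc k then k else j)"
  by (rule perm_kappa) (use assms in \<open>simp_all only: bij_adj adj_enum\<close>)

lemma kappa_flip:
  assumes "i < CARD('n)" "j < CARD('n)" "i \<noteq> j"
  shows "kappa t j i = cst t + 1 - (kappa t i j :: 'n::{finite,linorder} ratfun)"
proof -
  have "xv i \<noteq> (xv j :: 'n ratfun)" using assms by (simp add: x_eq_iff)
  then have "xv j - xv i \<noteq> (0 :: 'n ratfun)" "xv i - xv j \<noteq> (0 :: 'n ratfun)" by auto
  then show ?thesis by (simp add: kappa_def field_simps)
qed

lemma three_term_field:
  fixes a b c s :: "'a::field"
  assumes "a \<noteq> b" "b \<noteq> c" "a \<noteq> c"
  defines "K \<equiv> \<lambda>u v. (s * v - u) / (v - u)"
  shows "(K a b - 1) * (K b c - 1) = (K a c - 1) * (K a b + K b c - 1 - s)"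
proof -
  have nz: "b - a \<noteq> 0" "c - b \<noteq> 0" "c - a \<noteq> 0" using assms by auto
  \<comment> \<open>As \<open>K u v - 1\<close> is s - 1 times v / (v - u), the factor s - 1 splits
    off twice on both sides, and the identity P Q = R (P + Q - 1) without s remains.\<close>
  define P Q R where "P = b / (b - a)" and "Q = c / (c - b)" and "R = c / (c - a)"
  have K: "K a b - 1 = (s - 1) * P" "K b c - 1 = (s - 1) * Q" "K a c - 1 = (s - 1) * R"
    using nz by (simp_all add: K_def P_def Q_def R_def field_simps)
  have P: "P * (b - a) = b" "Q * (c - b) = c" "R * (c - a) = c"
    using nz by (simp_all add: P_def Q_def R_def)
  have "P * Q * ((b - a) * (c - b) * (c - a)) = b * c * (c - a)"
    using P by (metis (no_types, opaque_lifting) mult.assoc mult.left_commute)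
  moreover have "R * (P + Q - 1) * ((b - a) * (c - b) * (c - a)) =
      R * (c - a) * (P * (b - a) * (c - b) + Q * (c - b) * (b - a) - (b - a) * (c - b))"
    by (simp add: algebra_simps)
  then have "R * (P + Q - 1) * ((b - a) * (c - b) * (c - a)) = b * c * (c - a)"
    unfolding P by (simp add: algebra_simps)
  ultimately have "P * Q * ((b - a) * (c - b) * (c - a)) = R * (P + Q - 1) * ((b - a) * (c - b) * (c - a))"
    by (simp only:)
  then have "P * Q = R * (P + Q - 1)" by (rule mult_right_cancel[THEN iffD1, rotated]) (use nz in simp)
  moreover have "K a b + K b c - 1 - s = (s - 1) * (P + Q - 1)"
  proof -
    have "K a b + K b c - 1 - s = (K a b - 1) + (K b c - 1) - (s - 1)" by simp
    then show ?thesis unfolding K by (simp add: algebra_simps)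
  qed
  ultimately show ?thesis unfolding K by (simp add: mult.assoc mult.left_commute)
qed

lemma kappa_three_term:
  assumes "i < CARD('n)" "j < CARD('n)" "k < CARD('n)" "i \<noteq> j" "j \<noteq> k" "i \<noteq> k"
  shows "(kappa t i j - 1) * (kappa t j k - 1) =
    (kappa t i k - 1) * (kappa t i j + kappa t j k - 1 - cst t :: 'n::{finite,linorder} ratfun)"
  unfolding kappa_def by (rule three_term_field) (use assms in \<open>simp_all add: x_eq_iff\<close>)

lemma perm_adj_perm_adj [simp]: "perm (adj k) (perm (adj k) f) = f"
proof -
  have "perm id f = f"
  proof -
    have "mpol_perm id = (id :: 'a mpol \<Rightarrow> _)"
      by (rule ext, rule poly_mapping_eqI) (simp add: lookup_mpol_perm map_key_id[folded id_def])
    moreover obtain a b where "f = Fract a b" "b \<noteq> 0" by (cases f)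
    ultimately show ?thesis
      using fract_map_Fract[OF injective_hom_mpol_perm[of id], of b a] by (simp add: perm_def)
  qed
  then show ?thesis by (simp add: perm_perm)
qed

lemma T_quad:
  assumes "Suc k < CARD('n)"
  shows "T_op t k * T_op t k = (Mul (cst t) - 1) * T_op t k + (Mul (cst t) :: 'n::{finite,linorder} ratfun endo)"
proof (rule endo_eqI)
  fix f :: "'n ratfun"
  have k: "kappa t (Suc k) k = cst t + 1 - (kappa t k (Suc k) :: 'n ratfun)"
    using assms by (intro kappa_flip) auto
  show "app (T_op t k * T_op t k) f = app ((Mul (cst t) - 1) * T_op t k + Mul (cst t)) f"
    using assms by (simp add: app_T perm_hom perm_cst perm_kappa_adj k algebra_simps)
qed

lemma adj_braid:
  assumes "Suc (Suc k) < CARD('n)"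
  shows "adj k \<circ> (adj (Suc k) \<circ> adj k) = adj (Suc k) \<circ> (adj k \<circ> (adj (Suc k) :: 'n::{finite,linorder} \<Rightarrow> 'n))"
  by (rule enum_ext) (use assms in \<open>simp add: adj_enum\<close>)

lemma perm_adj_braid:
  assumes "Suc (Suc k) < CARD('n)"
  shows "perm (adj (Suc k)) (perm (adj k) (perm (adj (Suc k)) f)) =
    perm (adj k) (perm (adj (Suc k)) (perm (adj k) (f :: 'n::{finite,linorder} ratfun)))"
  using adj_braid[OF assms] by (simp add: perm_perm bij_comp)

text \<open>Both sides of the braid relation, expanded over the six permutations of three variables.
  \<open>A\<close>, \<open>C\<close>, \<open>M\<close> stand for \<open>kappa\<close> of the pairs
  (k, k+1), (k+1, k+2), (k, k+2); \<open>s + 1 - A\<close> and \<open>s + 1 - C\<close> belong to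
  reversed pairs. The coefficients of \<open>f12\<close>, \<open>f21\<close>, \<open>f121\<close>
  agree outright, and those of \<open>f\<close>, \<open>f1\<close>, \<open>f2\<close> differ by
  multiples of the three-term relation.\<close>

lemma braid_ring:
  fixes A C M s :: "'a::comm_ring_1"
  assumes "(A - 1) * (C - 1) = (M - 1) * (A + C - 1 - s)"
  shows
    "(s - A) * ((s - C) * ((s - A) * f + A * f1) + C * ((s - M) * f2 + M * f21)) +
      A * ((s - M) * ((s - (s + 1 - A)) * f1 + (s + 1 - A) * f) + M * ((s - C) * f12 + C * f121)) =
     (s - C) * ((s - A) * ((s - C) * f + C * f2) + A * ((s - M) * f1 + M * f12)) +
      C * ((s - M) * ((s - (s + 1 - C)) * f2 + (s + 1 - C) * f) + M * ((s - A) * f21 + A * f121))"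
    (is "?lhs = ?rhs")
proof -
  define X where "X = A * C - s - M * (A + C - 1 - s)"
  have X: "X = 0" using assms by (simp add: X_def algebra_simps)
  have "?lhs - ?rhs = ((C - A) * f + A * f1 - C * f2) * X"
    unfolding X_def by (simp add: algebra_simps)
  then show ?thesis by (simp add: X)
qed

lemma T_braid:
  assumes "Suc (Suc k) < CARD('n)"
  shows "T_op t k * T_op t (Suc k) * T_op t k = T_op t (Suc k) * T_op t k * (T_op t (Suc k) :: 'n::{finite,linorder} ratfun endo)"
proof (rule endo_eqI)
  fix f :: "'n ratfun"
  let ?s = "cst t :: 'n ratfun" and ?K = "kappa t :: nat \<Rightarrow> nat \<Rightarrow> 'n ratfun"
  have T: "app (T_op t j) g = (?s - ?K j (Suc j)) * g + ?K j (Suc j) * perm (adj j) g" for j g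
    by (simp add: app_T algebra_simps)
  note ring = braid_ring[OF kappa_three_term[of k "Suc k" "Suc (Suc k)" t]]
  have flips: "?K (Suc k) k = ?s + 1 - ?K k (Suc k)" "?K (Suc (Suc k)) (Suc k) = ?s + 1 - ?K (Suc k) (Suc (Suc k))"
    using assms by (intro kappa_flip; simp)+
  show "app (T_op t k * T_op t (Suc k) * T_op t k) f = app (T_op t (Suc k) * T_op t k * T_op t (Suc k)) f"
    using assms ring[where f = f and ?f1.0 = "perm (adj k) f" and ?f2.0 = "perm (adj (Suc k)) f"
        and ?f12.0 = "perm (adj k) (perm (adj (Suc k)) f)" and ?f21.0 = "perm (adj (Suc k)) (perm (adj k) f)"
        and ?f121.0 = "perm (adj k) (perm (adj (Suc k)) (perm (adj k) f))"]
    by (simp only: app_simps T) (simp add: perm_hom perm_cst perm_kappa_adj perm_adj_braid flips)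
qed

lemma T_commute_Mul:
  assumes "perm (adj k) r = r"
  shows "T_op t k * Mul r = Mul r * T_op t k"
  by (rule endo_eqI) (simp add: app_T perm_hom assms algebra_simps)

lemma T_commute_cst: "T_op t k * Mul (cst c) = Mul (cst c) * T_op t k"
  by (rule T_commute_Mul) (simp add: perm_cst)

lemma T_far:
  assumes "Suc i < j" "Suc j < CARD('n)"
  shows "T_op t i * T_op t j = T_op t j * (T_op t i :: 'n::{finite,linorder} ratfun endo)"
proof (rule endo_eqI)
  fix f :: "'n ratfun"
  have "adj i \<circ> adj j = adj j \<circ> (adj i :: 'n \<Rightarrow> 'n)"
    by (rule enum_ext) (use assms in \<open>simp add: adj_enum\<close>)
  then have "perm (adj i) (perm (adj j) f) = perm (adj j) (perm (adj i) f)"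
    by (simp add: perm_perm)
  then show "app (T_op t i * T_op t j) f = app (T_op t j * T_op t i) f"
    using assms by (simp add: app_T perm_hom perm_cst perm_kappa_adj algebra_simps)
qed

text \<open>\<open>kappa\<close> is homogeneous of degree 0, so a rescaling with the same factor on
  x_l and x_(l+1) leaves the coefficient of \<open>T_op t l\<close> fixed.\<close>

lemma T_intertwine:
  assumes w: "bij w" and wk: "w (enum k) = enum l" "w (enum (Suc k)) = enum (Suc l)"
    and a: "nonzero a" "a (enum l) = a (enum (Suc l))" and k: "Suc k < CARD('n)" "Suc l < CARD('n)"
  shows "Scale a * Perm w * T_op t k = T_op t l * Scale a * (Perm w :: 'n::{finite,linorder} ratfun endo)"
proof (rule endo_eqI)
  fix f :: "'n ratfun"
  have "w \<circ> adj k = adj l \<circ> w"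
    unfolding adj_def wk[symmetric] using w by (auto simp: fun_eq_iff transpose_def bij_is_inj inj_eq)
  then have 1: "perm w (perm (adj k) f) = perm (adj l) (perm w f)"
    using w by (simp add: perm_perm)
  have "(\<lambda>i. a (adj l i)) = a" using a(2) by (auto simp: fun_eq_iff adj_def transpose_def)
  then have 2: "scale a (perm (adj l) g) = perm (adj l) (scale a g)" for g
    using perm_scale[of "adj l" a g] a by simp
  have 3: "scale a (kappa t l (Suc l)) = kappa t l (Suc l)"
  proof -
    have "(s * (c * u) - c * v) / (c * u - c * v) = (s * u - v) / (u - v)" if "c \<noteq> 0" for s c u v :: "'n ratfun"
    proof -
      have "(s * (c * u) - c * v) / (c * u - c * v) = (c * (s * u - v)) / (c * (u - v))"
        by (simp add: algebra_simps)
      then show ?thesis using that by simp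
    qed
    moreover have "cst (a (enum (Suc l))) \<noteq> (0 :: 'n ratfun)" using a by (simp add: cst_eq_0_iff nonzeroD)
    ultimately show ?thesis
      using a by (simp add: kappa_def scale_hom scale_cst scale_var)
  qed
  show "app (Scale a * Perm w * T_op t k) f = app (T_op t l * Scale a * Perm w) f"
    using w a by (simp add: app_T perm_hom scale_hom perm_cst scale_cst perm_kappa[OF w wk] 1 2 3)
qed

definition zv :: "nat \<Rightarrow> 'n::{finite,linorder} ratfun" where "zv k = inverse (xv k)"

lemma perm_z_adj:
  assumes "Suc k < CARD('n)" "i < CARD('n)"
  shows "perm (adj k) (zv i :: 'n::{finite,linorder} ratfun) = zv (if i = k then Suc k else if i = Suc k then k else i)"
  using assms by (simp add: zv_def perm_hom perm_var adj_enum)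

lemma T_z_field:
  fixes u v s f g :: "'a::field"
  assumes "u \<noteq> 0" "v \<noteq> 0" "u \<noteq> v"
  defines "A \<equiv> (s * v - u) / (v - u)"
  shows "s * (inverse u * (s * f + A * (g - f))) +
      A * (inverse v * (s * g + (s + 1 - A) * (f - g)) - inverse u * (s * f + A * (g - f))) =
    s * (inverse v * f)"
proof -
  have "v - u \<noteq> 0" using assms by auto
  then have "A * (v - u) = s * v - u" by (simp add: A_def)
  then have *: "(s * (v * (s * f + A * (g - f))) +
      A * (u * (s * g + (s + 1 - A) * (f - g)) - v * (s * f + A * (g - f)))) =
    s * (u * f)" by algebra
  have "s * (inverse u * (s * f + A * (g - f))) +
      A * (inverse v * (s * g + (s + 1 - A) * (f - g)) - inverse u * (s * f + A * (g - f))) =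
     (s * (v * (s * f + A * (g - f))) +
      A * (u * (s * g + (s + 1 - A) * (f - g)) - v * (s * f + A * (g - f)))) * inverse u * inverse v"
    using assms(1,2) by (simp add: field_simps)
  also have "\<dots> = s * (inverse v * f)" unfolding * using assms(1,2) by (simp add: field_simps)
  finally show ?thesis .
qed

text \<open>Hence the multiplications by the inverse variables are themselves the tower over the
  multiplication by \<open>zv 0\<close>.\<close>

lemma T_z_T:
  assumes "Suc k < CARD('n)"
  shows "T_op t k * Mul (zv k) * T_op t k = Mul (cst t) * (Mul (zv (Suc k)) :: 'n::{finite,linorder} ratfun endo)"
proof (rule endo_eqI)
  fix f :: "'n ratfun"
  have k: "kappa t (Suc k) k = cst t + 1 - (kappa t k (Suc k) :: 'n ratfun)"
    using assms by (intro kappa_flip) auto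
  have "xv k \<noteq> (xv (Suc k) :: 'n ratfun)" using assms by (simp add: x_eq_iff)
  then show "app (T_op t k * Mul (zv k) * T_op t k) f = app (Mul (cst t) * Mul (zv (Suc k))) f"
    using assms T_z_field[of "xv k :: 'n ratfun" "xv (Suc k)" "cst t" f "perm (adj k) f", OF var_nonzero var_nonzero]
    by (simp add: app_T perm_hom perm_cst perm_kappa_adj k perm_z_adj)
      (simp add: zv_def kappa_def)
qed

definition pi_op :: "complex \<Rightarrow> 'n::{finite,linorder} ratfun endo" where
  "pi_op q = Scale (qpow q (enum 0)) * Perm cyc"

text \<open>The square rescales x_0 and x_1 by the same factor. This makes
  \<open>T_intertwine\<close> applicable with target \<open>T_op t 0\<close>, which it is not for
  \<open>pi_op q\<close> alone.\<close>

lemma p_p: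
  assumes "q \<noteq> 0" "CARD('n) \<ge> 2"
  shows "pi_op q * pi_op q = (Scale (\<lambda>i. qpow q (enum 0) i * qpow q (enum 1) i) * Perm (cyc \<circ> cyc) :: 'n::{finite,linorder} ratfun endo)"
proof (rule endo_eqI)
  fix f :: "'n ratfun"
  have "qpow q (enum 0) = (\<lambda>i. qpow q (enum 1) (cyc i :: 'n))"
    by (rule enum_ext) (use assms in \<open>auto simp: cyc_enum enum_eq_iff mod_Suc\<close>)
  then have "perm cyc (scale (qpow q (enum 0)) g) = scale (qpow q (enum 1)) (perm cyc g)" for g :: "'n ratfun"
    using perm_scale[of "cyc :: 'n \<Rightarrow> 'n" "qpow q (enum 1)" g] assms by simp
  moreover have "nonzero (\<lambda>i :: 'n. qpow q (enum 0) i * qpow q (enum 1) i :: complex)"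
    using assms by (simp add: nonzero_def)
  ultimately show "app (pi_op q * pi_op q) f = app (Scale (\<lambda>i. qpow q (enum 0) i * qpow q (enum 1) i) * Perm (cyc \<circ> cyc)) f"
    using assms by (simp add: pi_op_def scale_scale perm_perm bij_comp)
qed

lemma p_z:
  assumes "q \<noteq> 0" "Suc k < CARD('n)"
  shows "pi_op q * Mul (zv k) = Mul (zv (Suc k)) * (pi_op q :: 'n::{finite,linorder} ratfun endo)"
proof (rule endo_eqI)
  fix f :: "'n ratfun"
  have "perm cyc (zv k) = (zv (Suc k) :: 'n ratfun)"
    using assms by (simp add: zv_def perm_hom perm_var cyc_enum)
  moreover have "scale (qpow q (enum 0)) (zv (Suc k)) = (zv (Suc k) :: 'n ratfun)"
    using assms by (simp add: zv_def scale_hom scale_var enum_eq_iff cst_simps)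
  ultimately show "app (pi_op q * Mul (zv k)) f = app (Mul (zv (Suc k)) * pi_op q) f"
    using assms by (simp add: pi_op_def perm_hom scale_hom)
qed

lemma p_cst: "q \<noteq> 0 \<Longrightarrow> pi_op q * Mul (cst c) = Mul (cst c) * pi_op q"
  by (rule endo_eqI) (simp add: pi_op_def perm_hom scale_hom perm_cst scale_cst)

lemma daha_ops:
  assumes "q \<noteq> 0" "t \<noteq> 0"
  shows "daha (T_op t) (Mul (cst t)) (Mul (cst (inverse t))) (CARD('n) - 1) (Mul (zv 0))
    (pi_op q :: 'n::{finite,linorder} ratfun endo)"
proof
  let ?t = "Mul (cst t) :: 'n ratfun endo" and ?ti = "Mul (cst (inverse t)) :: 'n ratfun endo"
  have tt: "cst t * cst (inverse t) = (1 :: 'n ratfun)"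
    using assms by (simp add: cst_simps(4) flip: cst_simps(2))
  show t_ti: "?t * ?ti = 1" "?ti * ?t = 1"
    using tt by (simp_all add: Mul_simps mult.commute flip: Mul_simps(2))
  show "?t * T_op t i = T_op t i * ?t" for i by (simp add: T_commute_cst)
  show "T_op t i * T_op t i = (?t - 1) * T_op t i + ?t" if "i < CARD('n) - 1" for i
    by (rule T_quad) (use that in simp)
  show "T_op t i * T_op t (Suc i) * T_op t i = T_op t (Suc i) * T_op t i * (T_op t (Suc i) :: 'n ratfun endo)"
    if "Suc i < CARD('n) - 1" for i
    by (rule T_braid) (use that in simp)
  show "T_op t i * T_op t j = T_op t j * (T_op t i :: 'n ratfun endo)" if "Suc i < j" "j < CARD('n) - 1" for i j
    by (rule T_far) (use that in simp_all)
  show "?t * Mul (zv 0) = Mul (zv 0) * ?t" by (rule Mul_commute)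
  show "?t * pi_op q = pi_op q * ?t" using assms by (simp add: p_cst)
  show "Mul (zv 0) * T_op t i = T_op t i * (Mul (zv 0) :: 'n ratfun endo)" if "0 < i" "i < CARD('n) - 1" for i
    by (rule T_commute_Mul[symmetric]) (use that in \<open>simp add: perm_z_adj\<close>)
  show "Mul (zv 0) * T_op t 0 * Mul (zv 0) * T_op t 0 = T_op t 0 * Mul (zv 0) * T_op t 0 * (Mul (zv 0) :: 'n ratfun endo)"
    if "0 < CARD('n) - 1"
  proof -
    \<comment> \<open>The product T_0 z_0 T_0 is t times the multiplication by z_1, hence commutes
      with the multiplication by z_0.\<close>
    have "Mul (zv 0) * T_op t 0 * Mul (zv 0) * T_op t 0 = Mul (zv 0) * (T_op t 0 * Mul (zv 0) * (T_op t 0 :: 'n ratfun endo))"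
      by (simp only: mult.assoc)
    also have "\<dots> = T_op t 0 * Mul (zv 0) * T_op t 0 * Mul (zv 0)"
      using that by (subst (1 2) T_z_T) (simp_all add: mult.commute flip: Mul_simps(2))
    finally show ?thesis .
  qed
  show "pi_op q * T_op t i = T_op t (Suc i) * (pi_op q :: 'n ratfun endo)" if "Suc i < CARD('n) - 1" for i
  proof -
    have "pi_op q * T_op t i = Scale (qpow q (enum 0)) * Perm cyc * (T_op t i :: 'n ratfun endo)" by (simp add: pi_op_def)
    also have "\<dots> = T_op t (Suc i) * Scale (qpow q (enum 0)) * Perm cyc"
      using that assms by (intro T_intertwine) (simp_all add: cyc_enum enum_eq_iff)
    finally show ?thesis by (simp add: pi_op_def mult.assoc)
  qed
  show "pi_op q * pi_op q * T_op t (CARD('n) - 1 - 1) = T_op t 0 * pi_op q * (pi_op q :: 'n ratfun endo)" if "0 < CARD('n) - 1"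
  proof -
    have c: "CARD('n) \<ge> 2" using that by simp
    have e: "Suc (CARD('n) - Suc (Suc 0)) = CARD('n) - 1" "Suc (CARD('n) - Suc 0) = CARD('n)"
      using c by auto
    have "pi_op q * pi_op q * T_op t (CARD('n) - 1 - 1) =
        Scale (\<lambda>i. qpow q (enum 0) i * qpow q (enum 1) i) * Perm (cyc \<circ> cyc) * (T_op t (CARD('n) - 1 - 1) :: 'n ratfun endo)"
      by (simp only: p_p[OF assms(1) c])
    also have "\<dots> = T_op t 0 * Scale (\<lambda>i. qpow q (enum 0) i * qpow q (enum 1) i) * Perm (cyc \<circ> cyc)"
      using c assms
      by (intro T_intertwine) (auto simp: cyc_enum enum_eq_iff nonzero_def bij_comp e mod_Suc)
    also have "\<dots> = T_op t 0 * (pi_op q * pi_op q)" by (simp only: p_p[OF assms(1) c] mult.assoc)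
    finally show ?thesis by (simp only: mult.assoc)
  qed
  show "pi_op q * Mul (zv 0) = ?ti * (T_op t 0 * Mul (zv 0) * T_op t 0) * (pi_op q :: 'n ratfun endo)" if "0 < CARD('n) - 1"
  proof -
    have "?ti * (T_op t 0 * Mul (zv 0) * T_op t 0) = (Mul (zv (Suc 0)) :: 'n ratfun endo)"
      using that by (subst T_z_T) (simp_all add: t_ti flip: mult.assoc)
    then show ?thesis using p_z[OF assms(1), of 0] that by simp
  qed
qed

section \<open>The Hamiltonian on symmetric functions\<close>

definition symmetric :: "'n::{finite,linorder} ratfun \<Rightarrow> bool" where
  "symmetric f \<longleftrightarrow> (\<forall>w. bij w \<longrightarrow> perm w f = f)"

lemma symmetricD: "symmetric f \<Longrightarrow> bij w \<Longrightarrow> perm w f = f"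
  by (simp add: symmetric_def)

definition kappa_at :: "complex \<Rightarrow> 'n \<Rightarrow> 'n \<Rightarrow> 'n::{finite,linorder} ratfun" where
  "kappa_at t a b = (cst t * var b - var a) / (var b - var a)"

lemma kappa_eq_kappa_at: "kappa t i j = kappa_at t (enum i) (enum j)"
  by (simp add: kappa_def kappa_at_def)

lemma perm_kappa_at: "bij w \<Longrightarrow> perm w (kappa_at t a b) = kappa_at t (w a) (w b)"
  by (simp add: kappa_at_def perm_hom perm_cst perm_var)

section \<open>Products of Hecke generators applied to a permuted family\<close>

definition swap_index :: "nat \<Rightarrow> nat \<Rightarrow> nat" where
  "swap_index k j = (if j = k then Suc k else if j = Suc k then k else j)"

text \<open>The Hecke generator \<open>T\<^sub>k\<close> for \<open>\<theta> = t\<close>, and \<open>t T\<^sub>k\<^sup>-\<^sup>1\<close> for \<open>\<theta> = 1\<close>. Only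
  \<open>(\<theta> - 1) (\<theta> - t) = 0\<close> matters for the closed formula of the products below.\<close>

definition gen :: "complex \<Rightarrow> complex \<Rightarrow> nat \<Rightarrow> 'n::{finite,linorder} ratfun endo" where
  "gen t \<theta> k = Mul (cst \<theta>) + Mul (kappa t k (Suc k)) * (Perm (adj k) - 1)"

lemma app_gen: "app (gen t \<theta> k) f = cst \<theta> * f + kappa t k (Suc k) * (perm (adj k) f - f)"
  by (simp add: gen_def)

lemma gen_t: "gen t t = T_op t"
  by (simp add: gen_def T_op_def fun_eq_iff)

lemma gen_one: "gen t 1 k = T_op t k - (Mul (cst t) - 1)"
  by (simp add: gen_def T_op_def cst_simps Mul_simps)

primrec gens :: "complex \<Rightarrow> complex \<Rightarrow> nat \<Rightarrow> 'n::{finite,linorder} ratfun endo" where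
  "gens t \<theta> 0 = 1"
| "gens t \<theta> (Suc k) = gen t \<theta> k * gens t \<theta> k"

definition gens_coeff :: "complex \<Rightarrow> complex \<Rightarrow> nat \<Rightarrow> nat \<Rightarrow> 'n::{finite,linorder} ratfun" where
  "gens_coeff t \<theta> k j = (if j = k then 1 else cst \<theta> - kappa t j k) * (\<Prod>l\<in>{..<k} - {j}. kappa t l j)"

text \<open>\<open>a\<close>, \<open>c\<close>, \<open>m\<close> stand for \<open>kappa\<close> of
  (j, k), (k, k+1), (j, k+1), and \<open>u\<close> for \<theta>. The two sides differ by the sum of
  the expressions that vanish by assumption.\<close>

lemma gens_coeff_step:
  fixes a c m s u :: "'a::field"
  assumes "(a - 1) * (c - 1) = (m - 1) * (a + c - 1 - s)" and "(u - 1) * (u - s) = 0"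
  shows "u * (u - a) + c * ((u - m) - (u - a)) = (u - m) * (s + 1 - a)"
proof -
  have "u * (u - a) + c * ((u - m) - (u - a)) - (u - m) * (s + 1 - a) =
    (u - 1) * (u - s) + ((a - 1) * (c - 1) - (m - 1) * (a + c - 1 - s))"
    by (simp add: algebra_simps)
  then show ?thesis using assms by simp
qed

text \<open>The generator with index k exchanges \<open>F k\<close> and \<open>F (Suc k)\<close> and
  fixes the other \<open>F j\<close>. So for j < k it changes only the coefficient, by
  \<open>gens_coeff_step\<close>, while the term with j = k splits in two.\<close>

lemma gens_formula:
  fixes F :: "nat \<Rightarrow> 'n::{finite,linorder} ratfun"
  assumes F: "\<And>k j. Suc k < CARD('n) \<Longrightarrow> j < CARD('n) \<Longrightarrow> perm (adj k) (F j) = F (swap_index k j)"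
    and \<theta>: "\<theta> = 1 \<or> \<theta> = t"
  shows "k < CARD('n) \<Longrightarrow> app (gens t \<theta> k) (F 0) = (\<Sum>j\<le>k. gens_coeff t \<theta> k j * F j)"
proof (induction k)
  case 0
  then show ?case by (simp add: gens_coeff_def)
next
  case (Suc k)
  then have k: "Suc k < CARD('n)" by simp
  let ?g = "\<lambda>f. app (gen t \<theta> k) f :: 'n ratfun" and ?c = "gens_coeff t \<theta> :: nat \<Rightarrow> nat \<Rightarrow> 'n ratfun"
    and ?K = "kappa t :: nat \<Rightarrow> nat \<Rightarrow> 'n ratfun"
  have less: "?g (?c k j * F j) = ?c (Suc k) j * F j" if "j < k" for j
  proof -
    let ?G = "\<Prod>l\<in>{..<k} - {j}. ?K l j"
    have c: "?c k j = (cst \<theta> - ?K j k) * ?G" using that by (simp add: gens_coeff_def)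
    have "perm (adj k) (?K l j) = ?K l j" if "l \<in> {..<k} - {j}" for l
      using that \<open>j < k\<close> k by (simp add: perm_kappa_adj)
    then have G: "perm (adj k) ?G = ?G"
      by (subst field_hom.prod[OF field_hom_perm]) (simp, intro prod.cong refl)
    have K: "perm (adj k) (?K j k) = ?K j (Suc k)" using that k by (simp add: perm_kappa_adj)
    have Fj: "perm (adj k) (F j) = F j" using F[OF k, of j] that k by (simp add: swap_index_def)
    have "{..<Suc k} - {j} = insert k ({..<k} - {j})" using that by auto
    then have "?c (Suc k) j = (cst \<theta> - ?K j (Suc k)) * ?K k j * ?G"
      using that by (simp add: gens_coeff_def)
    moreover have "?K k j = cst t + 1 - ?K j k" using that k by (intro kappa_flip) auto
    moreover have "(?K j k - 1) * (?K k (Suc k) - 1) = (?K j (Suc k) - 1) * (?K j k + ?K k (Suc k) - 1 - cst t)"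
      using that k by (intro kappa_three_term) auto
    moreover have "(cst \<theta> - 1) * (cst \<theta> - cst t) = (0 :: 'n ratfun)"
      using \<theta> by (auto simp: cst_simps)
    ultimately have c': "?c (Suc k) j =
        (cst \<theta> * (cst \<theta> - ?K j k) + ?K k (Suc k) * ((cst \<theta> - ?K j (Suc k)) - (cst \<theta> - ?K j k))) * ?G"
      using gens_coeff_step[of "?K j k" "?K k (Suc k)" "?K j (Suc k)" "cst t" "cst \<theta>"] by simp
    have "?g (?c k j * F j) = cst \<theta> * ((cst \<theta> - ?K j k) * ?G * F j) +
        ?K k (Suc k) * ((cst \<theta> - ?K j (Suc k)) * ?G * F j - (cst \<theta> - ?K j k) * ?G * F j)"
      unfolding c by (simp add: app_gen field_hom.mult[OF field_hom_perm] field_hom.diff[OF field_hom_perm]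
          G K Fj perm_cst)
    also have "\<dots> = ?c (Suc k) j * F j" unfolding c' by (simp add: algebra_simps)
    finally show ?thesis .
  qed
  have same: "?g (?c k k * F k) = ?c (Suc k) k * F k + ?c (Suc k) (Suc k) * F (Suc k)"
  proof -
    have c: "?c k k = (\<Prod>l<k. ?K l k)" by (simp add: gens_coeff_def)
    have "perm (adj k) (?K l k) = ?K l (Suc k)" if "l \<in> {..<k}" for l
      using that k by (simp add: perm_kappa_adj)
    then have p: "perm (adj k) (\<Prod>l<k. ?K l k) = (\<Prod>l<k. ?K l (Suc k))"
      by (subst field_hom.prod[OF field_hom_perm]) (simp, intro prod.cong refl)
    have Fk: "perm (adj k) (F k) = F (Suc k)" using F[OF k, of k] k by (simp add: swap_index_def)
    have c1: "?c (Suc k) k = (cst \<theta> - ?K k (Suc k)) * (\<Prod>l<k. ?K l k)"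
      by (simp add: gens_coeff_def lessThan_Suc)
    have "{..<Suc k} - {Suc k} = insert k {..<k}" by auto
    then have c2: "?c (Suc k) (Suc k) = ?K k (Suc k) * (\<Prod>l<k. ?K l (Suc k))"
      by (simp add: gens_coeff_def)
    show ?thesis unfolding c c1 c2
      by (simp add: app_gen field_hom.mult[OF field_hom_perm] p Fk algebra_simps)
  qed
  have "app (gens t \<theta> (Suc k)) (F 0) = ?g (\<Sum>j\<le>k. ?c k j * F j)" using Suc by simp
  also have "\<dots> = (\<Sum>j<k. ?g (?c k j * F j)) + ?g (?c k k * F k)"
    by (simp add: app_sum app_add flip: lessThan_Suc_atMost)
  also have "\<dots> = (\<Sum>j<k. ?c (Suc k) j * F j) + (?c (Suc k) k * F k + ?c (Suc k) (Suc k) * F (Suc k))"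
  proof -
    have "(\<Sum>j<k. ?g (?c k j * F j)) = (\<Sum>j<k. ?c (Suc k) j * F j)"
      by (intro sum.cong refl less) simp
    then show ?thesis by (simp only: same)
  qed
  also have "\<dots> = (\<Sum>j\<le>Suc k. ?c (Suc k) j * F j)"
    by (simp add: add.assoc flip: lessThan_Suc_atMost)
  finally show ?case .
qed

text \<open>Adding the next product multiplies the coefficient of \<open>F j\<close> by 1 + t -
  \<open>kappa t j (Suc k)\<close>, which is \<open>kappa t (Suc k) j\<close> by
  \<open>kappa_flip\<close>. This is how the asymmetric coefficients add up to a full product over l
  \<noteq> j.\<close>

lemma sum_gens_formula:
  fixes F :: "nat \<Rightarrow> 'n::{finite,linorder} ratfun"
  assumes F: "\<And>k j. Suc k < CARD('n) \<Longrightarrow> j < CARD('n) \<Longrightarrow> perm (adj k) (F j) = F (swap_index k j)"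
  shows "k < CARD('n) \<Longrightarrow>
    (\<Sum>i\<le>k. app (gens t t i) (F 0)) = (\<Sum>j\<le>k. (\<Prod>l\<in>{..k} - {j}. kappa t l j) * F j)"
proof (induction k)
  case 0
  then show ?case by simp
next
  case (Suc k)
  let ?K = "kappa t :: nat \<Rightarrow> nat \<Rightarrow> 'n ratfun"
  have "(\<Sum>i\<le>Suc k. app (gens t t i) (F 0)) =
      (\<Sum>j\<le>k. (\<Prod>l\<in>{..k} - {j}. ?K l j) * F j) + (\<Sum>j\<le>Suc k. gens_coeff t t (Suc k) j * F j)"
    using Suc gens_formula[OF F, of t t "Suc k"] by simp
  also have "\<dots> = (\<Sum>j\<le>k. ((\<Prod>l\<in>{..k} - {j}. ?K l j) + gens_coeff t t (Suc k) j) * F j) +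
      gens_coeff t t (Suc k) (Suc k) * F (Suc k)"
    by (simp add: sum.distrib distrib_right)
  also have "(\<Sum>j\<le>k. ((\<Prod>l\<in>{..k} - {j}. ?K l j) + gens_coeff t t (Suc k) j) * F j) =
      (\<Sum>j\<le>k. (\<Prod>l\<in>{..Suc k} - {j}. ?K l j) * F j)"
  proof (intro sum.cong refl)
    fix j assume "j \<in> {..k}"
    then have j: "j \<le> k" by simp
    have "?K (Suc k) j = cst t + 1 - ?K j (Suc k)" using j Suc.prems by (intro kappa_flip) auto
    moreover have "gens_coeff t t (Suc k) j = (cst t - ?K j (Suc k)) * (\<Prod>l\<in>{..k} - {j}. ?K l j)"
      using j by (simp add: gens_coeff_def lessThan_Suc_atMost)
    moreover have ins: "{..Suc k} - {j} = insert (Suc k) ({..k} - {j})" using j by auto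
    have "(\<Prod>l\<in>{..Suc k} - {j}. ?K l j) = ?K (Suc k) j * (\<Prod>l\<in>{..k} - {j}. ?K l j)"
      unfolding ins by simp
    ultimately have "(\<Prod>l\<in>{..k} - {j}. ?K l j) + gens_coeff t t (Suc k) j = (\<Prod>l\<in>{..Suc k} - {j}. ?K l j)"
      by (simp only:) (simp add: algebra_simps)
    then show "((\<Prod>l\<in>{..k} - {j}. ?K l j) + gens_coeff t t (Suc k) j) * F j =
        (\<Prod>l\<in>{..Suc k} - {j}. ?K l j) * F j"
      by simp
  qed
  also have "gens_coeff t t (Suc k) (Suc k) = (\<Prod>l\<in>{..Suc k} - {Suc k}. ?K l (Suc k))"
  proof -
    have "{..<Suc k} - {Suc k} = {..Suc k} - {Suc k}" by auto
    then show ?thesis by (simp add: gens_coeff_def)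
  qed
  finally show ?case by simp
qed

lemma atMost_enum: "bij_betw (enum :: nat \<Rightarrow> 'n::{finite,linorder}) {..CARD('n) - 1} UNIV"
proof -
  have "{..CARD('n) - 1} = {..<CARD('n)}"
    by (simp flip: lessThan_Suc_atMost)
  then show ?thesis using bij_enum by simp
qed

lemma bij_betw_remove:
  assumes "bij_betw f A B" "S \<subseteq> A"
  shows "bij_betw f (A - S) (B - f ` S)"
  using assms inj_on_image_set_diff[of f A A S] by (auto simp: bij_betw_def inj_on_diff)

lemma bij_betw_enum_remove:
  assumes "j \<le> CARD('n) - 1"
  shows "bij_betw (enum :: nat \<Rightarrow> 'n::{finite,linorder}) ({..CARD('n) - 1} - {j}) (UNIV - {enum j})"
  using bij_betw_remove[OF atMost_enum[where 'n = 'n], of "{j}"] assms by simp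

lemma sum_gens_UNIV:
  fixes G :: "'n::{finite,linorder} \<Rightarrow> 'n ratfun"
  assumes G: "\<And>w a. bij w \<Longrightarrow> perm w (G a) = G (w a)"
  shows "(\<Sum>i<CARD('n). app (gens t t i) (G (enum 0))) = (\<Sum>a\<in>UNIV. (\<Prod>l\<in>UNIV - {a}. kappa_at t l a) * G a)"
proof -
  have c: "CARD('n) - 1 < CARD('n)" "{..<CARD('n)} = {..CARD('n) - 1}"
    by (simp_all flip: lessThan_Suc_atMost)
  have "(\<Sum>i\<le>CARD('n) - 1. app (gens t t i) (G (enum 0))) =
      (\<Sum>j\<le>CARD('n) - 1. (\<Prod>l\<in>{..CARD('n) - 1} - {j}. kappa t l j) * G (enum j))"
    by (rule sum_gens_formula[of "\<lambda>j. G (enum j)"]) (use c in \<open>auto simp: G adj_enum swap_index_def\<close>)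
  also have "\<dots> = (\<Sum>j\<le>CARD('n) - 1. (\<Prod>l\<in>UNIV - {enum j}. kappa_at t l (enum j)) * G (enum j))"
  proof (intro sum.cong refl arg_cong2[of _ _ _ _ "(*)"])
    fix j assume "j \<in> {..CARD('n) - 1}"
    then show "(\<Prod>l\<in>{..CARD('n) - 1} - {j}. kappa t l j) = (\<Prod>l\<in>UNIV - {enum j :: 'n}. kappa_at t l (enum j))"
      unfolding kappa_eq_kappa_at by (intro prod.reindex_bij_betw bij_betw_enum_remove) simp
  qed
  also have "\<dots> = (\<Sum>a\<in>UNIV. (\<Prod>l\<in>UNIV - {a}. kappa_at t l a) * G a)"
    by (rule sum.reindex_bij_betw[OF atMost_enum, of "\<lambda>a. (\<Prod>l\<in>UNIV - {a}. kappa_at t l a) * G a"])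
  finally show ?thesis by (simp add: c(2))
qed

lemma gens_one_UNIV:
  fixes G :: "'n::{finite,linorder} \<Rightarrow> 'n ratfun"
  assumes G: "\<And>w a. bij w \<Longrightarrow> perm w (G a) = G (w a)"
  shows "app (gens t 1 (CARD('n) - 1)) (G (enum 0)) = (\<Sum>a\<in>UNIV.
    (if a = enum (CARD('n) - 1) then 1 else 1 - kappa_at t a (enum (CARD('n) - 1))) *
    (\<Prod>l\<in>UNIV - {a, enum (CARD('n) - 1)}. kappa_at t l a) * G a)" (is "_ = ?rhs")
proof -
  let ?n = "CARD('n) - 1"
  have c: "?n < CARD('n)" using zero_less_card_finite[where 'a = 'n] by auto
  have "app (gens t 1 ?n) (G (enum 0)) = (\<Sum>j\<le>?n. gens_coeff t 1 ?n j * G (enum j))"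
    by (rule gens_formula[of "\<lambda>j. G (enum j)"]) (use c in \<open>auto simp: G adj_enum swap_index_def\<close>)
  also have "\<dots> = (\<Sum>j\<le>?n. (if (enum j :: 'n) = enum ?n then 1 else 1 - kappa_at t (enum j) (enum ?n)) *
      (\<Prod>l\<in>UNIV - {enum j, enum ?n}. kappa_at t l (enum j)) * G (enum j))"
  proof (intro sum.cong refl arg_cong2[of _ _ _ _ "(*)"])
    fix j assume "j \<in> {..?n}"
    then have j: "j \<le> ?n" by simp
    have "bij_betw (enum :: nat \<Rightarrow> 'n) ({..?n} - {j, ?n}) (UNIV - {enum j, enum ?n})"
      using bij_betw_remove[OF atMost_enum[where 'n = 'n], of "{j, ?n}"] j by simp
    then have "(\<Prod>l\<in>{..?n} - {j, ?n}. kappa t l j) = (\<Prod>l\<in>UNIV - {enum j, enum ?n}. kappa_at t l (enum j :: 'n))"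
      unfolding kappa_eq_kappa_at by (rule prod.reindex_bij_betw)
    moreover have "{..?n} - {j, ?n} = {..<?n} - {j}" using j by auto
    ultimately have P: "(\<Prod>l\<in>{..<?n} - {j}. kappa t l j) = (\<Prod>l\<in>UNIV - {enum j, enum ?n}. kappa_at t l (enum j :: 'n))"
      by simp
    have "(if j = ?n then 1 else cst 1 - kappa t j ?n) = (if (enum j :: 'n) = enum ?n then 1 else 1 - kappa_at t (enum j :: 'n) (enum ?n))"
      using j c by (simp add: kappa_eq_kappa_at cst_simps enum_eq_iff)
    then show "gens_coeff t 1 ?n j = (if (enum j :: 'n) = enum ?n then 1 else 1 - kappa_at t (enum j :: 'n) (enum ?n)) *
      (\<Prod>l\<in>UNIV - {enum j, enum ?n}. kappa_at t l (enum j))"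
      unfolding gens_coeff_def P by (simp only:)
  qed
  also have "\<dots> = ?rhs"
    by (rule sum.reindex_bij_betw[OF atMost_enum, of "\<lambda>a. (if a = enum ?n then 1 else 1 - kappa_at t a (enum ?n)) *
      (\<Prod>l\<in>UNIV - {a, enum ?n}. kappa_at t l a) * G a"])
  finally show ?thesis .
qed

text \<open>The expansion found in \<open>gens_one_UNIV\<close>, with the distinguished last
  variable replaced by an arbitrary one, so that permutations can move it.\<close>

definition off :: "complex \<Rightarrow> 'n \<Rightarrow> ('n \<Rightarrow> 'n ratfun) \<Rightarrow> 'n::{finite,linorder} ratfun" where
  "off t b G = (\<Sum>a\<in>UNIV. (if a = b then 1 else 1 - kappa_at t a b) * (\<Prod>l\<in>UNIV - {a, b}. kappa_at t l a) * G a)"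

lemma perm_off:
  fixes G :: "'n::{finite,linorder} \<Rightarrow> 'n ratfun"
  assumes G: "\<And>w a. bij w \<Longrightarrow> perm w (G a) = G (w a)" and w: "bij w"
  shows "perm w (off t b G) = off t (w b) G"
proof -
  let ?r = "\<lambda>b a. (if a = b then 1 else 1 - kappa_at t a b) * (\<Prod>l\<in>UNIV - {a, b}. kappa_at t l a) * G a"
  have "perm w (?r b a) = ?r (w b) (w a)" for a
  proof -
    have "bij_betw w (UNIV - {a, b}) (UNIV - {w a, w b})"
      using bij_betw_remove[OF w, of "{a, b}"] by simp
    then have "(\<Prod>l\<in>UNIV - {w a, w b}. kappa_at t l (w a)) = (\<Prod>l\<in>UNIV - {a, b}. kappa_at t (w l) (w a))"
      by (simp add: prod.reindex_bij_betw[where g = "\<lambda>l. kappa_at t l _"])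
    moreover have "w a = w b \<longleftrightarrow> a = b" using w by (simp add: bij_is_inj inj_eq)
    ultimately show ?thesis using w by (simp add: perm_hom perm_kappa_at G)
  qed
  then have "perm w (off t b G) = (\<Sum>a\<in>UNIV. ?r (w b) (w a))"
    unfolding off_def by (simp only: field_hom.sum[OF field_hom_perm[OF w]])
  also have "\<dots> = off t (w b) G"
    unfolding off_def by (rule sum.reindex_bij_betw[OF w, of "?r (w b)"])
  finally show ?thesis .
qed

lemma perm_qshift:
  assumes "bij w" "q \<noteq> 0"
  shows "perm w (scale (qpow q i) f) = scale (qpow q (w i)) (perm w f)"
proof -
  have "(\<lambda>j. qpow q (w i) (w j)) = qpow q i"
    using assms by (auto simp: fun_eq_iff bij_is_inj inj_eq)
  then show ?thesis using perm_scale[of w "qpow q (w i)" f] assms by simp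
qed

context
  fixes q t :: complex
  assumes qt: "q \<noteq> 0" "t \<noteq> 0"
begin

section \<open>The Cherednik operator and its square on symmetric functions\<close>

lemma app_gen_sym: "symmetric g \<Longrightarrow> app (gen t \<theta> k) g = cst \<theta> * g"
  by (simp add: app_gen symmetricD)

lemma app_gens_one_sym: "symmetric g \<Longrightarrow> app (gens t 1 k) g = g"
  by (induction k) (simp_all add: app_gen_sym cst_simps)

lemma P_eq_gens: "daha.P (T_op t) (Mul (cst t)) k = (gens t 1 k :: 'n::{finite,linorder} ratfun endo)"
proof -
  interpret daha "T_op t" "Mul (cst t)" "Mul (cst (inverse t))" "CARD('n) - 1" "Mul (zv 0)"
    "pi_op q :: 'n ratfun endo"
    by (rule daha_ops[OF qt])
  show ?thesis by (induction k) (simp_all add: S_def gen_one)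
qed

abbreviation "Yop \<equiv> daha.Y (T_op t) (Mul (cst t)) (CARD('n) - 1) (pi_op q) :: 'n::{finite,linorder} ratfun endo"

lemma Yop_eq: "Yop = pi_op q * (gens t 1 (CARD('n) - 1) :: 'n::{finite,linorder} ratfun endo)"
proof -
  interpret daha "T_op t" "Mul (cst t)" "Mul (cst (inverse t))" "CARD('n) - 1" "Mul (zv 0)"
    "pi_op q :: 'n ratfun endo"
    by (rule daha_ops[OF qt])
  show ?thesis unfolding Y_def P_eq_gens ..
qed

lemma app_hp: "app (pi_op q) f = scale (qpow q (enum 0)) (perm cyc f)"
  using qt by (simp add: pi_op_def)

lemma Yop_sym:
  fixes g :: "'n::{finite,linorder} ratfun"
  assumes "symmetric g"
  shows "app Yop g = scale (qpow q (enum 0)) g"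
  unfolding Yop_eq using assms by (simp add: app_gens_one_sym app_hp symmetricD)

text \<open>The function \<open>Y g\<close> is the shift of g in x_0 and no longer symmetric, but
  the shifts of g in all variables form a family that permutations permute, to which
  \<open>gens_one_UNIV\<close> applies. The expansion distinguishes the last variable, which
  \<open>cyc\<close> carries to the first.\<close>

lemma Yop_Yop_sym:
  fixes g :: "'n::{finite,linorder} ratfun"
  assumes g: "symmetric g"
  shows "app (Yop * Yop) g =
    scale (qpow q (enum 0)) (off t (enum 0) (\<lambda>a. scale (qpow q a) g))"
proof -
  let ?G = "\<lambda>a. scale (qpow q a) g"
  have G: "perm w (?G a) = ?G (w a)" if "bij w" for w a
    using that qt g by (simp add: perm_qshift symmetricD)
  have "app (Yop * Yop) g = app Yop (?G (enum 0))" using Yop_sym[OF g] by simp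
  also have "\<dots> = scale (qpow q (enum 0)) (perm cyc (off t (enum (CARD('n) - 1)) ?G))"
  proof -
    have "off t (enum (CARD('n) - 1)) ?G = app (gens t 1 (CARD('n) - 1)) (?G (enum 0))"
      unfolding off_def by (rule gens_one_UNIV[symmetric]) (rule G)
    then show ?thesis by (simp only: Yop_eq app_simps app_hp)
  qed
  also have "perm cyc (off t (enum (CARD('n) - 1)) ?G) = off t (cyc (enum (CARD('n) - 1))) ?G"
    by (rule perm_off) (simp_all add: G)
  also have "cyc (enum (CARD('n) - 1)) = (enum 0 :: 'n)"
    using zero_less_card_finite[where 'a = 'n] by (simp add: cyc_enum)
  finally show ?thesis .
qed

text \<open>This is \<open>T_z_T\<close> divided by the eigenvalue t of the right-hand Hecke
  generator on g.\<close>

lemma gens_z_sym: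
  fixes g :: "'n::{finite,linorder} ratfun"
  assumes g: "symmetric g"
  shows "k < CARD('n) \<Longrightarrow> app (gens t t k) (zv 0 * g) = zv k * g"
proof (induction k)
  case (Suc k)
  have "cst t * app (T_op t k) (zv k * g) = app (T_op t k * Mul (zv k) * T_op t k) g"
    using g by (simp add: gen_t[symmetric] app_gen_sym app_gen perm_hom perm_cst symmetricD algebra_simps)
  also have "\<dots> = cst t * (zv (Suc k) * g)"
    using Suc.prems by (subst T_z_T) simp_all
  finally show ?case using Suc qt by (simp add: gen_t cst_eq_0_iff)
qed simp

text \<open>Each of the two terms has a pole at u = v. In the sum the numerator becomes (r - s)(u +
  v)(u - v), so the pole cancels, and the factor u + v accounts for the sum of the inverses on the
  right. Here u, v, s, r stand for x_i, x_j, t, q.\<close>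

lemma b_coeff_field:
  fixes u v s r :: "'a::field"
  assumes "u \<noteq> v" "r * u \<noteq> v" "r * v \<noteq> u" "u \<noteq> 0" "v \<noteq> 0" "r \<noteq> 0"
  shows "(s * u - v) / (u - v) * (inverse u * (inverse r * (1 - (s * (r * u) - v) / (r * u - v)))) +
     (s * v - u) / (v - u) * (inverse v * (inverse r * (1 - (s * (r * v) - u) / (r * v - u)))) =
     ((s - 1) * (s - r) * (inverse u + inverse v)) / ((1 - r * (u / v)) * (1 - r * (v / u)))"
proof -
  have nz: "u - v \<noteq> 0" "v - u \<noteq> 0" "r * u - v \<noteq> 0" "r * v - u \<noteq> 0" "v - r * u \<noteq> 0" "u - r * v \<noteq> 0"
    using assms by auto
  have 1: "inverse u * (inverse r * (1 - (s * (r * u) - v) / (r * u - v))) = (1 - s) / (r * u - v)"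
    "inverse v * (inverse r * (1 - (s * (r * v) - u) / (r * v - u))) = (1 - s) / (r * v - u)"
    using assms nz by (simp_all add: field_simps)
  have 2: "((s - 1) * (s - r) * (inverse u + inverse v)) / ((1 - r * (u / v)) * (1 - r * (v / u))) =
      (s - 1) * (s - r) * (u + v) / ((v - r * u) * (u - r * v))"
  proof -
    have "(1 - r * (u / v)) * (1 - r * (v / u)) = (v - r * u) * (u - r * v) / (u * v)"
      using assms(4,5) by (simp add: field_simps)
    moreover have "inverse u + inverse v = (u + v) / (u * v)"
      using assms(4,5) by (simp add: field_simps)
    ultimately show ?thesis using assms(4,5) by simp
  qed
  have "(s * u - v) / (u - v) * ((1 - s) / (r * u - v)) + (s * v - u) / (v - u) * ((1 - s) / (r * v - u)) =
      ((s * u - v) * (r * v - u) - (s * v - u) * (r * u - v)) * (1 - s) / ((u - v) * (r * u - v) * (r * v - u))"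
    using nz by (simp add: divide_simps) (simp add: algebra_simps)
  also have "(s * u - v) * (r * v - u) - (s * v - u) * (r * u - v) = (r - s) * (u + v) * (u - v)"
    by (simp add: algebra_simps)
  also have "(r - s) * (u + v) * (u - v) * (1 - s) / ((u - v) * (r * u - v) * (r * v - u)) =
      (s - 1) * (s - r) * (u + v) / ((v - r * u) * (u - r * v))"
    using nz by (simp add: divide_simps) (simp add: algebra_simps)
  finally show ?thesis unfolding 1 2 .
qed

lemma ratio_eq: "v \<noteq> 0 \<Longrightarrow> (s * u - v) / (u - v) = (1 - s * (u / v)) / (1 - u / v)"
  for u v s :: "'a::field"
proof -
  assume v: "v \<noteq> 0"
  then have "1 - s * (u / v) = (v - s * u) / v" "1 - u / v = (v - u) / v" by (simp_all add: field_simps)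
  then have "(1 - s * (u / v)) / (1 - u / v) = (v - s * u) / (v - u)" using v by simp
  also have "\<dots> = (- (s * u - v)) / (- (u - v))" by simp
  finally show ?thesis by (simp only: minus_divide_divide)
qed

lemma kappa_at_eq: "kappa_at t b a = (1 - cst t * (var a / var b)) / (1 - var a / var b)"
  unfolding kappa_at_def by (rule ratio_eq) (rule var_nonzero)

lemma scale_kappa_at:
  assumes "a \<noteq> b"
  shows "scale (qpow q a) (kappa_at t b a) = (cst t * (cst q * var a) - var b) / (cst q * var a - var b)"
  using assms qt by (simp add: kappa_at_def scale_hom scale_cst scale_var cst_simps)

lemma scale_kappa_at_eq:
  assumes "a \<noteq> b"
  shows "scale (qpow q a) (kappa_at t b a) = (1 - cst q * cst t * (var a / var b)) / (1 - cst q * (var a / var b))"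
  unfolding scale_kappa_at[OF assms]
  using ratio_eq[of "var b" "cst t" "cst q * var a"] by (simp add: var_nonzero mult_ac)

lemma scale_kappa_at_other:
  assumes "a \<noteq> i" "b \<noteq> i"
  shows "scale (qpow q i) (kappa_at t b a) = kappa_at t b a"
  using assms qt by (simp add: kappa_at_def scale_hom scale_cst scale_var cst_simps)

text \<open>The product T_i T_j arises twice, from a shift in i after one in j and conversely. The
  factors belonging to the other variables are common to both contributions.\<close>

lemma b_coeff_eq:
  assumes "i \<noteq> j"
  shows "b_coeff q t i j =
    (\<Prod>l\<in>UNIV - {i}. kappa_at t l i) * (inverse (var i) * (inverse (cst q) *
      ((1 - scale (qpow q i) (kappa_at t j i)) * (\<Prod>l\<in>UNIV - {i, j}. kappa_at t l j)))) +
    (\<Prod>l\<in>UNIV - {j}. kappa_at t l j) * (inverse (var j) * (inverse (cst q) *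
      ((1 - scale (qpow q j) (kappa_at t i j)) * (\<Prod>l\<in>UNIV - {i, j}. kappa_at t l i))))"
proof -
  let ?Pi = "\<Prod>l\<in>UNIV - {i, j}. kappa_at t l i" and ?Pj = "\<Prod>l\<in>UNIV - {i, j}. kappa_at t l j"
  let ?u = "var i" and ?v = "var j" and ?s = "cst t" and ?r = "cst q"
  have "UNIV - {i} = insert j (UNIV - {i, j})" "UNIV - {j} = insert i (UNIV - {i, j})"
    using assms by auto
  then have P: "(\<Prod>l\<in>UNIV - {i}. kappa_at t l i) = kappa_at t j i * ?Pi" "(\<Prod>l\<in>UNIV - {j}. kappa_at t l j) = kappa_at t i j * ?Pj"
    by simp_all
  have b: "b_coeff q t i j = ((?s - 1) * (?s - ?r) * (inverse ?u + inverse ?v)) /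
      ((1 - ?r * (?u / ?v)) * (1 - ?r * (?v / ?u))) * (?Pi * ?Pj)"
    unfolding b_coeff_def kappa_at_eq by (simp add: prod.distrib prod_dividef)
  have neq: "?u \<noteq> ?v" "?r * ?u \<noteq> ?v" "?r * ?v \<noteq> ?u" "?u \<noteq> 0" "?v \<noteq> 0" "?r \<noteq> (0 :: 'a ratfun)"
    using assms qt cst_mult_var_neq[of i j 1 1] cst_mult_var_neq[of i j q 1] cst_mult_var_neq[of j i q 1]
    by (simp_all add: cst_simps var_nonzero cst_eq_0_iff)
  have "b_coeff q t i j = ((?s * ?u - ?v) / (?u - ?v) * (inverse ?u * (inverse ?r * (1 - (?s * (?r * ?u) - ?v) / (?r * ?u - ?v)))) +
     (?s * ?v - ?u) / (?v - ?u) * (inverse ?v * (inverse ?r * (1 - (?s * (?r * ?v) - ?u) / (?r * ?v - ?u))))) * (?Pi * ?Pj)"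
    unfolding b b_coeff_field[OF neq] ..
  then show ?thesis
    unfolding P scale_kappa_at[OF assms] scale_kappa_at[OF assms[symmetric]] unfolding kappa_at_def[of t j i] kappa_at_def[of t i j]
    by (simp only: distrib_left distrib_right mult_ac)
qed

lemma a_coeff_eq:
  "a_coeff q t i = (\<Prod>l\<in>UNIV - {i}. kappa_at t l i) * (inverse (var i) * (inverse (cst q) *
    scale (qpow q i) (\<Prod>l\<in>UNIV - {i}. kappa_at t l i)))"
proof -
  have "scale (qpow q i) (\<Prod>l\<in>UNIV - {i}. kappa_at t l i) = (\<Prod>l\<in>UNIV - {i}. scale (qpow q i) (kappa_at t l i))"
    using qt by (simp add: scale_hom)
  also have "\<dots> = (\<Prod>l\<in>UNIV - {i}. (1 - cst q * cst t * (var i / var l)) / (1 - cst q * (var i / var l)))"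
    by (intro prod.cong refl scale_kappa_at_eq) auto
  finally have "scale (qpow q i) (\<Prod>l\<in>UNIV - {i}. kappa_at t l i) = \<dots>" .
  then show ?thesis
    unfolding a_coeff_def kappa_at_eq by (simp add: prod.distrib prod_dividef mult_ac)
qed

lemma sum_pairs:
  fixes f :: "'n::{finite,linorder} \<Rightarrow> 'n \<Rightarrow> 'b::comm_monoid_add"
  shows "(\<Sum>i\<in>UNIV. \<Sum>j\<in>UNIV - {i}. f i j) = (\<Sum>(i, j)\<in>{(i, j). i < j}. f i j + f j i)"
proof -
  have "(\<Sum>i\<in>UNIV. \<Sum>j\<in>UNIV - {i}. f i j) = (\<Sum>(i, j)\<in>(SIGMA i:UNIV. UNIV - {i}). f i j)"
    by (rule sum.Sigma) simp_all
  also have "(SIGMA i:UNIV. UNIV - {i :: 'n}) = {(i, j). i < j} \<union> {(i, j). j < i}"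
    by auto
  also have "(\<Sum>(i, j)\<in>{(i, j). i < j} \<union> {(i, j). j < i}. f i j) =
      (\<Sum>(i, j)\<in>{(i, j). i < j}. f i j) + (\<Sum>(i, j)\<in>{(i, j). j < i}. f i j)"
    by (rule sum.union_disjoint) auto
  also have "(\<Sum>(i, j)\<in>{(i, j). j < i}. f i j) = (\<Sum>(i, j)\<in>{(i, j). i < j}. f j i)"
    by (rule sum.reindex_bij_witness[of _ prod.swap prod.swap]) auto
  finally show ?thesis by (simp add: sum.distrib split_def)
qed

abbreviation "fcoeff \<alpha> \<beta> a \<equiv> Mul (cst (if a = 0 then \<beta> else if a = 1 then \<alpha> else inverse q))"

lemma quadratic_Y_sym:
  fixes g :: "'n::{finite,linorder} ratfun"
  assumes g: "symmetric g"
  shows "app (\<Sum>a\<le>(2::nat). fcoeff \<alpha> \<beta> a * Yop ^ a) g =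
    cst \<beta> * g + cst \<alpha> * scale (qpow q (enum 0)) g +
    inverse (cst q) * scale (qpow q (enum 0)) (off t (enum 0) (\<lambda>a. scale (qpow q a) g))"
proof -
  have "(\<Sum>a\<le>(2::nat). fcoeff \<alpha> \<beta> a * (Yop :: 'n ratfun endo) ^ a) =
      Mul (cst \<beta>) + Mul (cst \<alpha>) * Yop + Mul (cst (inverse q)) * (Yop * Yop)"
    unfolding numeral_2_eq_2 by (simp add: mult.assoc)
  then show ?thesis
    using Yop_sym[OF g] Yop_Yop_sym[OF g] by (simp only: app_simps) (simp add: cst_inverse)
qed

lemma scale_qpow_commute: "scale (qpow q i) (scale (qpow q j) f) = scale (qpow q j) (scale (qpow q i) f)"
  using qt by (simp add: scale_scale mult.commute)

text \<open>The right-hand side is the sum of the D_i on g: the right-hand Hecke generators in D_i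
  act on g by t, which cancels the powers of t^-1, and only the left-hand ones survive.\<close>

lemma H21_eq_sum:
  fixes g :: "'n::{finite,linorder} ratfun"
  assumes g: "symmetric g"
  shows "H21 q t \<alpha> \<beta> g = (\<Sum>i<CARD('n). app (gens t t i) (zv 0 * app (\<Sum>a\<le>(2::nat). fcoeff \<alpha> \<beta> a * Yop ^ a) g))"
proof -
  let ?q = "\<lambda>i. scale (qpow q i)"
  let ?E = "\<lambda>a. \<Prod>l\<in>UNIV - {a}. kappa_at t l a :: 'n ratfun"
  let ?G = "\<lambda>a. inverse (var a) * (cst \<alpha> * ?q a g + inverse (cst q) * ?q a (off t a (\<lambda>b. ?q b g)))"
  have q: "perm w (?q a g) = ?q (w a) g" if "bij w" for w a
    using that qt g by (simp add: perm_qshift symmetricD)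
  have G: "perm w (?G a) = ?G (w a)" if w: "bij w" for w a
    using w qt g by (simp add: perm_hom perm_cst perm_var perm_qshift perm_off[OF q] symmetricD)
  \<comment> \<open>The term with \<beta> is split off: \<open>gens_z_sym\<close> turns it directly
    into the plain sum of the inverse variables, whereas \<open>sum_gens_UNIV\<close> would give
    that sum weighted by products of \<open>kappa_at\<close>.\<close>
  have z: "zv 0 * app (\<Sum>a\<le>(2::nat). fcoeff \<alpha> \<beta> a * Yop ^ a) g = ?G (enum 0) + zv 0 * (cst \<beta> * g)"
    unfolding quadratic_Y_sym[OF g] by (simp add: zv_def algebra_simps)
  have sb: "symmetric (cst \<beta> * g)"
    using g by (simp add: symmetric_def perm_hom perm_cst)
  have "(\<Sum>i<CARD('n). app (gens t t i) (zv 0 * app (\<Sum>a\<le>(2::nat). fcoeff \<alpha> \<beta> a * Yop ^ a) g)) =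
      (\<Sum>i<CARD('n). app (gens t t i) (?G (enum 0))) + (\<Sum>i<CARD('n). app (gens t t i) (zv 0 * (cst \<beta> * g)))"
    unfolding z by (simp add: app_add sum.distrib)
  also have "(\<Sum>i<CARD('n). app (gens t t i) (zv 0 * (cst \<beta> * g))) = (\<Sum>i<CARD('n). zv i * (cst \<beta> * g))"
    by (intro sum.cong refl gens_z_sym sb) simp
  also have "\<dots> = (\<Sum>i\<in>UNIV. inverse (var (i :: 'n)) * (cst \<beta> * g))"
    unfolding zv_def by (rule sum.reindex_bij_betw[OF bij_enum, of "\<lambda>i. inverse (var i) * (cst \<beta> * g)"])
  also have "\<dots> = cst \<beta> * (\<Sum>i\<in>UNIV. inverse (var (i :: 'n))) * g"
    by (simp add: sum_distrib_left sum_distrib_right mult_ac)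
  also have "(\<Sum>i<CARD('n). app (gens t t i) (?G (enum 0))) = (\<Sum>a\<in>UNIV. ?E a * ?G a)"
    by (rule sum_gens_UNIV) (rule G)
  also have "\<dots> = cst \<alpha> * (\<Sum>i\<in>UNIV. ?E i * inverse (var i) * ?q i g) +
      (\<Sum>i\<in>UNIV. ?E i * (inverse (var i) * (inverse (cst q) * ?q i (off t i (\<lambda>b. ?q b g)))))"
    by (simp add: sum_distrib_left sum.distrib algebra_simps)
  also have "(\<Sum>i\<in>UNIV. ?E i * (inverse (var i) * (inverse (cst q) * ?q i (off t i (\<lambda>b. ?q b g))))) =
      (\<Sum>i\<in>UNIV. a_coeff q t i * ?q i (?q i g)) +
      (\<Sum>i\<in>UNIV. \<Sum>j\<in>UNIV - {i}. ?E i * (inverse (var i) * (inverse (cst q) *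
        ((1 - ?q i (kappa_at t j i)) * (\<Prod>l\<in>UNIV - {i, j}. kappa_at t l j)))) * ?q i (?q j g))"
  proof -
    \<comment> \<open>The summand at i itself leads to T_i^2, the others to T_i T_j.\<close>
    have off: "off t i (\<lambda>b. ?q b g) = ?E i * ?q i g +
        (\<Sum>j\<in>UNIV - {i}. (1 - kappa_at t j i) * (\<Prod>l\<in>UNIV - {i, j}. kappa_at t l j) * ?q j g)" for i
      unfolding off_def by (subst sum.remove[of UNIV i]) (simp_all add: insert_commute)
    have c: "?q i (\<Prod>l\<in>UNIV - {i, j}. kappa_at t l j) = (\<Prod>l\<in>UNIV - {i, j}. kappa_at t l j)" if "j \<noteq> i" for i j
      using qt that by (subst field_hom.prod[OF field_hom_scale]) (simp, intro prod.cong refl scale_kappa_at_other, auto)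
    have s: "?q i (off t i (\<lambda>b. ?q b g)) = ?q i (?E i) * ?q i (?q i g) +
        (\<Sum>j\<in>UNIV - {i}. (1 - ?q i (kappa_at t j i)) * (\<Prod>l\<in>UNIV - {i, j}. kappa_at t l j) * ?q i (?q j g))" for i
    proof -
      have h: "field_hom (?q i)" using qt by (simp add: field_hom_scale)
      show ?thesis
        unfolding off field_hom.add[OF h] field_hom.sum[OF h] field_hom.mult[OF h] field_hom.diff[OF h] field_hom.one[OF h]
        by (intro arg_cong2[of _ _ _ _ "(+)"] refl sum.cong) (simp add: c)
    qed
    show ?thesis
      unfolding s a_coeff_eq by (simp only: distrib_left sum_distrib_left sum.distrib mult.assoc)
  qed
  also have "(\<Sum>i\<in>UNIV. \<Sum>j\<in>UNIV - {i}. ?E i * (inverse (var i) * (inverse (cst q) *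
        ((1 - ?q i (kappa_at t j i)) * (\<Prod>l\<in>UNIV - {i, j}. kappa_at t l j)))) * ?q i (?q j g)) =
      (\<Sum>(i, j)\<in>{(i, j). i < j}. b_coeff q t i j * ?q i (?q j g))"
    unfolding sum_pairs
  proof (intro sum.cong refl, clarify)
    fix i j :: 'n assume "i < j"
    then have "i \<noteq> j" by simp
    have e: "?q j (?q i g) = ?q i (?q j g)" by (rule scale_qpow_commute)
    show "?E i * (inverse (var i) * (inverse (cst q) *
        ((1 - ?q i (kappa_at t j i)) * (\<Prod>l\<in>UNIV - {i, j}. kappa_at t l j)))) * ?q i (?q j g) +
      ?E j * (inverse (var j) * (inverse (cst q) *
        ((1 - ?q j (kappa_at t i j)) * (\<Prod>l\<in>UNIV - {j, i}. kappa_at t l i)))) * ?q j (?q i g) =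
      b_coeff q t i j * ?q i (?q j g)"
      unfolding b_coeff_eq[OF \<open>i \<noteq> j\<close>] e insert_commute[of j i] distrib_right ..
  qed
  finally show ?thesis
    unfolding H21_def q_shift_eq_scale kappa_at_eq by (simp add: add_ac)
qed

end

section \<open>Operators on symmetric functions\<close>

lemma scale_one: "scale (\<lambda>_. 1) f = f"
proof -
  have "mpol_scale (\<lambda>_. 1) = (id :: 'a mpol \<Rightarrow> _)"
    by (rule ext, rule poly_mapping_eqI) (simp add: lookup_mpol_scale)
  moreover obtain a b where "f = Fract a b" "b \<noteq> 0" by (cases f)
  ultimately show ?thesis
    using fract_map_Fract[OF injective_hom_mpol_scale[of "\<lambda>_. 1"], of b a] by (simp add: scale_def)
qed

lemma perm_id: "perm id f = f"
  using perm_adj_perm_adj[of 0 f] by (simp add: perm_perm del: perm_adj_perm_adj)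

lemma sym_if_adj:
  fixes f :: "'n::{finite,linorder} ratfun"
  assumes "\<And>k. Suc k < CARD('n) \<Longrightarrow> perm (adj k) f = f"
  shows "symmetric f"
  unfolding symmetric_def
proof (intro allI impI)
  have tr: "perm (transpose (enum i) (enum j)) f = f" if "i < j" "j < CARD('n)" for i j
    using that
  proof (induction j)
    case (Suc j)
    show ?case
    proof (cases "i = j")
      case True
      then show ?thesis using assms Suc by (simp add: adj_def)
    next
      case False
      then have ij: "i < j" using Suc by simp
      have e: "(transpose (enum i) (enum (Suc j)) :: 'n \<Rightarrow> 'n) =
          adj j \<circ> (transpose (enum i) (enum j) \<circ> adj j)"
        by (rule enum_ext) (use ij Suc.prems in \<open>auto simp: adj_enum transpose_def enum_eq_iff\<close>)
      show ?thesis
      proof -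
        have "perm (adj j) (perm (transpose (enum i) (enum j)) (perm (adj j) f)) = f"
          using Suc ij assms[of j] by simp
        then show ?thesis
          unfolding e by (simp only: perm_perm bij_comp bij_adj bij_transpose)
      qed
    qed
  qed simp
  have tr': "perm (transpose a b) f = f" for a b :: 'n
  proof -
    obtain i j where "i < CARD('n)" "a = enum i" "j < CARD('n)" "b = enum j" by (metis enum_cases)
    then show ?thesis
      using tr[of i j] tr[of j i] by (cases i j rule: linorder_cases) (auto simp: perm_id transpose_commute)
  qed
  fix w :: "'n \<Rightarrow> 'n" assume "bij w"
  then have "w permutes UNIV" by (intro bij_imp_permutes) simp_all
  from this finite have "bij w \<and> perm w f = f"
  proof (induction rule: permutes_induct)
    case id
    show ?case by (intro conjI bij_id perm_id)
  next
    case (swap a b p)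
    have "perm (transpose a b \<circ> p) f = perm (transpose a b) (perm p f)"
      by (rule perm_perm[symmetric]) (use swap in simp_all)
    moreover have "bij (transpose a b \<circ> p)" using swap by (intro bij_comp) simp_all
    ultimately show ?case using swap tr' by (intro conjI) (simp_all only:)
  qed
  then show "perm w f = f" ..
qed

lemma T_sym: "symmetric f \<Longrightarrow> app (T_op t k) f = cst t * f"
  by (simp add: app_T symmetricD)

lemma kappa_nonzero:
  assumes "t \<noteq> 0" "i < CARD('n)" "j < CARD('n)" "i \<noteq> j"
  shows "kappa t i j \<noteq> (0 :: 'n::{finite,linorder} ratfun)"
  using assms cst_mult_var_neq[of "enum j :: 'n" "enum i" t 1] cst_mult_var_neq[of "enum j :: 'n" "enum i" 1 1]
  by (simp add: kappa_def enum_eq_iff cst_simps)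

text \<open>The eigenvalue equation says that \<open>kappa\<close> times the difference of
  \<open>perm (adj k) f\<close> and f vanishes, and \<open>kappa\<close> is nonzero. Thus symmetric
  functions are the common eigenspace of the Hecke generators for t.\<close>

lemma sym_if_T:
  fixes f :: "'n::{finite,linorder} ratfun"
  assumes "t \<noteq> 0" "\<And>k. Suc k < CARD('n) \<Longrightarrow> app (T_op t k) f = cst t * f"
  shows "symmetric f"
proof (rule sym_if_adj)
  fix k assume "Suc k < CARD('n)"
  with assms(2)[OF this] kappa_nonzero[of t k "Suc k", where 'n = 'n] assms(1)
  show "perm (adj k) f = f" by (simp add: app_T)
qed

section \<open>Independence of rescalings on symmetric functions\<close>

definition emb :: "'n mpol \<Rightarrow> 'n::linorder ratfun" where "emb p = Fract p 1"

lemma emb_simps: "emb (p + r) = emb p + emb r" "emb (p * r) = emb p * emb r" "emb 0 = 0" "emb 1 = 1"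
  by (simp_all add: emb_def Zero_fract_def One_fract_def)

lemma emb_eq_0_iff: "emb p = 0 \<longleftrightarrow> p = 0"
  by (simp add: emb_def Zero_fract_def eq_fract)

lemma emb_sum: "emb (sum g I) = (\<Sum>i\<in>I. emb (g i))"
  by (induction I rule: infinite_finite_induct) (simp_all add: emb_simps)

lemma sum_cst_var_eq_0:
  fixes d :: "'n::{finite,linorder} \<Rightarrow> complex"
  assumes "(\<Sum>i\<in>UNIV. cst (d i) * var i) = 0"
  shows "d i = 0"
proof -
  let ?p = "\<Sum>i\<in>UNIV. single (single i (1::nat)) (d i)"
  have "emb ?p = (\<Sum>i\<in>UNIV. cst (d i) * var i)"
    unfolding emb_sum by (intro sum.cong refl) (simp add: emb_def cst_def var_def mult_single)
  then have "?p = 0" using assms by (simp add: emb_eq_0_iff)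
  then have "lookup ?p (single i 1) = 0" by (simp only: lookup_zero)
  moreover have "lookup ?p (single i 1) = (\<Sum>j\<in>UNIV. if j = i then d j else 0)"
  proof -
    have "single j (1::nat) = single i 1 \<longleftrightarrow> j = i" for j :: 'n
      by (metis lookup_single_eq lookup_single_not_eq one_neq_zero)
    then show ?thesis
      unfolding lookup_sum by (intro sum.cong refl) (simp add: lookup_single when_def)
  qed
  ultimately show ?thesis by simp
qed

text \<open>Dedekind independence of characters; the power sum \<open>\<Sum>\<^sub>i x\<^sub>i\<close> separates the characters.\<close>

lemma scale_independent_on_sym:
  fixes c :: "('n::{finite,linorder} \<Rightarrow> complex) \<Rightarrow> 'n ratfun"
  assumes "finite F" "\<And>a. a \<in> F \<Longrightarrow> nonzero a"
    and "\<And>g. symmetric g \<Longrightarrow> (\<Sum>a\<in>F. c a * scale a g) = 0" and "a \<in> F"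
  shows "c a = 0"
  using assms
proof (induction F arbitrary: c a)
  case (insert b F)
  define s :: "'n ratfun" where "s = (\<Sum>i\<in>UNIV. var i)"
  have s: "symmetric s"
    unfolding symmetric_def s_def
  proof (intro allI impI)
    fix w :: "'n \<Rightarrow> 'n" assume w: "bij w"
    then have "perm w (\<Sum>i\<in>UNIV. var i) = (\<Sum>i\<in>UNIV. var (w i))" by (simp add: perm_hom perm_var)
    then show "perm w (\<Sum>i\<in>UNIV. var i) = (\<Sum>i\<in>UNIV. var i)"
      using sum.reindex_bij_betw[of w UNIV UNIV var] w by simp
  qed
  have sc: "scale a s = (\<Sum>i\<in>UNIV. cst (a i) * var i)" if "nonzero a" for a
    using that by (simp add: s_def scale_hom scale_var)
  have "c a * (scale a s - scale b s) = 0" if "a \<in> F" for a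
  proof (rule insert.IH[of "\<lambda>a. c a * (scale a s - scale b s)"])
    fix g :: "'n ratfun" assume g: "symmetric g"
    have "symmetric (s * g)" using s g by (simp add: symmetric_def perm_hom)
    then have "(\<Sum>a\<in>insert b F. c a * scale a (s * g)) = 0" using insert.prems by blast
    moreover have "(\<Sum>a\<in>insert b F. c a * scale a (s * g)) = (\<Sum>a\<in>insert b F. c a * scale a s * scale a g)"
      using insert.prems(1) by (intro sum.cong refl) (simp add: field_hom.mult[OF field_hom_scale])
    moreover have "(\<Sum>a\<in>insert b F. c a * scale a g) = 0" using insert.prems g by blast
    ultimately have "(\<Sum>a\<in>insert b F. c a * scale a s * scale a g) - scale b s * (\<Sum>a\<in>insert b F. c a * scale a g) = 0"
      by simp
    also have "(\<Sum>a\<in>insert b F. c a * scale a s * scale a g) - scale b s * (\<Sum>a\<in>insert b F. c a * scale a g) =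
        (\<Sum>a\<in>insert b F. c a * (scale a s - scale b s) * scale a g)"
      by (simp add: sum_distrib_left algebra_simps flip: sum_subtractf)
    finally show "(\<Sum>a\<in>F. c a * (scale a s - scale b s) * scale a g) = 0"
      using insert.hyps by simp
  qed (use insert.prems that in auto)
  moreover have "scale a s \<noteq> scale b s" if "a \<in> F" for a
  proof
    assume e: "scale a s = scale b s"
    have "nonzero a" "nonzero b" using that insert.prems by auto
    then have "(\<Sum>i\<in>UNIV. cst (a i - b i) * var i) = 0"
      using e by (simp add: sc cst_simps left_diff_distrib sum_subtractf)
    then have "a i - b i = 0" for i by (rule sum_cst_var_eq_0)
    then have "a = b" by (simp add: fun_eq_iff)
    then show False using that insert.hyps by simp
  qed
  ultimately have cF: "c a = 0" if "a \<in> F" for a using that by fastforce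
  have "symmetric (1 :: 'n ratfun)" by (simp add: symmetric_def perm_hom)
  then have "(\<Sum>a\<in>insert b F. c a * scale a 1) = 0" using insert.prems(2) by blast
  moreover have "scale b 1 = 1" using insert.prems(1)[of b] by (simp add: scale_hom)
  ultimately have "c b = 0" using insert.hyps cF by simp
  then show ?case using cF insert.prems by auto
qed simp

section \<open>Difference operators with nonnegative exponents\<close>

definition qpowers :: "complex \<Rightarrow> ('n \<Rightarrow> complex) set" where
  "qpowers q = {a. \<exists>\<mu> :: 'n \<Rightarrow> nat. a = (\<lambda>i. q ^ \<mu> i)}"

lemma nonzero_qpowers: "q \<noteq> 0 \<Longrightarrow> a \<in> qpowers q \<Longrightarrow> nonzero a"
  by (auto simp: qpowers_def nonzero_def)

lemma qpowers_mult: "a \<in> qpowers q \<Longrightarrow> b \<in> qpowers q \<Longrightarrow> (\<lambda>i. a i * b i) \<in> qpowers q"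
proof -
  assume "a \<in> qpowers q" "b \<in> qpowers q"
  then obtain \<mu> \<nu> :: "'a \<Rightarrow> nat" where "a = (\<lambda>i. q ^ \<mu> i)" "b = (\<lambda>i. q ^ \<nu> i)" by (auto simp: qpowers_def)
  then have "(\<lambda>i. a i * b i) = (\<lambda>i. q ^ (\<mu> i + \<nu> i))" by (simp add: power_add)
  then show ?thesis unfolding qpowers_def by (intro CollectI exI)
qed

lemma qpow_in_qpowers: "qpow q i \<in> qpowers q"
  unfolding qpowers_def by (intro CollectI exI[of _ "\<lambda>j. if j = i then 1 else 0"]) auto

lemma one_in_qpowers: "(\<lambda>_. 1) \<in> qpowers q"
  unfolding qpowers_def by (intro CollectI exI[of _ "\<lambda>_. 0"]) simp

lemma qpowers_comp: "a \<in> qpowers q \<Longrightarrow> (\<lambda>i. a (w i)) \<in> qpowers q"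
proof -
  assume "a \<in> qpowers q"
  then obtain \<mu> :: "'a \<Rightarrow> nat" where "a = (\<lambda>i. q ^ \<mu> i)" by (auto simp: qpowers_def)
  then have "(\<lambda>i. a (w i)) = (\<lambda>i. q ^ \<mu> (w i))" by simp
  then show ?thesis unfolding qpowers_def by (intro CollectI exI)
qed

text \<open>\<open>D0\<close> and the Hecke generators involve no inverse shift, so nonnegative
  exponents suffice for every operator that occurs.\<close>

inductive_set pos_ops :: "complex \<Rightarrow> 'n::{finite,linorder} ratop set" for q where
  basic: "a \<in> qpowers q \<Longrightarrow> (\<lambda>f. c * scale a f) \<in> pos_ops q"
| add: "D \<in> pos_ops q \<Longrightarrow> E \<in> pos_ops q \<Longrightarrow> (\<lambda>f. D f + E f) \<in> pos_ops q"

lemma pos_ops_mult: "(\<lambda>f. c * f) \<in> pos_ops q"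
  using pos_ops.basic[OF one_in_qpowers, of c] by (simp add: scale_one)

lemma pos_ops_sum:
  "(\<And>i. i \<in> I \<Longrightarrow> (\<lambda>f. Q i f) \<in> pos_ops q) \<Longrightarrow> (\<lambda>f. \<Sum>i\<in>I. Q i f) \<in> pos_ops q"
proof (induction I rule: infinite_finite_induct)
  case (insert i I)
  then show ?case by (simp add: pos_ops.add)
qed (use pos_ops_mult[of 0] in simp_all)

lemma pos_ops_normal_form:
  assumes "Q \<in> pos_ops q"
  shows "\<exists>F c. finite F \<and> F \<subseteq> qpowers q \<and> Q = (\<lambda>f. \<Sum>a\<in>F. c a * scale a f)"
  using assms
proof induction
  case (basic a c)
  then show ?case by (intro exI[of _ "{a}"] exI[of _ "\<lambda>_. c"]) simp
next
  case (add D E)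
  then obtain F c G d where *: "finite F" "F \<subseteq> qpowers q" "D = (\<lambda>f. \<Sum>a\<in>F. c a * scale a f)"
    "finite G" "G \<subseteq> qpowers q" "E = (\<lambda>f. \<Sum>a\<in>G. d a * scale a f)" by blast
  let ?e = "\<lambda>a. (if a \<in> F then c a else 0) + (if a \<in> G then d a else 0)"
  have "(\<Sum>a\<in>F \<union> G. ?e a * scale a f) = D f + E f" for f
  proof -
    have "(\<Sum>a\<in>F \<union> G. ?e a * scale a f) = (\<Sum>a\<in>F \<union> G. if a \<in> F then c a * scale a f else 0) +
        (\<Sum>a\<in>F \<union> G. if a \<in> G then d a * scale a f else 0)"
      unfolding sum.distrib[symmetric] by (intro sum.cong refl) (simp add: distrib_right)
    also have "(\<Sum>a\<in>F \<union> G. if a \<in> F then c a * scale a f else 0) = (\<Sum>a\<in>F. c a * scale a f)"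
      using * by (intro sum.mono_neutral_cong_right) auto
    also have "(\<Sum>a\<in>F \<union> G. if a \<in> G then d a * scale a f else 0) = (\<Sum>a\<in>G. d a * scale a f)"
      using * by (intro sum.mono_neutral_cong_right) auto
    finally show ?thesis using * by simp
  qed
  then show ?case using * by (intro exI[of _ "F \<union> G"] exI[of _ ?e]) (auto simp: fun_eq_iff)
qed

context
  fixes q :: complex
  assumes q: "q \<noteq> 0"
begin

lemma pos_ops_comp:
  assumes "D \<in> pos_ops q" "E \<in> pos_ops q"
  shows "D \<circ> E \<in> pos_ops q"
  using assms
proof (induction D)
  case (basic a c)
  then have a: "field_hom (scale a)" "nonzero a" using q by (auto intro: field_hom_scale nonzero_qpowers)
  from \<open>E \<in> pos_ops q\<close> show ?case
  proof induction
    case (basic b d)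
    have "(\<lambda>f. c * scale a f) \<circ> (\<lambda>f. d * scale b f) = (\<lambda>f. c * scale a d * scale (\<lambda>i. a i * b i) f)"
      using basic a q nonzero_qpowers[OF q basic]
      by (simp add: fun_eq_iff field_hom.mult[OF a(1)] scale_scale mult.assoc)
    then show ?case
      using pos_ops.basic[OF qpowers_mult[OF \<open>a \<in> qpowers q\<close> basic], of "c * scale a d"] by simp
  next
    case (add D E)
    then show ?case
      using pos_ops.add[OF add.IH] by (simp add: comp_def field_hom.add[OF a(1)] distrib_left)
  qed
next
  case (add D D')
  then show ?case using pos_ops.add[of "D \<circ> E" q "D' \<circ> E"] by (simp add: comp_def)
qed

lemma pos_ops_uminus: "D \<in> pos_ops q \<Longrightarrow> (\<lambda>f. - D f) \<in> pos_ops q"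
  using pos_ops_comp[OF pos_ops_mult[of "-1"]] by (simp add: comp_def)

text \<open>Written as a combination of distinct rescalings, the difference of the operators has all
  coefficients zero by \<open>scale_independent_on_sym\<close>. This lifts commutation on symmetric
  functions to commutation of operators.\<close>

lemma pos_ops_eqI:
  assumes "D \<in> pos_ops q" "E \<in> pos_ops q" "\<And>g. symmetric g \<Longrightarrow> D g = E g"
  shows "D = E"
proof -
  have "(\<lambda>f. D f + - E f) \<in> pos_ops q" using assms by (intro pos_ops.add pos_ops_uminus)
  from pos_ops_normal_form[OF this]
  obtain F c where F: "finite F" "F \<subseteq> qpowers q" "(\<lambda>f. D f + - E f) = (\<lambda>f. \<Sum>a\<in>F. c a * scale a f)"
    by (elim exE conjE)
  have "(\<Sum>a\<in>F. c a * scale a g) = 0" if "symmetric g" for g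
    using fun_cong[OF F(3), of g] assms(3)[OF that] by simp
  then have "c a = 0" if "a \<in> F" for a
    using scale_independent_on_sym[of F c a] F that nonzero_qpowers[OF q] by blast
  then have "(\<Sum>a\<in>F. c a * scale a f) = 0" for f
    by (intro sum.neutral) simp
  then have "D f + - E f = 0" for f
    using fun_cong[OF F(3), of f] by (simp only:)
  then show ?thesis by (simp add: fun_eq_iff)
qed

lemma scale_in_qdiff_ops:
  fixes a :: "'n::{finite,linorder} \<Rightarrow> complex"
  assumes "a \<in> qpowers q"
  shows "scale a \<in> qdiff_ops q"
proof -
  obtain \<mu> :: "'n \<Rightarrow> nat" where \<mu>: "a = (\<lambda>i. q ^ \<mu> i)" using assms by (auto simp: qpowers_def)
  have id: "(scale (\<lambda>_. 1) :: 'n ratop) \<in> qdiff_ops q"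
  proof -
    have e: "scale (\<lambda>_. 1) = (\<lambda>f :: 'n ratfun. 1 * f)" by (simp add: scale_one fun_eq_iff)
    show ?thesis unfolding e by (rule qdiff_ops.mult)
  qed
  have single: "scale (\<lambda>j. if j = i then q ^ k else 1) \<in> qdiff_ops q" for i :: 'n and k
  proof (induction k)
    case 0
    show ?case unfolding power_0 if_cancel by (rule id)
  next
    case (Suc k)
    have "q_shift q i \<circ> scale (\<lambda>j. if j = i then q ^ k else 1) = scale (\<lambda>j. if j = i then q ^ Suc k else 1)"
      unfolding q_shift_eq_scale using q
      by (simp add: fun_eq_iff scale_scale nonzero_def) (intro allI arg_cong2[of _ _ _ _ scale] refl ext, simp)
    then show ?case using qdiff_ops.comp[OF qdiff_ops.shift[of q i] Suc] by simp
  qed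
  have "scale (\<lambda>j. if j \<in> S then q ^ \<mu> j else 1) \<in> qdiff_ops q" for S :: "'n set"
    using finite[of S]
  proof (induction S)
    case empty
    then show ?case using id by simp
  next
    case (insert i S)
    have "scale (\<lambda>j. if j = i then q ^ \<mu> i else 1) \<circ> scale (\<lambda>j. if j \<in> S then q ^ \<mu> j else 1) =
        scale (\<lambda>j. if j \<in> insert i S then q ^ \<mu> j else 1)"
      using q insert.hyps
      by (simp add: fun_eq_iff scale_scale nonzero_def) (intro allI arg_cong2[of _ _ _ _ scale] refl ext, auto)
    then show ?case using qdiff_ops.comp[OF single insert.IH, of i "\<mu> i"] by simp
  qed
  from this[of UNIV] show ?thesis by (simp add: \<mu>)
qed

lemma pos_ops_subset: "pos_ops q \<subseteq> qdiff_ops q"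
proof
  fix D assume "D \<in> pos_ops q"
  then show "D \<in> qdiff_ops q"
  proof induction
    case (basic a c)
    have "(\<lambda>f. c * f) \<circ> scale a \<in> qdiff_ops q"
      using basic by (intro qdiff_ops.comp qdiff_ops.mult scale_in_qdiff_ops)
    then show ?case by (simp add: comp_def)
  qed (rule qdiff_ops.add)
qed

text \<open>Since \<open>w \<circ> c T\<^sup>\<mu> = w(c) T\<^sup>w\<^sup>(\<^sup>\<mu>\<^sup>) \<circ> w\<close>, a difference-reflection operator agrees on
  symmetric functions with a difference operator.\<close>

definition reducible :: "'n::{finite,linorder} ratfun endo set" where
  "reducible = {L. \<forall>Q\<in>pos_ops q. \<exists>Q'\<in>pos_ops q. \<forall>g. symmetric g \<longrightarrow> app L (Q g) = Q' g}"

lemma reducible_add: "L \<in> reducible \<Longrightarrow> M \<in> reducible \<Longrightarrow> L + M \<in> reducible"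
  unfolding reducible_def
proof (intro CollectI ballI)
  fix Q :: "'a ratop" assume "L \<in> {L. \<forall>Q\<in>pos_ops q. \<exists>Q'\<in>pos_ops q. \<forall>g. symmetric g \<longrightarrow> app L (Q g) = Q' g}"
    "M \<in> {L. \<forall>Q\<in>pos_ops q. \<exists>Q'\<in>pos_ops q. \<forall>g. symmetric g \<longrightarrow> app L (Q g) = Q' g}" "Q \<in> pos_ops q"
  then obtain Q1 Q2 where *: "Q1 \<in> pos_ops q" "Q2 \<in> pos_ops q"
    "\<forall>g. symmetric g \<longrightarrow> app L (Q g) = Q1 g" "\<forall>g. symmetric g \<longrightarrow> app M (Q g) = Q2 g" by blast
  then show "\<exists>Q'\<in>pos_ops q. \<forall>g. symmetric g \<longrightarrow> app (L + M) (Q g) = Q' g"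
    by (intro bexI[of _ "\<lambda>f. Q1 f + Q2 f"]) (auto intro: pos_ops.add)
qed

text \<open>This closure is why \<open>reducible\<close> quantifies over all \<open>Q\<close>: the
  right factor sends a symmetric g to a function that need not be symmetric but has the form
  \<open>Q g\<close>.\<close>

lemma reducible_mult: "L \<in> reducible \<Longrightarrow> M \<in> reducible \<Longrightarrow> L * M \<in> reducible"
  unfolding reducible_def by simp metis

lemma reducible_Mul: "Mul r \<in> reducible"
  unfolding reducible_def
proof (intro CollectI ballI)
  fix Q :: "'a ratop" assume "Q \<in> pos_ops q"
  then have "(\<lambda>f. r * f) \<circ> Q \<in> pos_ops q" by (intro pos_ops_comp pos_ops_mult)
  then show "\<exists>Q'\<in>pos_ops q. \<forall>g. symmetric g \<longrightarrow> app (Mul r) (Q g) = Q' g" by (rule bexI[rotated]) simp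
qed

lemma reducible_Scale: "Scale (qpow q i) \<in> reducible"
  unfolding reducible_def
proof (intro CollectI ballI)
  fix Q :: "'a ratop" assume "Q \<in> pos_ops q"
  then have "(\<lambda>f. 1 * scale (qpow q i) f) \<circ> Q \<in> pos_ops q"
    by (intro pos_ops_comp pos_ops.basic qpow_in_qpowers)
  then show "\<exists>Q'\<in>pos_ops q. \<forall>g. symmetric g \<longrightarrow> app (Scale (qpow q i)) (Q g) = Q' g"
    using q by (intro bexI[rotated, of "(\<lambda>f. 1 * scale (qpow q i) f) \<circ> Q"]) simp_all
qed

lemma reducible_Perm:
  assumes w: "bij w" shows "Perm w \<in> reducible"
proof -
  have "\<exists>Q'\<in>pos_ops q. \<forall>g. symmetric g \<longrightarrow> perm w (Q g) = Q' g" if "Q \<in> pos_ops q" for Q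
    using that
  proof induction
    case (basic a c)
    let ?b = "\<lambda>i. a (inv w i)"
    have b: "?b \<in> qpowers q" using basic by (rule qpowers_comp)
    have "(\<lambda>i. ?b (w i)) = a" using w by (simp add: bij_is_inj)
    then have "perm w (c * scale a g) = perm w c * scale ?b g" if "symmetric g" for g
      using perm_scale[OF w nonzero_qpowers[OF q b], of g] that w by (simp add: perm_hom symmetricD)
    then show ?case using pos_ops.basic[OF b] by (intro bexI[of _ "\<lambda>f. perm w c * scale ?b f"]) auto
  next
    case (add D E)
    then obtain D' E' where "D' \<in> pos_ops q" "\<forall>g. symmetric g \<longrightarrow> perm w (D g) = D' g"
      "E' \<in> pos_ops q" "\<forall>g. symmetric g \<longrightarrow> perm w (E g) = E' g" by blast
    then show ?case
      using w by (intro bexI[of _ "\<lambda>f. D' f + E' f"]) (auto simp: perm_hom intro: pos_ops.add)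
  qed
  then show ?thesis using w by (simp add: reducible_def)
qed

lemma reducible_one: "1 \<in> reducible"
  by (auto simp: reducible_def)

lemma reducible_zero: "0 \<in> reducible"
  using reducible_Mul[of 0] by (simp add: Mul_simps)

lemma reducible_uminus: "L \<in> reducible \<Longrightarrow> - L \<in> reducible"
  using reducible_mult[OF reducible_Mul[of "-1"], of L] by (simp add: Mul_simps)

lemma reducible_diff: "L \<in> reducible \<Longrightarrow> M \<in> reducible \<Longrightarrow> L - M \<in> reducible"
  using reducible_add[OF _ reducible_uminus, of L M] by simp

lemma reducible_power: "L \<in> reducible \<Longrightarrow> L ^ k \<in> reducible"
  by (induction k) (simp_all add: reducible_one reducible_mult)

lemma reducible_sum: "(\<And>i. i \<in> I \<Longrightarrow> L i \<in> reducible) \<Longrightarrow> sum L I \<in> reducible"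
  by (induction I rule: infinite_finite_induct) (simp_all add: reducible_zero reducible_add)

lemma reducible_T: "T_op t k \<in> reducible"
  unfolding T_op_def
  by (intro reducible_add reducible_mult reducible_Mul reducible_diff reducible_Perm reducible_one bij_adj)

lemma reducible_p: "pi_op q \<in> reducible"
  unfolding pi_op_def by (intro reducible_mult reducible_Scale reducible_Perm bij_cyc)

lemma reducible_restrict:
  assumes "L \<in> reducible"
  shows "\<exists>Q\<in>pos_ops q. \<forall>g. symmetric g \<longrightarrow> Q g = app L g"
proof -
  have "(\<lambda>f. 1 * f) \<in> pos_ops q" by (rule pos_ops_mult)
  then obtain Q' where "Q' \<in> pos_ops q" "\<forall>g. symmetric g \<longrightarrow> app L (1 * g) = Q' g"
    using assms unfolding reducible_def by blast
  then show ?thesis by (intro bexI[of _ Q']) simp_all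
qed

end

section \<open>The commutative algebra\<close>

inductive_set subalgebra :: "'a::ring_1 set \<Rightarrow> 'a set" for G where
  gen: "x \<in> G \<Longrightarrow> x \<in> subalgebra G"
| add: "x \<in> subalgebra G \<Longrightarrow> y \<in> subalgebra G \<Longrightarrow> x + y \<in> subalgebra G"
| mult: "x \<in> subalgebra G \<Longrightarrow> y \<in> subalgebra G \<Longrightarrow> x * y \<in> subalgebra G"

lemma subalgebra_commute_gen:
  assumes "x \<in> subalgebra G" "\<And>y. y \<in> G \<Longrightarrow> y * z = z * y"
  shows "x * z = z * x"
  using assms(1)
proof induction
  case (mult x y)
  then show ?case by (metis commutes_mult)
qed (simp_all add: assms(2) distrib_left distrib_right)

lemma subalgebra_commute:
  assumes "x \<in> subalgebra G" "y \<in> subalgebra G" "\<And>x y. x \<in> G \<Longrightarrow> y \<in> G \<Longrightarrow> x * y = y * x"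
  shows "x * y = y * x"
  using assms subalgebra_commute_gen by metis

text \<open>The parameter \<open>dim\<close> ties the locale to the index type, which q, t,
  \<alpha>, \<beta> do not mention.\<close>

locale quantum_params =
  fixes q t \<alpha> \<beta> :: complex and dim :: "'n::{finite,linorder} itself"
  assumes q0: "q \<noteq> 0" and t0: "t \<noteq> 0"
begin

definition D0 :: "'n ratfun endo" where
  "D0 = Mul (zv 0) * (\<Sum>a\<le>(2::nat). fcoeff q \<alpha> \<beta> a * Yop q t ^ a)"

sublocale daha "T_op t :: nat \<Rightarrow> 'n ratfun endo" "Mul (cst t)" "Mul (cst (inverse t))" "CARD('n) - 1" "Mul (zv 0)" "pi_op q"
  by (rule daha_ops[OF q0 t0])

sublocale affine_hecke "T_op t :: nat \<Rightarrow> 'n ratfun endo" "Mul (cst t)" "Mul (cst (inverse t))" "CARD('n) - 1" D0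
  unfolding D0_def
  by (rule affine_hecke_quadratic)
    (simp_all add: T_commute_cst p_cst[OF q0] Mul_commute)

lemma Suc_num: "Suc (CARD('n) - 1) = CARD('n)"
  by simp

lemma Yop_cst: "Yop q t * Mul (cst c) = Mul (cst c) * (Yop q t :: 'n ratfun endo)"
proof -
  have P: "Mul (cst c) * P k = P k * (Mul (cst c) :: 'n ratfun endo)" for k
    by (induction k) (simp_all add: commutes_mult S_def algebra_simps T_commute_cst Mul_commute)
  show ?thesis unfolding Y_def by (rule commutes_mult[symmetric]) (simp_all only: P p_cst[OF q0])
qed

lemma D0_cst: "D0 * Mul (cst c) = Mul (cst c) * D0"
  unfolding D0_def
  by (rule commutes_mult[symmetric])
    (rule commutes_mult commutes_sum commutes_power Mul_commute Yop_cst[symmetric])+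

lemma tower_cst: "tower D0 k * Mul (cst c) = Mul (cst c) * tower D0 k"
proof (induction k)
  case (Suc k)
  show ?case
    unfolding tower.simps
    by (rule sym, (rule commutes_mult)+) (simp_all only: Mul_commute T_commute_cst Suc)
qed (simp add: D0_cst)

definition gens_set :: "'n ratfun endo set" where
  "gens_set = range (\<lambda>c. Mul (cst c)) \<union> tower D0 ` {..(CARD('n) - 1)}"

text \<open>Described by commutation with the Hecke generators and not as symmetric polynomials in
  the D_i, so that closure under sums and products is immediate.\<close>

definition central :: "'n ratfun endo set" where
  "central = {L \<in> subalgebra gens_set. \<forall>i<(CARD('n) - 1). T_op t i * L = L * T_op t i}"

lemma central_commute: "L \<in> central \<Longrightarrow> M \<in> central \<Longrightarrow> L * M = M * L"
proof -
  have "A * B = B * A" if "A \<in> gens_set" "B \<in> gens_set" for A B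
    using that unfolding gens_set_def
    by (elim UnE imageE) (simp_all only: Mul_commute tower_cst X_X atMost_iff)
  then show "L \<in> central \<Longrightarrow> M \<in> central \<Longrightarrow> L * M = M * L"
    unfolding central_def by (blast intro: subalgebra_commute)
qed

lemma central_cst: "Mul (cst c) \<in> central"
  by (auto simp: central_def gens_set_def T_commute_cst intro: subalgebra.gen)

lemma central_add: "L \<in> central \<Longrightarrow> M \<in> central \<Longrightarrow> L + M \<in> central"
  by (auto simp: central_def distrib_left distrib_right intro: subalgebra.add)

lemma central_mult: "L \<in> central \<Longrightarrow> M \<in> central \<Longrightarrow> L * M \<in> central"
  by (auto simp: central_def intro: subalgebra.mult commutes_mult)

lemma esym_in_subalgebra: "k \<le> Suc (CARD('n) - 1) \<Longrightarrow> esym (tower D0) k r \<in> subalgebra gens_set"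
proof (induction k arbitrary: r)
  case 0
  have "Mul (cst 1) \<in> subalgebra gens_set" "Mul (cst 0) \<in> subalgebra gens_set"
    by (auto simp: gens_set_def intro: subalgebra.gen)
  then show ?case by (cases r) (simp_all add: cst_simps Mul_simps)
next
  case (Suc k)
  have "Mul (cst 1) \<in> subalgebra gens_set" by (auto simp: gens_set_def intro: subalgebra.gen)
  moreover have "tower D0 k \<in> subalgebra gens_set"
    using Suc.prems by (auto simp: gens_set_def intro: subalgebra.gen)
  ultimately show ?case
    using Suc by (cases r) (auto simp: cst_simps Mul_simps intro: subalgebra.add subalgebra.mult)
qed

lemma esym_central: "esym (tower D0) (CARD('n)) r \<in> central"
  using esym_in_subalgebra[of "CARD('n)" r] T_esym[of _ "CARD('n)" r] Suc_num
  unfolding central_def by auto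

text \<open>Symmetric functions form the common eigenspace of the Hecke generators, and an operator
  commuting with these generators and with constants preserves it.\<close>

lemma central_sym:
  assumes "L \<in> central" "symmetric g"
  shows "symmetric (app L g)"
proof (rule sym_if_T[OF t0])
  fix k assume "Suc k < CARD('n)"
  then have k: "k < (CARD('n) - 1)" by simp
  then have "app (T_op t k) (app L g) = app (L * T_op t k) g"
    using assms(1) by (simp add: central_def flip: app_simps(6))
  also have "\<dots> = app (L * Mul (cst t)) g" using T_sym[OF assms(2)] by simp
  also have "\<dots> = app (Mul (cst t) * L) g" using central_commute[OF assms(1) central_cst] by simp
  finally show "app (T_op t k) (app L g) = cst t * app L g" by simp
qed

lemma central_reducible: "L \<in> central \<Longrightarrow> L \<in> reducible q"
proof -
  note r = reducible_Mul[OF q0] reducible_T[OF q0] reducible_p[OF q0]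
  have S: "S k \<in> reducible q" for k
    unfolding S_def using r reducible_one[OF q0] by (intro reducible_diff[OF q0])
  have P: "P k \<in> reducible q" for k
    by (induction k) (simp_all add: S reducible_one[OF q0] reducible_mult[OF q0])
  have "Y \<in> reducible q" unfolding Y_def using r P by (intro reducible_mult[OF q0])
  then have D0: "D0 \<in> reducible q"
    unfolding D0_def using r by (intro reducible_mult[OF q0] reducible_sum[OF q0] reducible_power[OF q0])
  have tower: "tower D0 k \<in> reducible q" for k
    by (induction k) (simp_all add: D0 r reducible_mult[OF q0])
  have "L \<in> reducible q" if "L \<in> subalgebra gens_set" for L
    using that
    by induction (auto simp: gens_set_def r tower intro: reducible_add[OF q0] reducible_mult[OF q0])
  then show "L \<in> central \<Longrightarrow> L \<in> reducible q" by (simp add: central_def)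
qed

definition hamiltonians :: "'n ratop set" where
  "hamiltonians = {Q \<in> pos_ops q. \<exists>L\<in>central. \<forall>g. symmetric g \<longrightarrow> Q g = app L g}"

text \<open>The two compositions agree on symmetric functions with \<open>L * M\<close> and
  \<open>M * L\<close>, where \<open>central_sym\<close> keeps the intermediate function symmetric;
  \<open>pos_ops_eqI\<close> then yields equality as operators.\<close>

lemma commutative_hamiltonians: "commutative_qdiff_algebra q hamiltonians"
  unfolding commutative_qdiff_algebra_def
proof (intro conjI allI ballI)
  show "hamiltonians \<subseteq> qdiff_ops q"
    using pos_ops_subset[OF q0] by (auto simp: hamiltonians_def)
  show "(\<lambda>f. cst c * f) \<in> hamiltonians" for c
    using central_cst[of c] by (auto simp: hamiltonians_def pos_ops_mult intro!: bexI[of _ "Mul (cst c)"])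
  fix D E assume "D \<in> hamiltonians" "E \<in> hamiltonians"
  then obtain L M where *: "D \<in> pos_ops q" "E \<in> pos_ops q" "L \<in> central" "M \<in> central"
      "\<And>g. symmetric g \<Longrightarrow> D g = app L g" "\<And>g. symmetric g \<Longrightarrow> E g = app M g"
    by (auto simp: hamiltonians_def)
  show "(\<lambda>f. D f + E f) \<in> hamiltonians"
    unfolding hamiltonians_def using * central_add
    by (auto intro: pos_ops.add intro!: bexI[of _ "L + M"])
  have DE: "(D \<circ> E) g = app (L * M) g" "(E \<circ> D) g = app (M * L) g" if "symmetric g" for g
    using * that central_sym by simp_all
  have c: "D \<circ> E \<in> pos_ops q" "E \<circ> D \<in> pos_ops q"
    using * by (simp_all add: pos_ops_comp[OF q0])
  show "D \<circ> E \<in> hamiltonians"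
    unfolding hamiltonians_def using c DE central_mult[OF *(3,4)] by blast
  show "D \<circ> E = E \<circ> D"
    using c DE central_commute[OF *(3,4)] by (intro pos_ops_eqI[OF q0]) simp_all
qed

lemma hamiltonian_of_central: "L \<in> central \<Longrightarrow> \<exists>Q\<in>hamiltonians. \<forall>g. symmetric g \<longrightarrow> Q g = app L g"
proof -
  assume L: "L \<in> central"
  then obtain Q where "Q \<in> pos_ops q" "\<forall>g. symmetric g \<longrightarrow> Q g = app L g"
    using reducible_restrict[OF q0 central_reducible] by blast
  with L show ?thesis unfolding hamiltonians_def by blast
qed

text \<open>On a symmetric function each right-hand Hecke generator acts by t and cancels the factor
  t^-1 of its step.\<close>

lemma tower_sym:
  assumes "symmetric g"
  shows "app (tower D0 k) g = app (gens t t k) (app D0 g)"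
proof (induction k)
  case (Suc k)
  have tt: "cst (inverse t) * cst t = (1 :: 'n ratfun)"
    using t0 by (simp add: cst_simps(4) flip: cst_simps(2))
  have "app (tower D0 (Suc k)) g = cst (inverse t) * app (T_op t k) (app (tower D0 k * Mul (cst t)) g)"
    using T_sym[OF assms] by simp
  also have "\<dots> = cst (inverse t) * app (T_op t k * Mul (cst t)) (app (tower D0 k) g)"
    unfolding tower_cst by simp
  also have "\<dots> = cst (inverse t) * cst t * app (T_op t k) (app (tower D0 k) g)"
    unfolding T_commute_cst by (simp add: mult.assoc)
  finally show ?case using Suc by (simp add: tt gen_t)
qed simp

lemma esym_one: "esym X k (Suc 0) = sum X {..<k}"
  by (induction k) (simp_all add: add.commute)

lemma H21_hamiltonian: "H21 q t \<alpha> \<beta> \<in> hamiltonians"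
proof -
  have "H21 q t \<alpha> \<beta> g = app (esym (tower D0) (CARD('n)) (Suc 0)) g" if "symmetric g" for g
  proof -
    have "app (esym (tower D0) (CARD('n)) (Suc 0)) g = (\<Sum>i<CARD('n). app (tower D0 i) g)"
      by (simp only: esym_one sum_app)
    then show ?thesis
      unfolding H21_eq_sum[OF q0 t0 that] tower_sym[OF that] unfolding D0_def app_simps(6,7) by (rule sym)
  qed
  moreover have "(H21 q t \<alpha> \<beta> :: 'n ratop) \<in> pos_ops q"
  proof -
    have s1: "(\<lambda>f. c * q_shift q i f) \<in> pos_ops q" for c and i :: 'n
      unfolding q_shift_eq_scale by (intro pos_ops.basic qpow_in_qpowers)
    have s2: "(\<lambda>f. c * q_shift q i (q_shift q j f)) \<in> pos_ops q" for c and i j :: 'n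
      using pos_ops_comp[OF q0 s1[of c i] s1[of 1 j]] by (simp add: comp_def)
    have s3: "(\<lambda>f. case x of (i, j) \<Rightarrow> c i j * q_shift q i (q_shift q j f)) \<in> pos_ops q"
      for c and x :: "'n \<times> 'n"
      by (cases x) (simp add: s2)
    have s4: "(\<lambda>f. c * (\<Sum>i\<in>UNIV. d i * q_shift q i f)) \<in> pos_ops q" for c and d :: "'n \<Rightarrow> 'n ratfun"
      using pos_ops_comp[OF q0 pos_ops_mult[of c] pos_ops_sum[of UNIV "\<lambda>i f. d i * q_shift q i f", OF s1]] by (simp add: comp_def)
    have "(\<lambda>f :: 'n ratfun. H21 q t \<alpha> \<beta> f) \<in> pos_ops q"
      unfolding H21_def by (intro pos_ops.add pos_ops_sum s2 s3 s4 pos_ops_mult)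
    then show ?thesis by simp
  qed
  ultimately show ?thesis
    unfolding hamiltonians_def using esym_central[of "Suc 0"] by blast
qed

end

section \<open>Monomials and evaluation\<close>

definition monom :: "(nat \<Rightarrow> 'b::monoid_mult) \<Rightarrow> ('n::{finite,linorder} \<Rightarrow>\<^sub>0 nat) \<Rightarrow> 'b" where
  "monom X m = prod_list (map (\<lambda>k. X k ^ lookup m (enum k)) [0..<CARD('n)])"

definition tdeg :: "('n::finite \<Rightarrow>\<^sub>0 nat) \<Rightarrow> nat" where
  "tdeg m = (\<Sum>i\<in>UNIV. lookup m i)"

lemma tdeg_add: "tdeg (m + k) = tdeg m + tdeg k"
  by (simp add: tdeg_def lookup_add sum.distrib)

lemma tdeg_single [simp]: "tdeg (single i k) = k"
  by (simp add: tdeg_def lookup_single when_def)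

lemma tdeg_zero [simp]: "tdeg 0 = 0"
  by (simp add: tdeg_def)

lemma exponent_cases:
  fixes m :: "'n::{finite,linorder} \<Rightarrow>\<^sub>0 nat"
  obtains "m = 0" | m' j where "j < CARD('n)" "m = single (enum j) 1 + m'"
proof (cases "m = 0")
  case False
  then obtain i where i: "lookup m i \<noteq> 0" by (auto simp: poly_mapping_eq_iff fun_eq_iff)
  obtain j where j: "j < CARD('n)" "i = enum j" by (rule enum_cases)
  have "m = single (enum j) 1 + (m - single (enum j) 1)"
    using i j by (intro poly_mapping_eqI) (auto simp: lookup_add lookup_minus lookup_single when_def)
  with j that show thesis by blast
qed

lemma exponent_induct [case_names zero step]:
  fixes m :: "'n::{finite,linorder} \<Rightarrow>\<^sub>0 nat"
  assumes "P 0" "\<And>m j. j < CARD('n) \<Longrightarrow> P m \<Longrightarrow> P (single (enum j) 1 + m)"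
  shows "P m"
proof (induction "tdeg m" arbitrary: m rule: less_induct)
  case less
  show ?case
    by (cases m rule: exponent_cases) (use assms less in \<open>auto simp: tdeg_add\<close>)
qed

lemma finite_tdeg: "finite {m :: 'n::{finite,linorder} \<Rightarrow>\<^sub>0 nat. tdeg m \<le> d}"
proof (rule finite_imageD)
  have "lookup m i \<le> d" if "tdeg m \<le> d" for m :: "'n \<Rightarrow>\<^sub>0 nat" and i
    using that member_le_sum[of i UNIV "lookup m"] by (simp add: tdeg_def)
  then have "lookup ` {m :: 'n \<Rightarrow>\<^sub>0 nat. tdeg m \<le> d} \<subseteq> PiE UNIV (\<lambda>_. {..d})"
    unfolding PiE_UNIV_domain by blast
  then show "finite (lookup ` {m :: 'n \<Rightarrow>\<^sub>0 nat. tdeg m \<le> d})"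
    by (rule finite_subset) (intro finite_PiE finite finite_atMost)
  show "inj_on lookup {m :: 'n \<Rightarrow>\<^sub>0 nat. tdeg m \<le> d}"
    by (rule inj_onI) (rule poly_mapping_eq_iff[THEN iffD2])
qed

lemma prod_list_power_add:
  fixes X :: "nat \<Rightarrow> 'b::monoid_mult"
  assumes "\<And>i j. i \<in> set ks \<Longrightarrow> j \<in> set ks \<Longrightarrow> X i * X j = X j * X i"
  shows "prod_list (map (\<lambda>k. X k ^ (a k + b k)) ks) =
    prod_list (map (\<lambda>k. X k ^ a k) ks) * prod_list (map (\<lambda>k. X k ^ b k) ks)"
  using assms
proof (induction ks)
  case (Cons i ks)
  have "X i * prod_list (map (\<lambda>k. X k ^ a k) js) = prod_list (map (\<lambda>k. X k ^ a k) js) * X i"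
    if "set js \<subseteq> set (i # ks)" for js
    using that by (induction js) (auto intro!: commutes_mult commutes_power Cons.prems)
  from this[of ks] have "X i ^ b i * prod_list (map (\<lambda>k. X k ^ a k) ks) = prod_list (map (\<lambda>k. X k ^ a k) ks) * X i ^ b i"
    by (intro power_commuting_commutes) auto
  then show ?case
    using Cons by (simp add: power_add mult.assoc) (simp flip: mult.assoc)
qed simp

lemma monom_zero [simp]: "monom X 0 = 1"
proof -
  have "prod_list (map (\<lambda>k. X k ^ 0) ks) = 1" for ks by (induction ks) simp_all
  then show ?thesis by (simp add: monom_def)
qed

lemma monom_add:
  fixes m m' :: "'n::{finite,linorder} \<Rightarrow>\<^sub>0 nat"
  assumes "\<And>i j. i < CARD('n) \<Longrightarrow> j < CARD('n) \<Longrightarrow> X i * X j = X j * X i"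
  shows "monom X (m + m') = monom X m * monom X m'"
  unfolding monom_def lookup_add by (rule prod_list_power_add) (use assms in auto)

lemma monom_single:
  assumes "j < CARD('n)"
  shows "monom X (single (enum j :: 'n::{finite,linorder}) 1) = X j"
proof -
  have "map (\<lambda>k. X k ^ lookup (single (enum j :: 'n) 1) (enum k)) [0..<CARD('n)] =
      map (\<lambda>k. if k = j then X j else 1) [0..<CARD('n)]"
    using assms by (intro map_cong refl) (auto simp: lookup_single when_def enum_eq_iff)
  moreover have "prod_list (map (\<lambda>k. if k = j then X j else 1) [0..<l]) = (if j < l then X j else 1)" for l
    by (induction l) auto
  ultimately show ?thesis using assms by (simp only: monom_def if_True)
qed

lemma monom_step:
  fixes m :: "'n::{finite,linorder} \<Rightarrow>\<^sub>0 nat"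
  assumes "\<And>i j. i < CARD('n) \<Longrightarrow> j < CARD('n) \<Longrightarrow> X i * X j = X j * X i" "j < CARD('n)"
  shows "monom X (single (enum j) 1 + m) = X j * monom X m"
  by (subst monom_add) (use assms(1) in blast, simp only: monom_single[OF assms(2)])

global_interpretation ratfun: vector_space "\<lambda>c (f :: 'n::{finite,linorder} ratfun). cst c * f"
  by unfold_locales (simp_all add: cst_simps algebra_simps)

abbreviation "rspan \<equiv> ratfun.span"

definition lin :: "'n::{finite,linorder} ratfun endo \<Rightarrow> bool" where
  "lin L \<longleftrightarrow> (\<forall>c. L * Mul (cst c) = Mul (cst c) * L)"

lemma lin_app: "lin L \<Longrightarrow> app L (cst c * f) = cst c * app L f"
proof -
  assume "lin L"
  then have "app (L * Mul (cst c)) f = app (Mul (cst c) * L) f" by (simp only: lin_def)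
  then show ?thesis by simp
qed

lemma lin_span:
  assumes "lin L" "\<And>s. s \<in> S \<Longrightarrow> app L s \<in> rspan B" "f \<in> rspan S"
  shows "app L f \<in> rspan B"
  using assms(3)
proof (induction rule: ratfun.span_induct_alt)
  case base
  show ?case by (simp add: ratfun.span_zero)
next
  case (step c x y)
  then show ?case
    using assms by (simp add: app_add lin_app ratfun.span_add ratfun.span_scale)
qed

section \<open>Stability of spans of monomials\<close>

definition mspan :: "(nat \<Rightarrow> 'n::{finite,linorder} ratfun endo) \<Rightarrow> 'n ratfun \<Rightarrow> nat \<Rightarrow> 'n ratfun set" where
  "mspan X g d = rspan ((\<lambda>m. app (monom X m) g) ` {m :: 'n \<Rightarrow>\<^sub>0 nat. tdeg m \<le> d})"

lemma mspan_simps: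
  "0 \<in> mspan X g d" "f \<in> mspan X g d \<Longrightarrow> h \<in> mspan X g d \<Longrightarrow> f + h \<in> mspan X g d"
  "f \<in> mspan X g d \<Longrightarrow> h \<in> mspan X g d \<Longrightarrow> f - h \<in> mspan X g d"
  "f \<in> mspan X g d \<Longrightarrow> cst c * f \<in> mspan X g d"
  by (simp_all add: mspan_def ratfun.span_zero ratfun.span_add ratfun.span_diff ratfun.span_scale)

lemma mspan_mono: "d \<le> e \<Longrightarrow> mspan X g d \<subseteq> mspan X g e"
  unfolding mspan_def by (intro ratfun.span_mono image_mono) auto

lemma mspan_base: "g \<in> mspan X g d"
  unfolding mspan_def by (intro ratfun.span_base image_eqI[of _ _ 0]) simp_all

lemma mspan_zero_cases: "f \<in> mspan X g 0 \<Longrightarrow> \<exists>c. f = cst c * g"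
proof -
  have "{m :: 'a \<Rightarrow>\<^sub>0 nat. tdeg m \<le> 0} = {0}"
    by (auto simp: tdeg_def poly_mapping_eq_iff fun_eq_iff)
  then show "f \<in> mspan X g 0 \<Longrightarrow> \<exists>c. f = cst c * g"
    by (auto simp: mspan_def ratfun.span_singleton)
qed

locale commuting =
  fixes X :: "nat \<Rightarrow> 'n::{finite,linorder} ratfun endo"
  assumes X_X: "i < CARD('n) \<Longrightarrow> j < CARD('n) \<Longrightarrow> X i * X j = X j * X i"
    and X_lin: "i < CARD('n) \<Longrightarrow> lin (X i)"
begin

lemma monom_X_step:
  "j < CARD('n) \<Longrightarrow> monom X (single (enum j :: 'n) 1 + m) = X j * monom X m"
  by (rule monom_step) (rule X_X)

lemma X_mspan:
  assumes "j < CARD('n)" "f \<in> mspan X g d"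
  shows "app (X j) f \<in> mspan X g (Suc d)"
proof -
  have "app (X j) (app (monom X m) g) \<in> mspan X g (Suc d)" if "tdeg m \<le> d" for m :: "'n \<Rightarrow>\<^sub>0 nat"
  proof -
    have "app (X j) (app (monom X m) g) = app (monom X (single (enum j) 1 + m)) g"
      by (simp only: monom_X_step[OF assms(1)] app_simps)
    then show ?thesis
      unfolding mspan_def using that by (intro ratfun.span_base image_eqI) (auto simp: tdeg_add)
  qed
  then have "app (X j) s \<in> mspan X g (Suc d)"
    if "s \<in> (\<lambda>m. app (monom X m) g) ` {m :: 'n \<Rightarrow>\<^sub>0 nat. tdeg m \<le> d}" for s
    using that by auto
  then show ?thesis
    using assms(2) unfolding mspan_def by (rule lin_span[OF X_lin[OF assms(1)]])
qed

text \<open>Induction along the filtration by degree. The third hypothesis is supplied with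
  stability in degree d, so it suffices to have a relation that moves \<open>L\<close> past a single
  \<open>X j\<close> at the cost of one degree.\<close>

lemma mspan_stable:
  assumes "lin L" "\<exists>c. app L g = cst c * g"
    and "\<And>j f d. j < CARD('n) \<Longrightarrow> f \<in> mspan X g d \<Longrightarrow> (\<And>h. h \<in> mspan X g d \<Longrightarrow> app L h \<in> mspan X g d) \<Longrightarrow>
      app L (app (X j) f) \<in> mspan X g (Suc d)"
  shows "f \<in> mspan X g d \<Longrightarrow> app L f \<in> mspan X g d"
proof (induction d arbitrary: f)
  case 0
  then obtain c where "f = cst c * g" using mspan_zero_cases by blast
  moreover obtain c' where "app L g = cst c' * g" using assms(2) by blast
  ultimately show ?case using assms(1) by (simp add: lin_app mspan_simps mspan_base)
next
  case (Suc d)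
  have "app L (app (monom X m) g) \<in> mspan X g (Suc d)" if "tdeg m \<le> Suc d" for m :: "'n \<Rightarrow>\<^sub>0 nat"
  proof (cases m rule: exponent_cases)
    case 1
    obtain c' where "app L g = cst c' * g" using assms(2) by blast
    then show ?thesis using 1 by (simp add: mspan_simps mspan_base)
  next
    case (2 m' j)
    have "app (monom X m) g = app (X j) (app (monom X m') g)"
      by (simp only: monom_X_step[OF 2(1)] 2(2) app_simps)
    moreover have "app (monom X m') g \<in> mspan X g d"
      unfolding mspan_def using that 2 by (intro ratfun.span_base image_eqI) (auto simp: tdeg_add)
    ultimately show ?thesis using assms(3)[OF 2(1) _ Suc.IH] by simp
  qed
  then have "app L s \<in> mspan X g (Suc d)"
    if "s \<in> (\<lambda>m. app (monom X m) g) ` {m :: 'n \<Rightarrow>\<^sub>0 nat. tdeg m \<le> Suc d}" for s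
    using that by auto
  then show ?case
    using Suc.prems unfolding mspan_def by (rule lin_span[OF assms(1)])
qed

end

section \<open>Monomials in the inverse variables\<close>

definition x_mono :: "('n::linorder \<Rightarrow>\<^sub>0 nat) \<Rightarrow> 'n ratfun" where
  "x_mono m = emb (single m 1)"

lemma x_mono_add: "x_mono (m + k) = x_mono m * x_mono k"
  by (simp add: x_mono_def mult_single flip: emb_simps)

lemma x_mono_zero [simp]: "x_mono 0 = 1"
  by (simp add: x_mono_def single_one emb_simps)

lemma x_mono_single: "x_mono (single i 1) = var i"
  by (simp add: x_mono_def emb_def var_def)

lemma x_mono_nonzero: "x_mono m \<noteq> 0"
  unfolding x_mono_def emb_eq_0_iff by (metis lookup_single_eq lookup_zero one_neq_zero)

lemma emb_single: "emb (single m c) = cst c * x_mono m"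
  by (simp add: x_mono_def cst_def emb_def mult_single)

lemma monom_z:
  fixes m :: "'n::{finite,linorder} \<Rightarrow>\<^sub>0 nat"
  shows "app (monom (\<lambda>k. Mul (zv k)) m) f = inverse (x_mono m) * f"
proof (induction m rule: exponent_induct)
  case (step m j)
  have "monom (\<lambda>k. Mul (zv k)) (single (enum j) 1 + m) =
      Mul (zv j) * (monom (\<lambda>k. Mul (zv k)) m :: 'n ratfun endo)"
    by (rule monom_step) (use step Mul_commute in auto)
  then show ?case using step by (simp add: x_mono_add x_mono_single[simplified] zv_def mult.assoc)
qed simp

lemma inverse_xmono_independent:
  fixes c :: "('n::{finite,linorder} \<Rightarrow>\<^sub>0 nat) \<Rightarrow> complex"
  assumes "finite A" "(\<Sum>m\<in>A. cst (c m) * inverse (x_mono m)) = 0" "m \<in> A"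
  shows "c m = 0"
proof -
  \<comment> \<open>The sum of all exponents bounds each of them, so multiplication by
    \<open>x_mono L\<close> clears the denominators, and the truncated differences
    \<open>L - m\<close> are exact.\<close>
  define L where "L = (\<Sum>m\<in>A. m)"
  have L: "L = (L - m) + m" if "m \<in> A" for m
  proof (rule poly_mapping_eqI)
    fix i
    have "lookup m i \<le> (\<Sum>m\<in>A. lookup m i)"
      using assms(1) that by (intro member_le_sum) auto
    then show "lookup L i = lookup (L - m + m) i"
      by (simp add: L_def lookup_add lookup_minus lookup_sum)
  qed
  have i: "inverse (x_mono m) * x_mono L = x_mono (L - m)" if "m \<in> A" for m
  proof -
    have "x_mono L = x_mono (L - m) * x_mono m" using L[OF that] x_mono_add by metis
    then show ?thesis using x_mono_nonzero[of m] by simp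
  qed
  have "emb (\<Sum>m\<in>A. single (L - m) (c m)) = (\<Sum>m\<in>A. cst (c m) * inverse (x_mono m)) * x_mono L"
    unfolding emb_sum sum_distrib_right
    by (intro sum.cong refl) (simp add: emb_single mult.assoc i)
  then have "(\<Sum>m\<in>A. single (L - m) (c m)) = 0"
    using assms(2) by (simp add: emb_eq_0_iff)
  then have "(\<Sum>m'\<in>A. lookup (single (L - m') (c m')) (L - m)) = 0"
    by (simp flip: lookup_sum)
  moreover have "(\<Sum>m'\<in>A. lookup (single (L - m') (c m')) (L - m)) =
      (\<Sum>m'\<in>A. if m' = m then c m else 0)"
  proof (intro sum.cong refl)
    fix m' assume m': "m' \<in> A"
    have "L - m' = L - m \<longleftrightarrow> m' = m" using L[OF m'] L[OF assms(3)] by (metis add_left_cancel)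
    then show "lookup (single (L - m') (c m')) (L - m) = (if m' = m then c m else 0)"
      by (auto simp: lookup_single when_def)
  qed
  ultimately show ?thesis using assms by simp
qed

section \<open>Linear algebra\<close>

lemma eigenvectors_independent:
  fixes e :: "complex \<Rightarrow> 'n::{finite,linorder} ratfun"
  assumes "lin L" "finite U" "\<And>u. u \<in> U \<Longrightarrow> e u \<noteq> 0 \<and> app L (e u) = cst u * e u"
    and "(\<Sum>u\<in>U. cst (c u) * e u) = 0" "u \<in> U"
  shows "c u = 0"
  using assms(2-)
proof (induction U arbitrary: c u)
  case (insert b U)
  have s: "(\<Sum>u\<in>insert b U. cst (c u) * e u) = 0" by (rule insert.prems)
  have "app L (\<Sum>u\<in>insert b U. cst (c u) * e u) = (\<Sum>u\<in>insert b U. cst (c u) * (cst u * e u))"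
    unfolding app_sum using insert.prems(1) by (intro sum.cong refl) (simp add: lin_app[OF assms(1)])
  then have "(\<Sum>u\<in>insert b U. cst (c u) * (cst u * e u)) - cst b * (\<Sum>u\<in>insert b U. cst (c u) * e u) = 0"
    using s by simp
  moreover have "(\<Sum>u\<in>insert b U. cst (c u) * (cst u * e u)) - cst b * (\<Sum>u\<in>insert b U. cst (c u) * e u) =
      (\<Sum>u\<in>insert b U. cst (c u * (u - b)) * e u)"
    unfolding sum_distrib_left sum_subtractf[symmetric]
    by (intro sum.cong refl) (simp add: cst_simps algebra_simps)
  ultimately have "(\<Sum>u\<in>U. cst (c u * (u - b)) * e u) = 0"
    using insert.hyps by (simp add: cst_simps)
  then have "c u * (u - b) = 0" if "u \<in> U" for u
    using insert.IH[of "\<lambda>u. c u * (u - b)"] insert.prems(1) that by blast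
  then have U: "c u = 0" if "u \<in> U" for u
    using that insert.hyps by fastforce
  then have "cst (c b) * e b = 0" using s insert.hyps by (simp add: cst_simps)
  then have "c b = 0" using insert.prems(1)[of b] by (simp add: cst_eq_0_iff)
  then show ?case using U insert.prems by auto
qed simp

text \<open>The span need not be stable under \<open>L\<close>: eigenvectors in it for distinct
  eigenvalues are independent, so there are at most \<open>card B\<close> of them.\<close>

lemma finite_eigenvalues:
  fixes B :: "'n::{finite,linorder} ratfun set"
  assumes "lin L" "finite B"
  shows "finite {u. \<exists>h\<in>rspan B. h \<noteq> 0 \<and> app L h = cst u * h}" (is "finite ?U")
proof (rule ccontr)
  assume "infinite ?U"
  from infinite_arbitrarily_large[OF this, of "Suc (card B)"]
  obtain U where U: "finite U" "card U = Suc (card B)" "U \<subseteq> ?U"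
    by (elim exE conjE)
  then have "\<forall>u\<in>U. \<exists>h\<in>rspan B. h \<noteq> 0 \<and> app L h = cst u * h" by blast
  then obtain e where e: "\<And>u. u \<in> U \<Longrightarrow> e u \<in> rspan B \<and> e u \<noteq> 0 \<and> app L (e u) = cst u * e u"
    by metis
  have inj: "inj_on e U"
  proof (rule inj_onI)
    fix u v assume "u \<in> U" "v \<in> U" "e u = e v"
    then have "cst u * e u = cst v * e u" "e u \<noteq> 0" using e by metis+
    then show "u = v" by (simp add: cst_eq_iff)
  qed
  have "ratfun.independent (e ` U)"
  proof (rule ratfun.independent_if_scalars_zero)
    fix f x assume *: "(\<Sum>x\<in>e ` U. cst (f x) * x) = 0" "x \<in> e ` U"
    then have "(\<Sum>u\<in>U. cst (f (e u)) * e u) = 0" by (simp add: sum.reindex[OF inj])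
    then have "f (e u) = 0" if "u \<in> U" for u
      using eigenvectors_independent[OF assms(1) U(1), of e "\<lambda>u. f (e u)"] e that by blast
    then show "f x = 0" using * by auto
  qed (use U in simp)
  moreover have "e ` U \<subseteq> rspan B" using e by auto
  ultimately have "card (e ` U) \<le> card B"
    using ratfun.independent_span_bound[OF assms(2)] by blast
  then show False using U by (simp add: card_image[OF inj])
qed

lemma injective_imp_surjective:
  fixes B :: "'n::{finite,linorder} ratfun set"
  assumes L: "lin L" "\<And>f. f \<in> rspan B \<Longrightarrow> app L f \<in> rspan B" "\<And>f. f \<in> rspan B \<Longrightarrow> app L f = 0 \<Longrightarrow> f = 0"
    and B: "finite B" "ratfun.independent B" and h: "h \<in> rspan B"
  shows "\<exists>f\<in>rspan B. h = app L f"
proof -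
  have inj: "inj_on (app L) (rspan B)"
  proof (rule inj_onI)
    fix f g assume *: "f \<in> rspan B" "g \<in> rspan B" "app L f = app L g"
    then have "f - g \<in> rspan B" "app L (f - g) = 0" by (simp_all add: ratfun.span_diff app_diff)
    then have "f - g = 0" by (rule L(3))
    then show "f = g" by simp
  qed
  have injB: "inj_on (app L) B" using inj by (rule inj_on_subset) (rule ratfun.span_superset)
  have ind: "ratfun.independent (app L ` B)"
  proof (rule ratfun.independent_if_scalars_zero)
    fix c x assume *: "(\<Sum>x\<in>app L ` B. cst (c x) * x) = 0" "x \<in> app L ` B"
    then have "app L (\<Sum>b\<in>B. cst (c (app L b)) * b) = 0"
      by (simp add: sum.reindex[OF injB] app_sum lin_app[OF L(1)])
    moreover have "(\<Sum>b\<in>B. cst (c (app L b)) * b) \<in> rspan B"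
      by (intro ratfun.span_sum ratfun.span_scale ratfun.span_base)
    ultimately have "(\<Sum>b\<in>B. cst (c (app L b)) * b) = 0"
      by (rule L(3)[rotated])
    then have "c (app L b) = 0" if "b \<in> B" for b
      using ratfun.independentD[OF B(2) B(1) subset_refl, of "\<lambda>b. c (app L b)"] that by blast
    then show "c x = 0" using * by auto
  qed (use B in simp)
  have sub: "app L ` B \<subseteq> rspan B" using L(2) ratfun.span_base by blast
  have "B \<subseteq> rspan (app L ` B)"
  proof
    fix b assume b: "b \<in> B"
    show "b \<in> rspan (app L ` B)"
    proof (rule ccontr)
      assume nb: "b \<notin> rspan (app L ` B)"
      then have "ratfun.independent (insert b (app L ` B))"
        using ind by (intro ratfun.independent_insertI)
      moreover have "insert b (app L ` B) \<subseteq> rspan B" using sub b ratfun.span_base by blast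
      ultimately have "card (insert b (app L ` B)) \<le> card B"
        using ratfun.independent_span_bound[OF B(1)] by blast
      moreover have "b \<notin> app L ` B" using nb ratfun.span_base by blast
      ultimately show False using B(1) card_image[OF injB] by simp
    qed
  qed
  then have "h \<in> rspan (app L ` B)"
    using h ratfun.span_minimal[OF _ ratfun.subspace_span, of B "app L ` B"] by blast
  then show ?thesis
  proof (induction rule: ratfun.span_induct_alt)
    case base
    show ?case by (intro bexI[of _ 0]) (simp_all add: ratfun.span_zero)
  next
    case (step c x y)
    then obtain b f where "b \<in> B" "x = app L b" "f \<in> rspan B" "y = app L f" by blast
    then show ?case
      by (intro bexI[of _ "cst c * b + f"])
        (simp_all add: app_add lin_app[OF L(1)] ratfun.span_add ratfun.span_scale ratfun.span_base)
  qed
qed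

section \<open>Linear independence of the monomials in the commuting operators\<close>

lemma monom_cong:
  "(\<And>k. k < CARD('n) \<Longrightarrow> X k = X' k) \<Longrightarrow> monom X (m :: 'n::{finite,linorder} \<Rightarrow>\<^sub>0 nat) = monom X' m"
  unfolding monom_def by (intro arg_cong[of _ _ prod_list] map_cong refl) simp

lemma mspan_cong:
  fixes X X' :: "nat \<Rightarrow> 'n::{finite,linorder} ratfun endo"
  assumes "\<And>k. k < CARD('n) \<Longrightarrow> X k = X' k"
  shows "mspan X g d = mspan X' g d"
proof -
  have "monom X m = monom X' m" for m :: "'n \<Rightarrow>\<^sub>0 nat"
    by (rule monom_cong) (rule assms)
  then show ?thesis by (simp add: mspan_def)
qed

text \<open>Used twice: with the multiplication by \<open>zv 0\<close>, whose tower consists of the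
  multiplications by the inverse variables, and with \<open>D0\<close>.\<close>

locale poly_action =
  affine_hecke "T_op t" "Mul (cst t)" "Mul (cst (inverse t))" "CARD('n) - 1" X0
  for t and X0 :: "'n::{finite,linorder} ratfun endo" +
  assumes lin_X: "k < CARD('n) \<Longrightarrow> lin (tower X0 k)"
begin

sublocale commuting X
  by unfold_locales (auto intro: X_X lin_X)

text \<open>The Bernstein relations express \<open>T_op t j * X i\<close> through products
  \<open>X k * T_op t j\<close> and multiples of \<open>X k\<close>, as \<open>mspan_stable\<close>
  requires.\<close>

lemma T_mspan:
  assumes j: "Suc j < CARD('n)" and g: "symmetric g"
  shows "f \<in> mspan X g d \<Longrightarrow> app (T_op t j) f \<in> mspan X g d"
proof (rule mspan_stable)
  show "lin (T_op t j :: 'n ratfun endo)" by (simp add: lin_def T_commute_cst)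
  show "\<exists>c. app (T_op t j) g = cst c * g" using T_sym[OF g] by blast
  fix i f d assume i: "i < CARD('n)" and f: "f \<in> mspan X g d"
    and IH: "\<And>h. h \<in> mspan X g d \<Longrightarrow> app (T_op t j) h \<in> mspan X g d"
  consider "i = j" | "i = Suc j" | "i \<noteq> j" "i \<noteq> Suc j" by blast
  then show "app (T_op t j) (app (X i) f) \<in> mspan X g (Suc d)"
  proof cases
    case 1
    have "app (T_op t j) (app (X j) f) = app (T_op t j * X j) f" by simp
    also have "T_op t j * X j = X (Suc j) * S j" using j by (intro T_X_same) simp
    also have "app (X (Suc j) * S j) f = app (X (Suc j)) (app (T_op t j) f - (cst (t - 1) * f))"
    proof -
      have "app (S j) f = app (T_op t j) f - cst (t - 1) * f"
        by (simp add: S_def cst_simps algebra_simps)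
      then show ?thesis by (simp only: app_simps)
    qed
    finally have "app (T_op t j) (app (X j) f) = app (X (Suc j)) (app (T_op t j) f - (cst (t - 1) * f))" .
    then show ?thesis
      using 1 j X_mspan[of "Suc j" "app (T_op t j) f - (cst (t - 1) * f)"] IH[OF f] f
      by (simp add: mspan_simps del: tower.simps)
  next
    case 2
    have "app (T_op t j) (app (X (Suc j)) f) = app (T_op t j * X (Suc j)) f" by simp
    also have "T_op t j * X (Suc j) = (Mul (cst t) - 1) * X (Suc j) + X j * T_op t j"
      using j by (intro T_X_Suc) simp
    also have "app ((Mul (cst t) - 1) * X (Suc j) + X j * T_op t j) f =
        cst (t - 1) * app (X (Suc j)) f + app (X j) (app (T_op t j) f)"
      by (simp add: cst_simps algebra_simps del: tower.simps)
    finally have "app (T_op t j) (app (X (Suc j)) f) = cst (t - 1) * app (X (Suc j)) f + app (X j) (app (T_op t j) f)" .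
    moreover have "app (X (Suc j)) f \<in> mspan X g (Suc d)" using X_mspan[OF j f] .
    moreover have "app (X j) (app (T_op t j) f) \<in> mspan X g (Suc d)" using j by (intro X_mspan IH f) simp
    ultimately show ?thesis using 2 by (simp add: mspan_simps del: tower.simps)
  next
    case 3
    have "app (T_op t j) (app (X i) f) = app (T_op t j * X i) f" by simp
    also have "T_op t j * X i = X i * T_op t j" using i j 3 by (intro T_X) auto
    finally show ?thesis using X_mspan[OF i IH[OF f]] by simp
  qed
qed

end

section \<open>The spans generated by the inverse variables and by the operators D_k\<close>

context quantum_params
begin

abbreviation "Zs \<equiv> \<lambda>k. Mul (zv k) :: 'n ratfun endo"

sublocale z: affine_hecke "T_op t :: nat \<Rightarrow> 'n ratfun endo" "Mul (cst t)" "Mul (cst (inverse t))" "CARD('n) - 1" "Mul (zv 0)"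
  by unfold_locales (auto intro: t_Z Z_T Z_braid)

lemma z_tower: "k < CARD('n) \<Longrightarrow> tower (Mul (zv 0)) k = Zs k"
proof (induction k)
  case (Suc k)
  have "Mul (cst (inverse t)) * (T_op t k * Mul (zv k) * T_op t k) = Zs (Suc k)"
    using Suc.prems t_ti by (subst T_z_T) (simp_all flip: mult.assoc)
  then show ?case using Suc by (simp add: mult.assoc)
qed simp

sublocale z: poly_action t "Mul (zv 0) :: 'n ratfun endo"
  by unfold_locales (simp add: z_tower lin_def Mul_commute)

sublocale D: poly_action t D0
  by unfold_locales (simp add: lin_def tower_cst del: tower.simps)

sublocale Z: commuting Zs
  by unfold_locales (auto simp: lin_def Mul_commute)

text \<open>Multiplication by \<open>z_pow M\<close> turns \<open>Y\<close> into \<open>q\<^sup>-\<^sup>M Y\<close>, which allows to move the roots of \<open>f\<close> away from the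
  eigenvalues of \<open>Y\<close>.\<close>

definition z_pow :: "nat \<Rightarrow> 'n ratfun" where
  "z_pow M = (\<Prod>i\<in>UNIV. inverse (var i)) ^ M"

lemma z_pow_nonzero: "z_pow M \<noteq> 0"
  by (simp add: z_pow_def var_nonzero)

lemma z_pow_sym: "symmetric (z_pow M)"
  unfolding symmetric_def
proof (intro allI impI)
  fix w :: "'n \<Rightarrow> 'n" assume w: "bij w"
  then have "perm w (z_pow M) = (\<Prod>i\<in>UNIV. inverse (var (w i))) ^ M"
    by (simp add: z_pow_def perm_hom perm_var)
  then show "perm w (z_pow M) = z_pow M"
    using prod.reindex_bij_betw[of w UNIV UNIV "\<lambda>i. inverse (var i)"] w by (simp add: z_pow_def)
qed

lemma scale_z_pow: "scale (qpow q i) (z_pow M) = cst (inverse (q ^ M)) * z_pow M"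
proof -
  have "scale (qpow q i) (\<Prod>i\<in>UNIV. inverse (var i)) = (\<Prod>j\<in>UNIV. inverse (cst (qpow q i j)) * inverse (var j))"
    using q0 by (simp add: scale_hom scale_var)
  also have "\<dots> = (\<Prod>j\<in>UNIV. inverse (cst (qpow q i j))) * (\<Prod>j\<in>UNIV. inverse (var j))"
    by (rule prod.distrib)
  also have "(\<Prod>j\<in>UNIV. inverse (cst (qpow q i j)) :: 'n ratfun) = (\<Prod>j\<in>UNIV. if j = i then inverse (cst q) else 1)"
    by (intro prod.cong refl) (simp add: cst_simps)
  finally have "scale (qpow q i) (\<Prod>i\<in>UNIV. inverse (var i)) = inverse (cst q) * (\<Prod>j\<in>UNIV. inverse (var j))"
    by simp
  then show ?thesis
    using q0 by (simp add: z_pow_def scale_hom power_mult_distrib cst_inverse cst_power power_inverse)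
qed

lemma T_Mul_z_pow: "T_op t k * Mul (z_pow M) = Mul (z_pow M) * T_op t k"
  by (rule T_commute_Mul) (simp add: symmetricD[OF z_pow_sym])

lemma P_Mul_z_pow: "P k * Mul (z_pow M) = Mul (z_pow M) * P k"
proof (induction k)
  case (Suc k)
  have "Mul (z_pow M) * S k = S k * Mul (z_pow M)"
    by (simp add: S_def algebra_simps T_Mul_z_pow Mul_commute)
  then show ?case using Suc by (simp add: commutes_mult)
qed simp

lemma Y_Mul_z_pow: "Y * Mul (z_pow M) = Mul (cst (inverse (q ^ M)) * z_pow M) * Y"
proof -
  have "pi_op q * Mul (z_pow M) = Mul (cst (inverse (q ^ M)) * z_pow M) * pi_op q"
    by (rule endo_eqI) (use q0 in \<open>simp add: pi_op_def field_hom.mult[OF field_hom_perm]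
        field_hom.mult[OF field_hom_scale] symmetricD[OF z_pow_sym] scale_z_pow\<close>)
  then show ?thesis
    unfolding Y_def by (simp add: mult.assoc P_Mul_z_pow) (simp flip: mult.assoc)
qed

text \<open>The eigenvalue 0 has to be excluded separately, since multiplication by powers of q does
  not move it. \<open>Y\<close> is a product of an automorphism and of factors \<open>S k\<close>,
  which are invertible up to t.\<close>

lemma Y_nonzero: "app Y f = 0 \<Longrightarrow> f = 0"
proof -
  have p: "f = 0" if "app (pi_op q) f = 0" for f :: "'n ratfun"
    using that q0 by (simp add: pi_op_def field_hom.eq_0_iff[OF field_hom_scale] field_hom.eq_0_iff[OF field_hom_perm])
  have S: "f = 0" if "k < CARD('n) - 1" "app (S k) f = 0" for f :: "'n ratfun" and k
  proof -
    have "app (T_op t k * S k) f = 0" using that by simp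
    then show ?thesis using S_T(2)[OF that(1)] t0 by (simp add: cst_eq_0_iff)
  qed
  have P: "f = 0" if "k \<le> CARD('n) - 1" "app (P k) f = 0" for f k
    using that
  proof (induction k)
    case (Suc k)
    then show ?case using S[of k "app (P k) f"] by simp
  qed simp
  assume "app Y f = 0"
  then have "app (pi_op q) (app (P (CARD('n) - 1)) f) = 0" unfolding Y_def app_simps(6) .
  then have "app (P (CARD('n) - 1)) f = 0" by (rule p)
  then show "f = 0" by (rule P[OF order_refl])
qed

lemma T_Z_mspan: "Suc j < CARD('n) \<Longrightarrow> symmetric g \<Longrightarrow> f \<in> mspan Zs g d \<Longrightarrow> app (T_op t j) f \<in> mspan Zs g d"
  using z.T_mspan[of j g f d] mspan_cong[of "tower (Mul (zv 0))" Zs g d] z_tower by simp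

lemma p_z_last: "pi_op q * Zs (CARD('n) - 1) = Mul (cst (inverse q)) * Zs 0 * pi_op q"
proof (rule endo_eqI)
  fix f :: "'n ratfun"
  have "perm cyc (zv (CARD('n) - 1)) = (zv 0 :: 'n ratfun)"
    by (simp add: zv_def perm_hom perm_var cyc_enum)
  moreover have "scale (qpow q (enum 0)) (zv 0) = cst (inverse q) * (zv 0 :: 'n ratfun)"
    using q0 by (simp add: zv_def scale_hom scale_var cst_inverse)
  ultimately show "app (pi_op q * Zs (CARD('n) - 1)) f = app (Mul (cst (inverse q)) * Zs 0 * pi_op q) f"
    using q0 by (simp add: pi_op_def field_hom.mult[OF field_hom_perm] field_hom.mult[OF field_hom_scale])
qed

text \<open>The rotation sends each inverse variable to the next in cyclic order, the return to the
  first costing only a factor q^-1, and it rescales \<open>z_pow M\<close>; so the degree is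
  kept.\<close>

lemma p_Z_mspan: "f \<in> mspan Zs (z_pow M) d \<Longrightarrow> app (pi_op q) f \<in> mspan Zs (z_pow M) d"
proof (rule Z.mspan_stable)
  show "lin (pi_op q :: 'n ratfun endo)" by (simp add: lin_def p_cst[OF q0])
  show "\<exists>c. app (pi_op q) (z_pow M) = cst c * z_pow M"
    using q0 scale_z_pow by (auto simp: pi_op_def symmetricD[OF z_pow_sym])
  fix i f d assume i: "i < CARD('n)" and f: "f \<in> mspan Zs (z_pow M) d"
    and IH: "\<And>h. h \<in> mspan Zs (z_pow M) d \<Longrightarrow> app (pi_op q) h \<in> mspan Zs (z_pow M) d"
  show "app (pi_op q) (app (Zs i) f) \<in> mspan Zs (z_pow M) (Suc d)"
  proof (cases "Suc i < CARD('n)")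
    case True
    have "app (pi_op q) (app (Zs i) f) = app (pi_op q * Zs i) f" by simp
    also have "\<dots> = app (Zs (Suc i)) (app (pi_op q) f)" unfolding p_z[OF q0 True] by simp
    finally show ?thesis using Z.X_mspan[OF True IH[OF f]] by (simp only:)
  next
    case False
    then have i': "i = CARD('n) - 1" using i by simp
    have "app (pi_op q) (app (Zs i) f) = app (pi_op q * Zs (CARD('n) - 1)) f" by (simp add: i')
    also have "\<dots> = cst (inverse q) * app (Zs 0) (app (pi_op q) f)" unfolding p_z_last by (simp add: mult.assoc)
    finally show ?thesis using Z.X_mspan[OF _ IH[OF f], of 0] by (simp only: mspan_simps zero_less_card_finite)
  qed
qed

lemma Y_Z_mspan: "f \<in> mspan Zs (z_pow M) d \<Longrightarrow> app Y f \<in> mspan Zs (z_pow M) d"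
proof -
  have "app (P k) f \<in> mspan Zs (z_pow M) d" if "k \<le> CARD('n) - 1" "f \<in> mspan Zs (z_pow M) d" for k f
    using that
  proof (induction k)
    case (Suc k)
    then have "app (T_op t k) (app (P k) f) - cst (t - 1) * app (P k) f \<in> mspan Zs (z_pow M) d"
      by (intro mspan_simps T_Z_mspan z_pow_sym) auto
    then show ?case by (simp add: S_def cst_simps algebra_simps)
  qed simp
  then show "f \<in> mspan Zs (z_pow M) d \<Longrightarrow> app Y f \<in> mspan Zs (z_pow M) d"
    unfolding Y_def by (simp add: p_Z_mspan)
qed

abbreviation "quad_Y \<equiv> \<Sum>a\<le>(2::nat). fcoeff q \<alpha> \<beta> a * Y ^ a"

lemma lin_Y: "lin Y"
  using Yop_cst by (simp add: lin_def)

lemma lin_FY: "lin quad_Y"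
  unfolding lin_def
  by (intro allI, rule sym, rule commutes_sum) (rule commutes_mult commutes_power Mul_commute Yop_cst[symmetric])+

lemma quad_Y_app: "app quad_Y f = cst \<beta> * f + cst \<alpha> * app Y f + cst (inverse q) * app Y (app Y f)"
proof -
  have "quad_Y = Mul (cst \<beta>) + Mul (cst \<alpha>) * Y + Mul (cst (inverse q)) * (Y * Y)"
    unfolding numeral_2_eq_2 by (simp add: mult.assoc)
  then show ?thesis by (simp only: app_simps)
qed

lemma quad_Y_Z_mspan: "f \<in> mspan Zs (z_pow M) d \<Longrightarrow> app quad_Y f \<in> mspan Zs (z_pow M) d"
  unfolding quad_Y_app by (intro mspan_simps Y_Z_mspan)

lemma quad_Y_factor:
  "\<exists>u v. \<forall>f. app quad_Y f = cst (inverse q) * (app Y (app Y f - cst v * f) - cst u * (app Y f - cst v * f))"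
proof -
  \<comment> \<open>u and v are the roots of y^2 + q \<alpha> y + q \<beta>, which is q f(y); d is a
    square root of its discriminant.\<close>
  define d where "d = csqrt ((q * \<alpha>)\<^sup>2 - 4 * q * \<beta>)"
  define u v where "u = (- (q * \<alpha>) + d) / 2" and "v = (- (q * \<alpha>) - d) / 2"
  have d: "d * d = (q * \<alpha>)\<^sup>2 - 4 * q * \<beta>" by (simp add: d_def flip: power2_eq_square)
  have "u * v = ((q * \<alpha>)\<^sup>2 - d * d) / 4" by (simp add: u_def v_def field_simps power2_eq_square)
  then have uv: "\<beta> = inverse q * (u * v)" "\<alpha> = - (inverse q * (u + v))"
    using q0 by (simp_all add: d, simp_all add: u_def v_def field_simps)
  have "app quad_Y f = cst (inverse q) * (app Y (app Y f - cst v * f) - cst u * (app Y f - cst v * f))" for f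
  proof -
    have "app Y (app Y f - cst v * f) = app Y (app Y f) - cst v * app Y f"
      by (simp only: app_diff lin_app[OF lin_Y])
    then have *: "app quad_Y f = cst \<beta> * f + cst \<alpha> * app Y f + cst (inverse q) * app Y (app Y f)"
      "app Y (app Y f - cst v * f) = app Y (app Y f) - cst v * app Y f"
      using quad_Y_app by blast+
    have ring: "e * (b * c) * g + - (e * (b + c)) * y + e * z = e * ((z - c * y) - b * (y - c * g))"
      for b c e g y z :: "'n ratfun"
      by (simp add: algebra_simps)
    show ?thesis
      unfolding * by (subst uv(1), subst uv(2), simp only: cst_simps, rule ring)
  qed
  then show ?thesis by blast
qed

lemma mspan_gM_divide:
  assumes "h \<in> mspan Zs (z_pow M) d"
  obtains k where "k \<in> mspan Zs 1 d" "h = z_pow M * k"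
proof -
  have "app (Mul (inverse (z_pow M))) h \<in> mspan Zs 1 d"
  proof -
    have *: "app (Mul (inverse (z_pow M))) s \<in> mspan Zs 1 d"
      if s: "s \<in> (\<lambda>m. app (monom Zs m) (z_pow M)) ` {m :: 'n \<Rightarrow>\<^sub>0 nat. tdeg m \<le> d}" for s
    proof -
      obtain m :: "'n \<Rightarrow>\<^sub>0 nat" where m: "tdeg m \<le> d" "s = app (monom Zs m) (z_pow M)" using s by blast
      then have "app (Mul (inverse (z_pow M))) s = app (monom Zs m) 1"
        using z_pow_nonzero[of M] by (simp add: monom_z)
      then show ?thesis
        unfolding mspan_def using m by (intro ratfun.span_base image_eqI[of _ _ m]) simp_all
    qed
    have lin: "lin (Mul (inverse (z_pow M)))" by (simp add: lin_def Mul_commute)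
    show ?thesis
      using assms * unfolding mspan_def by (rule lin_span[OF lin, rotated])
  qed
  moreover have "h = z_pow M * app (Mul (inverse (z_pow M))) h" using z_pow_nonzero[of M] by simp
  ultimately show thesis by (rule that)
qed

text \<open>Dividing an eigenvector by \<open>z_pow M\<close> leads into a space independent of M
  and multiplies the eigenvalue w by q^M. That space has finitely many eigenvalues, while q^M w
  takes infinitely many values for w \<noteq> 0, as q is not a root of unity. So some M serves for
  both roots of f at once; a root 0 is harmless by \<open>Y_nonzero\<close>.\<close>

lemma quad_Y_injective:
  assumes "\<forall>k::nat. k > 0 \<longrightarrow> q ^ k \<noteq> 1"
  obtains M where "\<And>h. h \<in> mspan Zs (z_pow M) d \<Longrightarrow> app quad_Y h = 0 \<Longrightarrow> h = 0"
proof -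
  obtain u v where uv: "\<And>f. app quad_Y f = cst (inverse q) * (app Y (app Y f - cst v * f) - cst u * (app Y f - cst v * f))"
    using quad_Y_factor by blast
  define U where "U = {u. \<exists>h\<in>mspan Zs 1 d. h \<noteq> 0 \<and> app Y h = cst u * h}"
  have finU: "finite U"
    unfolding U_def mspan_def by (intro finite_eigenvalues lin_Y finite_imageI finite_tdeg)
  have inj: "inj (\<lambda>M. q ^ M)"
  proof (rule injI)
    have "a = b" if "q ^ a = q ^ b" "a \<le> b" for a b
    proof (rule ccontr)
      assume "a \<noteq> b"
      then have "b - a > 0" using that by simp
      moreover have "q ^ b = q ^ (b - a) * q ^ a"
        unfolding power_add[symmetric] using that by simp
      ultimately show False using that assms q0 by auto
    qed
    then show "a = b" if "q ^ a = q ^ b" for a b using that by (metis nat_le_linear)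
  qed
  have "finite {M. q ^ M * w \<in> U}" if "w \<noteq> 0" for w
  proof -
    have "inj (\<lambda>M. q ^ M * w)" using inj that by (simp add: inj_def)
    then show ?thesis using finite_vimageI[OF finU] by (simp add: vimage_def)
  qed
  then have "finite ({M. u \<noteq> 0 \<and> q ^ M * u \<in> U} \<union> {M. v \<noteq> 0 \<and> q ^ M * v \<in> U})" by simp
  then obtain M where M: "M \<notin> {M. u \<noteq> 0 \<and> q ^ M * u \<in> U} \<union> {M. v \<noteq> 0 \<and> q ^ M * v \<in> U}"
    using ex_new_if_finite[OF infinite_UNIV_nat] by blast
  have eig: "h = 0" if h: "h \<in> mspan Zs (z_pow M) d" "app Y h = cst w * h" and w: "w = u \<or> w = v" for h w
  proof (cases "w = 0")
    case True
    then show ?thesis using h(2) Y_nonzero by (simp add: cst_simps)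
  next
    case False
    obtain k where k: "k \<in> mspan Zs 1 d" "h = z_pow M * k" using mspan_gM_divide[OF h(1)] .
    have "app Y h = app (Y * Mul (z_pow M)) k" by (simp add: k)
    also have "\<dots> = cst (inverse (q ^ M)) * z_pow M * app Y k" unfolding Y_Mul_z_pow by simp
    finally have "cst (inverse (q ^ M)) * z_pow M * app Y k = cst w * (z_pow M * k)"
      using h(2) k(2) by (simp only:)
    then have "cst (q ^ M) * (cst (inverse (q ^ M)) * z_pow M * app Y k) = cst (q ^ M) * (cst w * (z_pow M * k))"
      by (rule arg_cong)
    moreover have "cst (q ^ M) * cst (inverse (q ^ M)) = (1 :: 'n ratfun)"
      using q0 by (simp add: cst_simps(4) flip: cst_simps(2))
    ultimately have "z_pow M * app Y k = z_pow M * (cst (q ^ M * w) * k)"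
      by (simp add: cst_simps mult_ac)
    then have "app Y k = cst (q ^ M * w) * k" using z_pow_nonzero by simp
    then have "k = 0" using M w False k(1) unfolding U_def by auto
    then show ?thesis using k by simp
  qed
  have "h = 0" if h: "h \<in> mspan Zs (z_pow M) d" "app quad_Y h = 0" for h
  proof -
    have "app Y (app Y h - cst v * h) = cst u * (app Y h - cst v * h)"
      using h(2) q0 uv by (simp add: cst_eq_0_iff)
    moreover have "app Y h - cst v * h \<in> mspan Zs (z_pow M) d"
      by (intro mspan_simps Y_Z_mspan h)
    ultimately have "app Y h - cst v * h = 0" using eig by blast
    then show "h = 0" using eig[OF h(1), of v] by simp
  qed
  then show thesis by (rule that)
qed

lemma Z_independent:
  fixes c :: "('n \<Rightarrow>\<^sub>0 nat) \<Rightarrow> complex"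
  assumes "finite A" "(\<Sum>m\<in>A. cst (c m) * app (monom Zs m) (z_pow M)) = 0" "m \<in> A"
  shows "c m = 0"
proof -
  have "(\<Sum>m\<in>A. cst (c m) * inverse (x_mono m)) * z_pow M = 0"
    using assms(2) by (simp add: monom_z sum_distrib_right mult.assoc)
  then show ?thesis using inverse_xmono_independent[OF assms(1) _ assms(3)] z_pow_nonzero by simp
qed

lemma Z_inj: "inj_on (\<lambda>m :: 'n \<Rightarrow>\<^sub>0 nat. app (monom Zs m) (z_pow M)) A"
proof (rule inj_onI, rule ccontr)
  fix m m' :: "'n \<Rightarrow>\<^sub>0 nat"
  assume e: "app (monom Zs m) (z_pow M) = app (monom Zs m') (z_pow M)" and "m \<noteq> m'"
  then have "(\<Sum>k\<in>{m, m'}. cst (if k = m then 1 else -1) * app (monom Zs k) (z_pow M)) = 0"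
    by (simp add: cst_simps)
  then have "(if m = m then 1 else -1 :: complex) = 0"
    by (rule Z_independent[rotated]) simp_all
  then show False by simp
qed

lemma Z_basis:
  "ratfun.independent ((\<lambda>m. app (monom Zs m) (z_pow M)) ` {m :: 'n \<Rightarrow>\<^sub>0 nat. tdeg m \<le> d})"
proof (rule ratfun.independent_if_scalars_zero)
  fix c x assume *: "(\<Sum>x\<in>(\<lambda>m. app (monom Zs m) (z_pow M)) ` {m :: 'n \<Rightarrow>\<^sub>0 nat. tdeg m \<le> d}. cst (c x) * x) = 0"
    "x \<in> (\<lambda>m. app (monom Zs m) (z_pow M)) ` {m :: 'n \<Rightarrow>\<^sub>0 nat. tdeg m \<le> d}"
  then obtain m :: "'n \<Rightarrow>\<^sub>0 nat" where m: "tdeg m \<le> d" "x = app (monom Zs m) (z_pow M)" by blast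
  have "(\<Sum>m\<in>{m :: 'n \<Rightarrow>\<^sub>0 nat. tdeg m \<le> d}. cst (c (app (monom Zs m) (z_pow M))) * app (monom Zs m) (z_pow M)) = 0"
    using *(1) by (simp add: sum.reindex[OF Z_inj])
  then show "c x = 0"
    using Z_independent[OF finite_tdeg, of "\<lambda>m. c (app (monom Zs m) (z_pow M))" M d m] m by simp
qed (intro finite_imageI finite_tdeg)

text \<open>Since \<open>f(Y)\<close> is onto, \<open>z\<^sub>0 h\<close> has the form \<open>z\<^sub>0 f(Y) h' = D\<^sub>0 h'\<close>; the other \<open>z\<^sub>j\<close> follow by conjugation
  with the Hecke generators.\<close>

lemma Z_subset_D:
  assumes inj: "\<And>h. h \<in> mspan Zs (z_pow M) d \<Longrightarrow> app quad_Y h = 0 \<Longrightarrow> h = 0"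
  shows "e \<le> d \<Longrightarrow> mspan Zs (z_pow M) e \<subseteq> mspan (tower D0) (z_pow M) e"
proof (induction e)
  case 0
  show ?case using mspan_zero_cases mspan_simps(4) mspan_base by blast
next
  case (Suc e)
  note IH = Suc.IH[OF Suc_leD[OF Suc.prems]]
  have step: "app (Zs j) f \<in> mspan (tower D0) (z_pow M) (Suc e)" if "j < CARD('n)" "f \<in> mspan Zs (z_pow M) e" for j f
    using that
  proof (induction j arbitrary: f)
    case 0
    have "\<exists>h\<in>mspan Zs (z_pow M) e. f = app quad_Y h"
      unfolding mspan_def
    proof (rule injective_imp_surjective)
      show "f \<in> rspan ((\<lambda>m. app (monom Zs m) (z_pow M)) ` {m :: 'n \<Rightarrow>\<^sub>0 nat. tdeg m \<le> e})"
        using 0 by (simp add: mspan_def)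
      show "h = 0" if "h \<in> rspan ((\<lambda>m. app (monom Zs m) (z_pow M)) ` {m :: 'n \<Rightarrow>\<^sub>0 nat. tdeg m \<le> e})"
        "app quad_Y h = 0" for h
        using inj that mspan_mono[OF Suc_leD[OF Suc.prems], of Zs "z_pow M"] unfolding mspan_def by blast
      show "app quad_Y h \<in> rspan ((\<lambda>m. app (monom Zs m) (z_pow M)) ` {m :: 'n \<Rightarrow>\<^sub>0 nat. tdeg m \<le> e})"
        if "h \<in> rspan ((\<lambda>m. app (monom Zs m) (z_pow M)) ` {m :: 'n \<Rightarrow>\<^sub>0 nat. tdeg m \<le> e})" for h
        using quad_Y_Z_mspan[of h M e] that unfolding mspan_def .
    qed (intro lin_FY finite_imageI finite_tdeg Z_basis)+
    then obtain h where h: "h \<in> mspan Zs (z_pow M) e" "f = app quad_Y h" by blast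
    then have "app (Zs 0) f = app (tower D0 0) h" unfolding tower.simps D0_def app_simps(6) by simp
    then show ?case using D.X_mspan[OF 0(1), of h "z_pow M" e] IH h by auto
  next
    case (Suc j)
    have "Zs (Suc j) = Mul (cst (inverse t)) * (T_op t j * Zs j * T_op t j)"
      using Suc.prems t_ti by (subst T_z_T) (simp_all flip: mult.assoc)
    then have e: "app (Zs (Suc j)) f = cst (inverse t) * app (T_op t j) (app (Zs j) (app (T_op t j) f))"
      by (simp only: app_simps(6,7))
    have "app (Zs j) (app (T_op t j) f) \<in> mspan (tower D0) (z_pow M) (Suc e)"
      using Suc by (intro Suc.IH T_Z_mspan z_pow_sym) auto
    then show ?case
      unfolding e by (intro mspan_simps D.T_mspan z_pow_sym Suc.prems)
  qed
  have "app (monom Zs m) (z_pow M) \<in> mspan (tower D0) (z_pow M) (Suc e)" if "tdeg m \<le> Suc e" for m :: "'n \<Rightarrow>\<^sub>0 nat"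
  proof (cases m rule: exponent_cases)
    case 1
    then show ?thesis by (simp add: mspan_base)
  next
    case (2 m' j)
    have "app (monom Zs m) (z_pow M) = app (Zs j) (app (monom Zs m') (z_pow M))"
      by (simp only: Z.monom_X_step[OF 2(1)] 2(2) app_simps(6))
    moreover have "app (monom Zs m') (z_pow M) \<in> mspan Zs (z_pow M) e"
      unfolding mspan_def using that 2 by (intro ratfun.span_base image_eqI) (auto simp: tdeg_add)
    ultimately show ?thesis using step[OF 2(1)] by (simp only:)
  qed
  then have "(\<lambda>m. app (monom Zs m) (z_pow M)) ` {m :: 'n \<Rightarrow>\<^sub>0 nat. tdeg m \<le> Suc e} \<subseteq> mspan (tower D0) (z_pow M) (Suc e)"
    by blast
  then show ?case
    unfolding mspan_def[of Zs] by (rule ratfun.span_minimal) (simp add: mspan_def)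
qed

lemma D_independent:
  fixes c :: "('n \<Rightarrow>\<^sub>0 nat) \<Rightarrow> complex"
  assumes inj: "\<And>h. h \<in> mspan Zs (z_pow M) d \<Longrightarrow> app quad_Y h = 0 \<Longrightarrow> h = 0"
    and sum: "(\<Sum>m\<in>{m. tdeg m \<le> d}. cst (c m) * app (monom (tower D0) m) (z_pow M)) = 0"
    and k: "tdeg k \<le> d"
  shows "c k = 0"
proof (rule ccontr)
  assume ck: "c k \<noteq> 0"
  let ?S = "{m :: 'n \<Rightarrow>\<^sub>0 nat. tdeg m \<le> d}" and ?D = "\<lambda>m. app (monom (tower D0) m) (z_pow M)"
  let ?Z = "\<lambda>m. app (monom Zs m) (z_pow M)"
  note fin = finite_tdeg[of d, where 'n = 'n]
  have "cst (c k) * ?D k + (\<Sum>m\<in>?S - {k}. cst (c m) * ?D m) = 0"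
    using sum k fin by (simp add: sum.remove[of ?S k])
  then have "cst (c k) * ?D k = - (\<Sum>m\<in>?S - {k}. cst (c m) * ?D m)"
    by (rule eq_neg_iff_add_eq_0[THEN iffD2])
  then have "cst (inverse (c k)) * (cst (c k) * ?D k) = cst (inverse (c k)) * - (\<Sum>m\<in>?S - {k}. cst (c m) * ?D m)"
    by simp
  moreover have "cst (inverse (c k)) * cst (c k) = (1 :: 'n ratfun)"
    using ck by (simp add: cst_simps(4) flip: cst_simps(2))
  ultimately have Dk: "?D k = cst (inverse (c k)) * - (\<Sum>m\<in>?S - {k}. cst (c m) * ?D m)"
    by (simp flip: mult.assoc)
  have "?D k \<in> rspan (?D ` (?S - {k}))"
    unfolding Dk by (intro ratfun.span_scale ratfun.span_neg ratfun.span_sum ratfun.span_base imageI)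
  then have "?D m \<in> rspan (?D ` (?S - {k}))" if "m \<in> ?S" for m
    using that by (cases "m = k") (auto intro: ratfun.span_base)
  then have "?D ` ?S \<subseteq> rspan (?D ` (?S - {k}))" by blast
  then have "rspan (?D ` ?S) \<subseteq> rspan (?D ` (?S - {k}))"
    by (rule ratfun.span_minimal) simp
  moreover have "?Z ` ?S \<subseteq> rspan (?D ` ?S)"
    by (rule subset_trans[OF ratfun.span_superset Z_subset_D[OF inj order_refl, unfolded mspan_def]])
  ultimately have "?Z ` ?S \<subseteq> rspan (?D ` (?S - {k}))" by blast
  then have "card (?Z ` ?S) \<le> card (?D ` (?S - {k}))"
    by (rule ratfun.independent_span_bound[OF finite_imageI[OF finite_Diff[OF fin]] Z_basis, THEN conjunct2])
  \<comment> \<open>Only an upper bound, since the functions \<open>?D m\<close> are not yet known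
    to be distinct.\<close>
  also have "\<dots> \<le> card (?S - {k})" using fin by (intro card_image_le) simp
  also have "\<dots> < card ?S" using fin k by (intro psubset_card_mono) auto
  finally show False by (simp add: card_image[OF Z_inj])
qed

end

section \<open>Evaluation of polynomials at commuting operators\<close>

context commuting
begin

definition ev :: "'n mpol \<Rightarrow> 'n ratfun endo" where
  "ev P = (\<Sum>m\<in>keys P. Mul (cst (lookup P m)) * monom X m)"

lemma ev_superset:
  assumes "finite A" "keys P \<subseteq> A"
  shows "ev P = (\<Sum>m\<in>A. Mul (cst (lookup P m)) * monom X m)"
  unfolding ev_def using assms
  by (intro sum.mono_neutral_left) (auto simp: in_keys_iff cst_simps Mul_simps)

lemma ev_add: "ev (P + Q) = ev P + ev Q"
proof -
  let ?A = "keys P \<union> keys Q"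
  have "ev (P + Q) = (\<Sum>m\<in>?A. Mul (cst (lookup (P + Q) m)) * monom X m)"
    using keys_add[of P Q] by (intro ev_superset) auto
  also have "\<dots> = ev P + ev Q"
    by (simp add: ev_superset[of ?A] lookup_add cst_simps Mul_simps distrib_right sum.distrib)
  finally show ?thesis .
qed

lemma ev_single: "ev (single m c) = Mul (cst c) * monom X m"
  using ev_superset[of "{m}" "single m c"] by simp

lemma lin_monom: "monom X m * Mul (cst c) = Mul (cst c) * monom X (m :: 'n \<Rightarrow>\<^sub>0 nat)"
proof (induction m rule: exponent_induct)
  case (step m j)
  have "Mul (cst c) * X j = X j * Mul (cst c)" using X_lin[OF step(1)] by (simp add: lin_def)
  then show ?case
    unfolding monom_X_step[OF step(1)] using step by (intro commutes_mult[symmetric]) simp_all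
qed simp

lemma ev_mult: "ev (P * Q) = ev P * ev Q"
proof (rule mult_hom_if_single)
  fix m m' :: "'n \<Rightarrow>\<^sub>0 nat" and c c'
  have "monom X m * (Mul (cst c') * monom X m') = Mul (cst c') * (monom X m * monom X m')"
    by (simp add: lin_monom flip: mult.assoc)
  then show "ev (single m c * single m' c') =
      ev (single m c) * ev (single m' c')"
    by (simp add: mult_single ev_single monom_add[OF X_X] cst_simps Mul_simps mult.assoc)
qed (rule ev_add)

lemma ev_zero: "ev 0 = 0"
  by (simp add: ev_def)

lemma ev_one: "ev 1 = 1"
  using ev_single[of 0 1] by (simp add: single_one cst_simps Mul_simps)

lemma ev_sum: "ev (sum g A) = (\<Sum>a\<in>A. ev (g a))"
  by (induction A rule: infinite_finite_induct) (simp_all add: ev_zero ev_add)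

lemma ev_monom: "ev (monom R m) = monom (\<lambda>k. ev (R k)) (m :: 'n \<Rightarrow>\<^sub>0 nat)"
proof -
  have pow: "ev (P ^ k) = ev P ^ k" for P k by (induction k) (simp_all add: ev_one ev_mult)
  have "ev (prod_list (map (\<lambda>k. R k ^ a k) ks)) = prod_list (map (\<lambda>k. ev (R k) ^ a k) ks)" for a ks
    by (induction ks) (simp_all add: ev_one ev_mult pow)
  then show ?thesis by (simp add: monom_def)
qed

end

text \<open>A formal variable to be replaced by a commuting operator. It lives in the same
  polynomial type as the x_i but plays no part in the action on functions; \<open>esym\<close> and
  \<open>monom\<close> apply to it as to operators.\<close>

definition y_var :: "nat \<Rightarrow> 'n::{finite,linorder} mpol" where
  "y_var j = single (single (enum j) 1) 1"

lemma (in commuting) ev_esym: "k \<le> CARD('n) \<Longrightarrow> ev (esym y_var k r) = esym X k r"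
proof (induction k arbitrary: r)
  case 0
  then show ?case by (cases r) (simp_all add: ev_one ev_zero)
next
  case (Suc k)
  have "ev (y_var k) = X k"
    using monom_single[of k X, where 'n = 'n] Suc.prems by (simp add: y_var_def ev_single cst_simps Mul_simps)
  then show ?case using Suc by (cases r) (simp_all add: ev_one ev_add ev_mult)
qed

section \<open>Leading monomials of the elementary symmetric polynomials\<close>

text \<open>The order on exponents is lexicographic, with the smallest variable being the most significant.\<close>

definition lead :: "'n::linorder mpol \<Rightarrow> ('n \<Rightarrow>\<^sub>0 nat) \<Rightarrow> bool" where
  "lead P a \<longleftrightarrow> lookup P a \<noteq> 0 \<and> (\<forall>m\<in>keys P. m \<le> a)"

lemma lead_one: "lead 1 0"
  by (simp add: lead_def)

lemma lead_yv: "lead (y_var k) (single (enum k) 1)"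
  by (simp add: lead_def y_var_def)

lemma lead_add: "lead P a \<Longrightarrow> lead Q b \<Longrightarrow> b < a \<Longrightarrow> lead (P + Q) a"
  unfolding lead_def
proof (intro conjI ballI)
  assume *: "lookup P a \<noteq> 0 \<and> (\<forall>m\<in>keys P. m \<le> a)"
    "lookup Q b \<noteq> 0 \<and> (\<forall>m\<in>keys Q. m \<le> b)" "b < a"
  then have "a \<notin> keys Q" by force
  then show "lookup (P + Q) a \<noteq> 0" using * by (simp add: lookup_add in_keys_iff)
  fix m assume "m \<in> keys (P + Q)"
  then have "m \<in> keys P \<or> m \<in> keys Q" using keys_add[of P Q] by blast
  then show "m \<le> a" using * by force
qed

lemma lead_mult:
  fixes P Q :: "'n::linorder mpol"
  assumes P: "lead P a" and Q: "lead Q b"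
  shows "lead (P * Q) (a + b)"
  unfolding lead_def
proof (intro conjI ballI)
  fix m assume "m \<in> keys (P * Q)"
  then obtain k l where "m = k + l" "k \<in> keys P" "l \<in> keys Q"
    using keys_mult[of P Q] by blast
  then show "m \<le> a + b" using P Q by (auto simp: lead_def intro: add_mono)
next
  let ?t = "\<lambda>k l. single (k + l) (lookup P k * lookup Q l)"
  have "P * Q = (\<Sum>k\<in>keys P. \<Sum>l\<in>keys Q. ?t k l)"
    by (subst mpol_sum_single[of P], subst mpol_sum_single[of Q]) (simp add: sum_product mult_single)
  then have "lookup (P * Q) (a + b) =
      (\<Sum>k\<in>keys P. \<Sum>l\<in>keys Q. lookup (?t k l) (a + b))"
    by (simp add: lookup_sum)
  also have "\<dots> = (\<Sum>k\<in>keys P. \<Sum>l\<in>keys Q.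
      if k = a \<and> l = b then lookup P a * lookup Q b else 0)"
  proof (intro sum.cong refl)
    fix k l assume kl: "k \<in> keys P" "l \<in> keys Q"
    then have le: "k \<le> a" "l \<le> b" using P Q by (auto simp: lead_def)
    have "k + l = a + b \<longleftrightarrow> k = a \<and> l = b"
    proof
      assume e: "k + l = a + b"
      have "k = a"
      proof (rule ccontr)
        assume "k \<noteq> a"
        then have "k + l < a + b" using le by (intro add_less_le_mono) auto
        then show False using e by simp
      qed
      then show "k = a \<and> l = b" using e by simp
    qed simp
    then show "lookup (?t k l) (a + b) =
        (if k = a \<and> l = b then lookup P a * lookup Q b else 0)"
      by (auto simp: lookup_single when_def)
  qed
  also have "\<dots> = (\<Sum>k\<in>keys P.
      if k = a then lookup P a * lookup Q b else 0)"
  proof (intro sum.cong refl)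
    fix k
    show "(\<Sum>l\<in>keys Q. if k = a \<and> l = b then lookup P a * lookup Q b else 0) =
        (if k = a then lookup P a * lookup Q b else 0)"
      using Q by (cases "k = a") (simp_all add: lead_def in_keys_iff)
  qed
  also have "\<dots> = lookup P a * lookup Q b"
    using P Q by (simp add: lead_def in_keys_iff)
  finally show "lookup (P * Q) (a + b) \<noteq> 0" using P Q by (simp add: lead_def)
qed

lemma lead_power: "lead P a \<Longrightarrow> lead (P ^ k) (\<Sum>_<k. a)"
proof (induction k)
  case (Suc k)
  then show ?case using lead_mult[of P a "P ^ k" "\<Sum>_<k. a"] by (simp add: add.commute)
qed (simp add: lead_one)

text \<open>The exponent of the product of the first r variables, the leading monomial of the r-th
  elementary symmetric polynomial.\<close>

definition omega :: "nat \<Rightarrow> 'n::{finite,linorder} \<Rightarrow>\<^sub>0 nat" where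
  "omega r = (\<Sum>j<r. single (enum j) 1)"

lemma lookup_omega:
  assumes "r \<le> CARD('n)" "j < CARD('n)"
  shows "lookup (omega r) (enum j :: 'n::{finite,linorder}) = (if j < r then 1 else 0)"
proof -
  have "lookup (omega r) (enum j :: 'n) = (\<Sum>i<r. if i = j then 1 else 0)"
    unfolding omega_def lookup_sum
    by (intro sum.cong refl) (use assms in \<open>auto simp: lookup_single when_def enum_eq_iff\<close>)
  then show ?thesis by simp
qed

lemma single_enum_less:
  assumes "r < k" "k < CARD('n)"
  shows "single (enum k :: 'n::{finite,linorder}) (1::nat) < single (enum r) 1"
proof -
  have "less_fun (lookup (single (enum k :: 'n) (1::nat)))
    (lookup (single (enum r) 1))"
    unfolding less_fun_def
  proof (intro exI[of _ "enum r"] conjI allI impI)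
    have "enum r < (enum k :: 'n)" using assms by (simp add: enum_less_iff)
    then show "lookup (single (enum k :: 'n) (1::nat)) (enum r) <
        lookup (single (enum r) 1) (enum r)"
      by (simp add: lookup_single)
    fix i :: 'n assume "i < enum r"
    with \<open>enum r < (enum k :: 'n)\<close>
    show "lookup (single (enum k :: 'n) (1::nat)) i =
        lookup (single (enum r) 1) i"
      by (auto simp: lookup_single when_def)
  qed
  then show ?thesis by (simp add: less_poly_mapping.rep_eq)
qed

lemma esym_zero: "k < r \<Longrightarrow> esym X k r = 0"
proof (induction k arbitrary: r)
  case 0
  then show ?case by (cases r) simp_all
next
  case (Suc k)
  then show ?case by (cases r) simp_all
qed

text \<open>Of the two summands in the recursion the one without y_k has the larger leading
  monomial, except for r = k + 1, where it vanishes.\<close>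

lemma lead_esym:
  "r \<le> k \<Longrightarrow> k \<le> CARD('n) \<Longrightarrow> lead (esym y_var k r :: 'n::{finite,linorder} mpol) (omega r)"
proof (induction k arbitrary: r)
  case 0
  then show ?case by (simp add: lead_one omega_def)
next
  case (Suc k)
  show ?case
  proof (cases r)
    case 0
    then show ?thesis by (simp add: lead_one omega_def)
  next
    case (Suc s)
    have y: "lead (y_var k * esym y_var k s :: 'n mpol) (single (enum k) 1 + omega s)"
      using Suc.prems Suc.IH[of s] Suc by (intro lead_mult lead_yv) simp
    have om: "omega (Suc s) = single (enum s) 1 + (omega s :: 'n \<Rightarrow>\<^sub>0 nat)"
      by (simp add: omega_def add.commute)
    show ?thesis
    proof (cases "s = k")
      case True
      then show ?thesis using y om esym_zero[of k "Suc s" "y_var :: nat \<Rightarrow> 'n mpol"] Suc by simp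
    next
      case False
      then have "s < k" using Suc Suc.prems by simp
      then have "single (enum k :: 'n) 1 + omega s < omega (Suc s)"
        unfolding om using Suc.prems by (intro add_strict_right_mono single_enum_less) auto
      then show ?thesis
        using y Suc.IH[of "Suc s"] \<open>s < k\<close> Suc.prems Suc by (auto intro: lead_add)
    qed
  qed
qed

text \<open>The leading exponent of the product of the elementary symmetric polynomials with
  exponents m; the entry at \<open>enum k\<close> belongs to the polynomial of degree k + 1.\<close>

definition weight :: "('n::{finite,linorder} \<Rightarrow>\<^sub>0 nat) \<Rightarrow> 'n \<Rightarrow>\<^sub>0 nat" where
  "weight m = sum_list (map (\<lambda>k. \<Sum>_<lookup m (enum k). omega (Suc k)) [0..<CARD('n)])"

lemma lead_monom:
  fixes R :: "nat \<Rightarrow> 'n::{finite,linorder} mpol"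
  assumes "\<And>k. k < CARD('n) \<Longrightarrow> lead (R k) (omega (Suc k))"
  shows "lead (monom R m) (weight m)"
proof -
  have "lead (prod_list (map (\<lambda>k. R k ^ a k) ks)) (sum_list (map (\<lambda>k. \<Sum>_<a k. omega (Suc k)) ks))"
    if "set ks \<subseteq> {..<CARD('n)}" for a ks
    using that by (induction ks) (auto intro!: lead_mult lead_power assms simp: lead_one)
  from this[of "[0..<CARD('n)]" "\<lambda>k. lookup m (enum k)"]
  show ?thesis unfolding monom_def weight_def by (simp add: atLeast0LessThan)
qed

text \<open>The entry of \<open>weight m\<close> at index j is the sum of the entries of m from j
  on, so consecutive differences recover m.\<close>

lemma weight_inj: "inj (weight :: ('n::{finite,linorder} \<Rightarrow>\<^sub>0 nat) \<Rightarrow> _)"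
proof (rule injI)
  fix m m' :: "'n \<Rightarrow>\<^sub>0 nat" assume e: "weight m = weight m'"
  have w: "lookup (weight m) (enum j :: 'n) = (\<Sum>k\<in>{j..<CARD('n)}. lookup m (enum k))"
    if j: "j < CARD('n)" for m :: "'n \<Rightarrow>\<^sub>0 nat" and j
  proof -
    have "lookup (sum_list (map f ks)) i = sum_list (map (\<lambda>k. lookup (f k) i) ks)"
      for f :: "nat \<Rightarrow> 'n \<Rightarrow>\<^sub>0 nat" and ks i
      by (induction ks) (simp_all add: lookup_add)
    then have "lookup (weight m) (enum j :: 'n) =
        (\<Sum>k\<leftarrow>[0..<CARD('n)]. lookup (\<Sum>_<lookup m (enum k). omega (Suc k)) (enum j :: 'n))"
      by (simp add: weight_def)
    also have "\<dots> = (\<Sum>k\<in>{0..<CARD('n)}. lookup (\<Sum>_<lookup m (enum k). omega (Suc k)) (enum j :: 'n))"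
      by (simp add: interv_sum_list_conv_sum_set_nat)
    also have "\<dots> = (\<Sum>k\<in>{0..<CARD('n)}. if j \<le> k then lookup m (enum k) else 0)"
      using j by (intro sum.cong refl) (auto simp: lookup_sum lookup_omega)
    also have "\<dots> = (\<Sum>k\<in>{j..<CARD('n)}. lookup m (enum k))"
      by (intro sum.mono_neutral_cong_right) auto
    finally show ?thesis .
  qed
  show "m = m'"
  proof (rule poly_mapping_eqI)
    fix i :: 'n
    obtain j where j: "j < CARD('n)" "i = enum j" by (rule enum_cases)
    have s: "(\<Sum>k\<in>{l..<CARD('n)}. lookup m (enum k)) = (\<Sum>k\<in>{l..<CARD('n)}. lookup m' (enum k))" for l
    proof (cases "l < CARD('n)")
      case True
      then show ?thesis using w[of l m] w[of l m'] e by simp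
    qed simp
    show "lookup m i = lookup m' i"
      using s[of j] s[of "Suc j"] j by (simp add: sum.atLeast_Suc_lessThan)
  qed
qed

text \<open>Distinct monomials in the elementary symmetric polynomials have distinct leading
  exponents, so the largest of these occurs in one term only and cannot cancel.\<close>

lemma esym_algebraically_independent:
  fixes p :: "'n::{finite,linorder} mpol"
  assumes "(\<Sum>m\<in>keys p. single 0 (lookup p m) *
    monom (\<lambda>k. esym y_var (CARD('n)) (Suc k)) m) = (0 :: 'n mpol)"
  shows "p = 0"
proof (rule ccontr)
  assume "p \<noteq> 0"
  let ?M = "monom (\<lambda>k. esym y_var (CARD('n)) (Suc k)) :: ('n \<Rightarrow>\<^sub>0 nat) \<Rightarrow> 'n mpol"
  have L: "lead (?M m) (weight m)" for m
    by (intro lead_monom lead_esym) auto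
  have K: "finite (weight ` keys p)" "weight ` keys p \<noteq> {}"
    using \<open>p \<noteq> 0\<close> by simp_all
  obtain a where a: "a \<in> keys p" "weight a = Max (weight ` keys p)"
    using Max_in[OF K] by auto
  have z: "lookup (?M m) (weight a) = 0" if "m \<in> keys p" "m \<noteq> a" for m
  proof -
    have "weight m \<le> weight a" using a K that by simp
    moreover have "weight m \<noteq> weight a" using injD[OF weight_inj, of m a] that by blast
    ultimately have "weight a \<notin> keys (?M m)" using L[of m] by (force simp: lead_def)
    then show ?thesis by (simp add: in_keys_iff)
  qed
  have c: "lookup (single 0 c * q) m = c * lookup q m"
    for c m and q :: "'n mpol"
    by (simp add: map.rep_eq when_def flip: mult_map_scale_conv_mult)
  have "0 = (\<Sum>m\<in>keys p. lookup p m * lookup (?M m) (weight a))"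
    using arg_cong[OF assms, of "\<lambda>q. lookup q (weight a)"] by (simp add: lookup_sum c)
  also have "\<dots> = (\<Sum>m\<in>keys p. if m = a then lookup p a * lookup (?M a) (weight a) else 0)"
    by (intro sum.cong refl) (simp add: z)
  also have "\<dots> = lookup p a * lookup (?M a) (weight a)"
    using a by simp
  finally show False using a L[of a] by (simp add: lead_def in_keys_iff)
qed

section \<open>Algebraic independence of the Hamiltonians\<close>

context quantum_params
begin

abbreviation "Es \<equiv> \<lambda>k. esym (tower D0) (CARD('n)) (Suc k)"

lemma central_one: "1 \<in> central"
  using central_cst[of 1] by (simp add: cst_simps Mul_simps)

lemma central_power: "L \<in> central \<Longrightarrow> L ^ k \<in> central"
  by (induction k) (simp_all add: central_one central_mult)

text \<open>The operators agree only on symmetric functions, so they are exchanged one factor at a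
  time; \<open>central_sym\<close> keeps every intermediate result symmetric.\<close>

lemma op_monomial_eq:
  fixes H :: "'n \<Rightarrow> 'n ratop"
  assumes H: "\<And>k g. k < CARD('n) \<Longrightarrow> symmetric g \<Longrightarrow> H (enum k) g = app (Es k) g" and g: "symmetric g"
  shows "op_monomial H m g = app (monom Es m) g"
proof -
  have pow: "symmetric h \<Longrightarrow> (H (enum k) ^^ a) h = app (Es k ^ a) h" if "k < CARD('n)" for k a h
  proof (induction a)
    case (Suc a)
    then show ?case
      using H[OF that central_sym[OF central_power[OF esym_central] Suc.prems]] by simp
  qed simp
  have "foldr (\<lambda>i D. (H i ^^ lookup m i) \<circ> D) (map enum ks) id g =
      app (prod_list (map (\<lambda>k. Es k ^ lookup m (enum k)) ks)) g"
    if "set ks \<subseteq> {..<CARD('n)}" for ks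
    using that
  proof (induction ks)
    case (Cons k ks)
    have "prod_list (map (\<lambda>k. Es k ^ lookup m (enum k)) ks) \<in> central"
      by (induction ks) (simp_all add: central_one central_mult central_power esym_central)
    then have "symmetric (app (prod_list (map (\<lambda>k. Es k ^ lookup m (enum k)) ks)) g)"
      using g by (rule central_sym)
    from pow[OF _ this, of k] show ?case using Cons by simp
  qed simp
  moreover have "sorted_list_of_set (UNIV :: 'n set) = map enum [0..<CARD('n)]"
    by (rule nth_equalityI) (simp_all add: enum_def)
  ultimately show ?thesis by (simp add: op_monomial_def monom_def atLeast0LessThan)
qed

text \<open>One test function is enough: on a suitable \<open>z_pow M\<close>, which is symmetric,
  the monomials in the D_i up to the degree of \<open>R\<close> are independent.\<close>

lemma D_ev_injective:
  assumes q: "\<forall>k::nat. k > 0 \<longrightarrow> q ^ k \<noteq> 1"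
    and "\<And>g. symmetric g \<Longrightarrow> app (D.ev R) g = 0"
  shows "R = 0"
proof -
  \<comment> \<open>The sum of the degrees is a bound that needs no separate treatment of R =
    0.\<close>
  define d where "d = (\<Sum>m\<in>keys R. tdeg m)"
  have d: "tdeg m \<le> d" if "m \<in> keys R" for m
    unfolding d_def using that by (intro member_le_sum) auto
  obtain M where M: "\<And>h. h \<in> mspan Zs (z_pow M) d \<Longrightarrow> app quad_Y h = 0 \<Longrightarrow> h = 0"
    using quad_Y_injective[OF q] by blast
  have "0 = app (D.ev R) (z_pow M)" using assms(2)[OF z_pow_sym] by simp
  also have "D.ev R = (\<Sum>m\<in>{m. tdeg m \<le> d}. Mul (cst (lookup R m)) * monom (tower D0) m)"
    using d by (intro D.ev_superset finite_tdeg) auto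
  finally have z: "(\<Sum>m\<in>{m. tdeg m \<le> d}. cst (lookup R m) * app (monom (tower D0) m) (z_pow M)) = 0"
    by (simp add: sum_app)
  have "lookup R m = 0" if "tdeg m \<le> d" for m
  proof (rule D_independent[of M d])
    show "h = 0" if "h \<in> mspan Zs (z_pow M) d" "app quad_Y h = 0" for h using that by (rule M)
  qed (fact z, fact that)
  then have "lookup R m = 0" for m
    using d[of m] by (auto simp: in_keys_iff)
  then show ?thesis by (intro poly_mapping_eqI) simp
qed

lemma completely_integrable_H21:
  assumes q: "\<forall>k::nat. k > 0 \<longrightarrow> q ^ k \<noteq> 1"
  shows "completely_integrable q (H21 q t \<alpha> \<beta> :: 'n ratop)"
proof -
  have "\<exists>Q\<in>hamiltonians. \<forall>g. symmetric g \<longrightarrow> Q g = app (Es k) g" for k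
    by (intro hamiltonian_of_central esym_central)
  then obtain R where R: "\<And>k. R k \<in> hamiltonians" "\<And>k g. symmetric g \<Longrightarrow> R k g = app (Es k) g"
    by metis
  \<comment> \<open>The k-th variable, counted from 0, receives the elementary symmetric polynomial
    of degree k + 1; the one of degree 0 is skipped.\<close>
  define H :: "'n \<Rightarrow> 'n ratop" where "H i = R (inv_into {..<CARD('n)} enum i)" for i
  have H: "H (enum k) g = app (Es k) g" if "k < CARD('n)" "symmetric g" for k g
    using that R(2) bij_enum[where 'n = 'n] by (simp add: H_def bij_betw_def inv_into_f_f)
  have "algebraically_independent H"
    unfolding algebraically_independent_def
  proof (intro allI impI)
    fix p :: "'n mpol" assume p: "op_eval H p = (\<lambda>f. 0)"
    \<comment> \<open>The polynomial obtained from p by substituting the elementary symmetric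
      polynomials; its evaluation at the D_i restricts on symmetric functions to
      \<open>op_eval H p\<close>.\<close>
    let ?c = "\<Sum>m\<in>keys p. single 0 (lookup p m) *
      monom (\<lambda>k. esym y_var (CARD('n)) (Suc k)) m :: 'n mpol"
    have mon: "monom (\<lambda>k. D.ev (esym y_var (CARD('n)) (Suc k))) m = monom Es m" for m :: "'n \<Rightarrow>\<^sub>0 nat"
      by (simp add: D.ev_esym)
    have ev0: "app (D.ev ?c) g = 0" if g: "symmetric g" for g :: "'n ratfun"
    proof -
      have "app (D.ev ?c) g = (\<Sum>m\<in>keys p. cst (lookup p m) * app (monom Es m) g)"
        by (simp add: D.ev_sum D.ev_mult D.ev_single D.ev_monom mon sum_app)
      also have "\<dots> = op_eval H p g"
        by (simp add: op_eval_def op_monomial_eq[OF H g])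
      finally show ?thesis by (simp add: p)
    qed
    have "?c = 0" by (rule D_ev_injective[OF q]) (rule ev0)
    then show "p = 0" by (rule esym_algebraically_independent)
  qed
  moreover have "range H \<subseteq> hamiltonians" using R(1) by (auto simp: H_def)
  ultimately show ?thesis
    unfolding completely_integrable_def using commutative_hamiltonians H21_hamiltonian by blast
qed

end

theorem proposition5p5:
  fixes q t \<alpha> \<beta> :: complex
  assumes "q \<noteq> 0" and "\<forall>k::nat. k > 0 \<longrightarrow> q ^ k \<noteq> 1" and "t \<noteq> 0"
  shows "completely_integrable q (H21 q t \<alpha> \<beta> :: 'n::{finite,linorder} ratop)"
proof -
  interpret quantum_params q t \<alpha> \<beta> "TYPE('n)" by unfold_locales fact+
  show ?thesis using assms(2) by (rule completely_integrable_H21)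
qed

end
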